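(* Let $H_1,\ldots,H_L$ and $G$ be Hermitian operators on a finite-dimensional Hilbert space. Let $\rho:=e^{-G}/\mathrm{Tr}[e^{-G}]$ and, for $\phi\in\mathbb{R}^L$, let $H(\phi):=\sum_{j=1}^L\phi_jH_j$ and $\sigma(\phi):=e^{-iH(\phi)}\rho\,e^{iH(\phi)}$. For all $\alpha\in(0,1)$ and $z>0$, the $\alpha$-$z$ information matrix of the family $(\sigma(\phi))_{\phi\in\mathbb{R}^L}$ satisfies $$[I_{\alpha,z}(\phi)]_{i,j}=\left\langle\left[\Phi_{p_{\alpha,z}}(\Psi_\phi(H_i)),[G,\Psi_\phi(H_j)]\right]\right\rangle_\rho,$$ where the channels $\Psi_\phi$ and $\Phi_{p_{\alpha,z}}$ are $$\Psi_\phi(X):=\int_0^1dt\;e^{iH(\phi)t}Xe^{-iH(\phi)t},\qquad \Phi_{p_{\alpha,z}}(X):=\int_{-\infty}^\infty dt\;p_{\alpha,z}(t)\,e^{-iGt}Xe^{iGt},$$ and $p_{\alpha,z}$ is the probability density function on $\mathbb{R}$ defined by $$p_{\alpha,z}(t):=\frac{z}{2\pi\alpha(1-\alpha)}\ln\left(1+\left(\frac{\sin(\pi\alpha)}{\sinh(\pi zt)}\right)^2\right).$$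
   Context: For positive definite states (unit-trace operators) $\rho,\sigma$, $\alpha\in(0,1)\cup(1,\infty)$ and $z>0$, the $\alpha$-$z$ Rényi relative entropy is $D_{\alpha,z}(\rho\|\sigma):=\frac{1}{\alpha-1}\ln\mathrm{Tr}\big[(\sigma^{\frac{1-\alpha}{2z}}\rho^{\frac\alpha z}\sigma^{\frac{1-\alpha}{2z}})^z\big]$, and the $\alpha$-$z$ information matrix of the family $(\sigma(\phi))_\phi$ has entries $[I_{\alpha,z}(\phi)]_{i,j}:=\frac1\alpha\left.\frac{\partial^2}{\partial\varepsilon_i\partial\varepsilon_j}D_{\alpha,z}(\sigma(\phi)\|\sigma(\phi+\varepsilon))\right|_{\varepsilon=0}$. Notation: $\langle X\rangle_\rho:=\mathrm{Tr}[X\rho]$ and $[A,B]:=AB-BA$. The density $p_{\alpha,z}$ has an integrable logarithmic singularity at $t=0$. *)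

theory Defs
  imports "HOL-Analysis.Analysis"
begin

text \<open>
  Operators on a finite-dimensional Hilbert space are complex square matrices
  \<open>complex^'n^'n\<close> acting on \<open>complex^'n\<close>. On this type \<open>*\<close> and \<open>^\<close> are componentwise, so
  matrix powers and the matrix exponential are defined from \<open>**\<close>.
\<close>

definition cscale :: "complex \<Rightarrow> complex^'n^'n \<Rightarrow> complex^'n^'n" where
  "cscale c A = (\<chi> i j. c * A $ i $ j)"

definition dagger :: "complex^'n^'n \<Rightarrow> complex^'n^'n" where
  "dagger A = (\<chi> i j. cnj (A $ j $ i))"

definition hermitian :: "complex^'n^'n \<Rightarrow> bool" where
  "hermitian A \<longleftrightarrow> dagger A = A"

definition unitary :: "complex^'n^'n \<Rightarrow> bool" where
  "unitary U \<longleftrightarrow> dagger U ** U = mat 1 \<and> U ** dagger U = mat 1"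

definition real_diag :: "('n \<Rightarrow> real) \<Rightarrow> complex^'n^'n" where
  "real_diag d = (\<chi> i j. if i = j then complex_of_real (d i) else 0)"

definition commutator :: "complex^'n^'n \<Rightarrow> complex^'n^'n \<Rightarrow> complex^'n^'n" where
  "commutator A B = A ** B - B ** A"

primrec matpow :: "complex^'n^'n \<Rightarrow> nat \<Rightarrow> complex^'n^'n" where
  "matpow A 0 = mat 1"
| "matpow A (Suc k) = A ** matpow A k"

definition mat_exp :: "complex^'n^'n \<Rightarrow> complex^'n^'n" where
  "mat_exp A = (\<Sum>k. (1 / fact k) *\<^sub>R matpow A k)"

text \<open>
  Functional calculus for Hermitian matrices: the value does not depend on the chosen
  spectral decomposition.  Nothing is claimed if \<open>A\<close> is not Hermitian.
\<close>

definition spectral_fun :: "(real \<Rightarrow> real) \<Rightarrow> complex^'n^'n \<Rightarrow> complex^'n^'n" where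
  "spectral_fun f A = (THE B. \<exists>U d. unitary U
      \<and> A = U ** real_diag d ** dagger U
      \<and> B = U ** real_diag (\<lambda>i. f (d i)) ** dagger U)"

text \<open>Real powers; meant for positive definite matrices, whose eigenvalues are positive.\<close>

definition mat_powr :: "complex^'n^'n \<Rightarrow> real \<Rightarrow> complex^'n^'n" where
  "mat_powr A s = spectral_fun (\<lambda>x. x powr s) A"

text \<open>
  For positive definite \<open>\<rho>\<close> and \<open>\<sigma>\<close> the trace below is a positive real number, so that
  taking \<open>Re\<close> only changes its type.
\<close>

definition renyi_az ::
  "real \<Rightarrow> real \<Rightarrow> complex^'n^'n \<Rightarrow> complex^'n^'n \<Rightarrow> real" where
  "renyi_az \<alpha> z \<rho> \<sigma> = 1 / (\<alpha> - 1) *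
     ln (Re (trace (mat_powr
       (mat_powr \<sigma> ((1 - \<alpha>) / (2 * z)) ** mat_powr \<rho> (\<alpha> / z)
          ** mat_powr \<sigma> ((1 - \<alpha>) / (2 * z))) z)))"

definition partial_deriv :: "'l \<Rightarrow> (real^'l \<Rightarrow> real) \<Rightarrow> real^'l \<Rightarrow> real" where
  "partial_deriv i f x = deriv (\<lambda>s. f (x + s *\<^sub>R axis i 1)) 0"

definition has_partial_at :: "'l \<Rightarrow> (real^'l \<Rightarrow> real) \<Rightarrow> real^'l \<Rightarrow> bool" where
  "has_partial_at i f x \<longleftrightarrow> (\<lambda>s. f (x + s *\<^sub>R axis i 1)) field_differentiable at 0"

text \<open>
  Since \<open>deriv\<close> is total, existence of \<open>\<partial>\<^sub>i (\<partial>\<^sub>j f)\<close> at \<open>x\<close> is a separate predicate.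
\<close>

definition has_second_partial_at ::
  "'l \<Rightarrow> 'l \<Rightarrow> (real^'l \<Rightarrow> real) \<Rightarrow> real^'l \<Rightarrow> bool" where
  "has_second_partial_at i j f x \<longleftrightarrow>
     (\<forall>\<^sub>F y in nhds x. has_partial_at j f y) \<and> has_partial_at i (partial_deriv j f) x"

definition info_matrix ::
  "real \<Rightarrow> real \<Rightarrow> (real^'l \<Rightarrow> complex^'n^'n) \<Rightarrow> real^'l \<Rightarrow> real^'l^'l" where
  "info_matrix \<alpha> z \<sigma> \<phi> = (\<chi> i j. 1 / \<alpha> *
     partial_deriv i (partial_deriv j (\<lambda>\<epsilon>. renyi_az \<alpha> z (\<sigma> \<phi>) (\<sigma> (\<phi> + \<epsilon>)))) 0)"

definition gibbs :: "complex^'n^'n \<Rightarrow> complex^'n^'n" where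
  "gibbs G = cscale (1 / trace (mat_exp (- G))) (mat_exp (- G))"

definition expect :: "complex^'n^'n \<Rightarrow> complex^'n^'n \<Rightarrow> complex" where
  "expect \<rho> X = trace (X ** \<rho>)"

definition hamiltonian :: "('l \<Rightarrow> complex^'n^'n) \<Rightarrow> real^'l \<Rightarrow> complex^'n^'n" where
  "hamiltonian H \<phi> = (\<Sum>j\<in>UNIV. (\<phi> $ j) *\<^sub>R H j)"

definition evolved ::
  "('l \<Rightarrow> complex^'n^'n) \<Rightarrow> complex^'n^'n \<Rightarrow> real^'l \<Rightarrow> complex^'n^'n" where
  "evolved H \<rho> \<phi> =
     mat_exp (cscale (- \<i>) (hamiltonian H \<phi>)) ** \<rho> ** mat_exp (cscale \<i> (hamiltonian H \<phi>))"

definition Psi ::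
  "('l \<Rightarrow> complex^'n^'n) \<Rightarrow> real^'l \<Rightarrow> complex^'n^'n \<Rightarrow> complex^'n^'n" where
  "Psi H \<phi> X = (LINT t:{0..1}|lborel.
     mat_exp (cscale (\<i> * complex_of_real t) (hamiltonian H \<phi>)) ** X
       ** mat_exp (cscale (- \<i> * complex_of_real t) (hamiltonian H \<phi>)))"

definition Phi ::
  "(real \<Rightarrow> real) \<Rightarrow> complex^'n^'n \<Rightarrow> complex^'n^'n \<Rightarrow> complex^'n^'n" where
  "Phi p G X = (LINT t|lborel. p t *\<^sub>R
     (mat_exp (cscale (- \<i> * complex_of_real t) G) ** X
       ** mat_exp (cscale (\<i> * complex_of_real t) G)))"

text \<open>
  The logarithmic singularity at \<open>t = 0\<close> is a null set; with \<open>x / 0 = 0\<close> the density takes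
  the value \<open>0\<close> there.
\<close>

definition p_az :: "real \<Rightarrow> real \<Rightarrow> real \<Rightarrow> real" where
  "p_az \<alpha> z t = z / (2 * pi * \<alpha> * (1 - \<alpha>)) *
     ln (1 + (sin (pi * \<alpha>) / sinh (pi * z * t))\<^sup>2)"

definition is_prob_density :: "(real \<Rightarrow> real) \<Rightarrow> bool" where
  "is_prob_density p \<longleftrightarrow> (\<forall>t. 0 \<le> p t) \<and> has_bochner_integral lborel p 1"

text \<open>
  An \<open>m\<close> by \<open>m\<close> block matrix with blocks \<open>X k l\<close> is an operator on the tensor product of
  \<open>complex^'n\<close> with an \<open>m\<close>-dimensional space; applying \<open>\<Lambda>\<close> to each block is the ampliation of \<open>\<Lambda>\<close>.
  Complete positivity is positivity of all ampliations.
\<close>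

definition block_psd :: "nat \<Rightarrow> (nat \<Rightarrow> nat \<Rightarrow> complex^'n^'n) \<Rightarrow> bool" where
  "block_psd m X \<longleftrightarrow> (\<forall>v :: nat \<Rightarrow> complex^'n.
     (\<Sum>k<m. \<Sum>l<m. \<Sum>a\<in>UNIV. cnj (v k $ a) * (X k l *v v l) $ a) \<in> \<real>\<^sub>\<ge>\<^sub>0)"

definition completely_positive :: "(complex^'n^'n \<Rightarrow> complex^'n^'n) \<Rightarrow> bool" where
  "completely_positive \<Lambda> \<longleftrightarrow>
     (\<forall>m X. block_psd m X \<longrightarrow> block_psd m (\<lambda>k l. \<Lambda> (X k l)))"

definition is_channel :: "(complex^'n^'n \<Rightarrow> complex^'n^'n) \<Rightarrow> bool" where
  "is_channel \<Lambda> \<longleftrightarrow>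
     (\<forall>X Y. \<Lambda> (X + Y) = \<Lambda> X + \<Lambda> Y) \<and> (\<forall>c X. \<Lambda> (cscale c X) = cscale c (\<Lambda> X))
     \<and> completely_positive \<Lambda> \<and> (\<forall>X. trace (\<Lambda> X) = trace X)"

end

theory Submission
  imports Defs
begin

text \<open>
  Both sides are computed in an eigenbasis of \<open>G\<close>, where \<open>\<rho>\<close> is diagonal with entries \<open>r\<^sub>p = exp (- g\<^sub>p) / Z\<close>.
  Up to a unitary conjugation the operator whose \<open>z\<close>-th power is traced is
  \<open>M = C W A W\<^sup>* C\<close>, where \<open>C\<close> and \<open>A\<close> are the powers of \<open>\<rho>\<close> with exponents \<open>(1-\<alpha>)/(2z)\<close> and
  \<open>\<alpha>/z\<close>, and \<open>W\<close> is unitary and equals \<open>1\<close> at \<open>\<epsilon> = 0\<close>, where its derivative in the direction \<open>j\<close>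
  is \<open>\<i> \<Psi>(H\<^sub>j)\<close> by Duhamel's formula. The spectrum of \<open>M\<close> lies in \<open>(0, 2)\<close> near
  \<open>\<epsilon> = 0\<close>, so \<open>M\<^sup>z\<close> is a binomial series in \<open>M - 1\<close> that can be differentiated termwise. The second
  derivative of the trace comes out as a sum over \<open>\<Psi>(H\<^sub>i)\<^sub>p\<^sub>q \<Psi>(H\<^sub>j)\<^sub>q\<^sub>p\<close> with weights
  \<open>- z (a\<^sub>p - a\<^sub>q) (b\<^sub>p - b\<^sub>q) (r\<^sub>p - r\<^sub>q) / (m\<^sub>p - m\<^sub>q)\<close>, where \<open>a\<close>, \<open>b\<close>, \<open>m\<close> are the powers of \<open>r\<close> with exponents
  \<open>\<alpha>/z\<close>, \<open>(1-\<alpha>)/z\<close>, \<open>1/z\<close>.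

  The right-hand side is the same sum with the Fourier transform of \<open>p_az\<close> at \<open>g\<^sub>p - g\<^sub>q\<close> as weight. It is
  found by expanding \<open>ln (1 + (sin (\<pi>\<alpha>) / sinh s)\<^sup>2)\<close> in powers of \<open>exp (- 2 s)\<close>, integrating termwise, and
  summing the result by the cosine series of \<open>cosh (c (\<pi> - t))\<close>; a continuous function on \<open>[0, \<pi>]\<close>
  is determined by its cosine moments because polynomials in \<open>cos\<close> are dense.
\<close>

section \<open>Cosine series\<close>

text \<open>For general \<open>z\<close> the power \<open>M ^ z\<close> is defined through
  eigenvectors, which need not vary smoothly where eigenvalues cross. The series in
  \<open>M - 1\<close> avoids them: at \<epsilon> = 0 the eigenvalues of \<open>M\<close> are the
  powers \<open>m p\<close> of probabilities, so they lie in (0, 1], and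
  \<open>opnorm (M - mat 1) < 1\<close> is an open condition. The same neighbourhood supplies the
  first partial derivatives at points near 0, on which existence of the second one depends.
  Cyclicity of the trace turns the first derivative into
  \<open>z * trace (M ^ (z - 1) ** Mj)\<close>, so only one noncommutative derivative is left, that
  of \<open>M ^ (z - 1)\<close>; its eigenbasis entries are divided differences. At \<epsilon> = 0
  the trace is 1 and its first derivatives vanish, so the logarithm does not alter the second
  derivative. For pairs with \<open>m p = m q\<close> the weights contain 0 / 0, read as 0; this is
  the correct value because \<open>a\<close> and \<open>b\<close> then agree as well. On the
  analytic side, the sum of the L1 norms of the exponential terms converges. This gives
  integrability of the density across its singularity, its Fourier transform and its total mass at
  once.\<close>

lemma integral_cos_mult:
  fixes a :: int
  shows "integral {0..pi} (\<lambda>t. cos (of_int a * t)) = (if a = 0 then pi else 0)"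
proof (cases "a = 0")
  case False
  have "((\<lambda>t. cos (of_int a * t)) has_integral (sin (of_int a * pi) / of_int a - sin (of_int a * 0) / of_int a)) {0..pi}"
    using False
    by (intro fundamental_theorem_of_calculus)
       (auto intro!: derivative_eq_intros simp flip: has_real_derivative_iff_has_vector_derivative)
  moreover have "sin (of_int a * pi) = 0"
    by (simp add: sin_integer_2pi sin_times_pi_eq_0)
  ultimately show ?thesis using False by (simp add: integral_unique)
qed auto

lemma integral_cos_cos:
  fixes k m :: nat
  shows "integral {0..pi} (\<lambda>t. cos (real k * t) * cos (real m * t))
           = (if k = m then (if k = 0 then pi else pi / 2) else 0)"
proof -
  have "integral {0..pi} (\<lambda>t. cos (real k * t) * cos (real m * t))
      = integral {0..pi} (\<lambda>t. (cos (of_int (int k - int m) * t) + cos (of_int (int k + int m) * t)) / 2)"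
    by (intro integral_cong) (simp add: cos_times_cos algebra_simps)
  also have "\<dots> = (integral {0..pi} (\<lambda>t. cos (of_int (int k - int m) * t))
                  + integral {0..pi} (\<lambda>t. cos (of_int (int k + int m) * t))) / 2"
    by (subst integral_divide, subst Henstock_Kurzweil_Integration.integral_add)
       (auto intro!: integrable_continuous_interval continuous_intros)
  finally show ?thesis unfolding integral_cos_mult by auto
qed

text \<open>Stone-Weierstrass supplies a polynomial \<open>g\<close> in \<open>cos\<close> close to
  \<open>D\<close>. Since the integral of \<open>D * g\<close> is zero, the integral of
  \<open>D * D\<close> is at most the uniform error times the integral of \<bar>D\<bar>.\<close>

lemma cosine_moments_zero:
  fixes D :: "real \<Rightarrow> real"
  assumes D: "continuous_on {0..pi} D"
    and mom: "\<And>k::nat. integral {0..pi} (\<lambda>t. D t * cos (real k * t)) = 0"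
    and t: "t \<in> {0..pi}"
  shows "D t = 0"
proof -
  define A where "A g \<longleftrightarrow> (\<forall>k::nat. integral {0..pi} (\<lambda>t. D t * g t * cos (real k * t)) = 0)"
    for g :: "real \<Rightarrow> real"
  \<comment> \<open>\<open>P\<close> collects the multipliers that keep all cosine moments of
    \<open>D * g\<close> zero. In this form closure under products is immediate, and powers of
    \<open>cos\<close> never have to be expanded into cosines of multiples.\<close>
  define P where "P f \<longleftrightarrow> continuous_on {0..pi} f \<and>
      (\<forall>g. continuous_on {0..pi} g \<and> A g \<longrightarrow> A (\<lambda>t. f t * g t))" for f :: "real \<Rightarrow> real"
  have cosP: "P cos"
    unfolding P_def
  proof (intro conjI allI impI)
    fix g assume g: "continuous_on {0..pi} g \<and> A g"
    show "A (\<lambda>t. cos t * g t)"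
      unfolding A_def
    proof
      fix k :: nat
      \<comment> \<open>For \<open>k = 0\<close> the two neighbouring frequencies are 1 and -1; as
        the cosine is even, index 1 stands for both.\<close>
      have split: "cos t * cos (real k * t)
             = cos (real (Suc k) * t) / 2 + cos (real (if k = 0 then 1 else k - 1) * t) / 2" for t
      proof (cases k)
        case (Suc l)
        have "t - real k * t = - (real l * t)" "t + real k * t = real (Suc k) * t"
          using Suc by (simp_all add: algebra_simps)
        then show ?thesis using Suc by (simp add: cos_times_cos)
      qed simp
      have "integral {0..pi} (\<lambda>t. D t * (cos t * g t) * cos (real k * t))
          = integral {0..pi} (\<lambda>t. D t * g t * cos (real (Suc k) * t) / 2
                + D t * g t * cos (real (if k = 0 then 1 else k - 1) * t) / 2)"
      proof (intro integral_cong)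
        fix t
        have "D t * (cos t * g t) * cos (real k * t) = D t * g t * (cos t * cos (real k * t))"
          by (simp add: mult_ac)
        also have "\<dots> = D t * g t * cos (real (Suc k) * t) / 2
                + D t * g t * cos (real (if k = 0 then 1 else k - 1) * t) / 2"
          unfolding split by (simp only: distrib_left times_divide_eq_right)
        finally show "D t * (cos t * g t) * cos (real k * t) = \<dots>" .
      qed
      also have "\<dots> = integral {0..pi} (\<lambda>t. D t * g t * cos (real (Suc k) * t)) / 2
            + integral {0..pi} (\<lambda>t. D t * g t * cos (real (if k = 0 then 1 else k - 1) * t)) / 2"
        by (subst Henstock_Kurzweil_Integration.integral_add)
           (use g D in \<open>auto intro!: integrable_continuous_interval continuous_intros\<close>)
      also have "\<dots> = 0"
      proof -
        have h: "integral {0..pi} (\<lambda>t. D t * g t * cos (real m * t)) = 0" for m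
          using g unfolding A_def by blast
        show ?thesis unfolding h by simp
      qed
      finally show "integral {0..pi} (\<lambda>t. D t * (cos t * g t) * cos (real k * t)) = 0" .
    qed
  qed (intro continuous_intros)
  have Pconst: "P (\<lambda>x. c)" for c
    unfolding P_def A_def
    by (auto simp: mult.assoc mult.left_commute[of _ c])
  have Padd: "P (\<lambda>x. f x + g x)" if "P f \<and> P g" for f g
    unfolding P_def
  proof (intro conjI allI impI)
    show "continuous_on {0..pi} (\<lambda>x. f x + g x)"
      using that unfolding P_def by (intro continuous_intros) auto
    fix h assume h: "continuous_on {0..pi} h \<and> A h"
    then have "A (\<lambda>t. f t * h t)" "A (\<lambda>t. g t * h t)" using that unfolding P_def by auto
    then show "A (\<lambda>t. (f t + g t) * h t)"
      unfolding A_def distrib_left distrib_right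
      by (subst Henstock_Kurzweil_Integration.integral_add)
         (use D h that P_def in \<open>auto intro!: integrable_continuous_interval continuous_intros\<close>)
  qed
  have Pmult: "P (\<lambda>x. f x * g x)" if "P f \<and> P g" for f g
    unfolding P_def
  proof (intro conjI allI impI)
    show "continuous_on {0..pi} (\<lambda>x. f x * g x)"
      using that unfolding P_def by (intro continuous_intros) auto
    fix h assume h: "continuous_on {0..pi} h \<and> A h"
    then have "A (\<lambda>t. g t * h t)" "continuous_on {0..pi} (\<lambda>t. g t * h t)"
      using that unfolding P_def by (auto intro!: continuous_intros)
    then have "A (\<lambda>t. f t * (g t * h t))" using that unfolding P_def by auto
    then show "A (\<lambda>t. f t * g t * h t)" by (simp add: mult.assoc)
  qed
  have Psep: "\<exists>f. P f \<and> f x \<noteq> f y" if "x \<in> {0..pi} \<and> y \<in> {0..pi} \<and> x \<noteq> y" for x y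
    using that cosP cos_inj_pi[of x y] by (intro exI[of _ cos]) auto
  have approx: "\<exists>g. P g \<and> (\<forall>x\<in>{0..pi}. \<bar>D x - g x\<bar> < e)" if "e > 0" for e
    by (rule Stone_Weierstrass_HOL[of "{0..pi}" P]) (use Pconst Padd Pmult Psep D that P_def in auto)
  define J where "J = integral {0..pi} (\<lambda>t. \<bar>D t\<bar>)"
  have J0: "J \<ge> 0" unfolding J_def
    by (intro integral_nonneg integrable_continuous_interval continuous_intros D) auto
  have le: "integral {0..pi} (\<lambda>t. D t * D t) \<le> e * J" if e: "e > 0" for e
  proof -
    obtain g where g: "P g" "\<And>x. x \<in> {0..pi} \<Longrightarrow> \<bar>D x - g x\<bar> < e" using approx[OF e] by blast
    have cg: "continuous_on {0..pi} g" using g unfolding P_def by auto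
    have "A (\<lambda>t. 1)" using mom unfolding A_def by simp
    then have "A (\<lambda>t. g t * 1)"
      using g(1) continuous_on_const[of "{0..pi}" "1::real"] unfolding P_def by blast
    then have "integral {0..pi} (\<lambda>t. D t * g t) = 0" unfolding A_def by (auto dest: spec[of _ 0])
    then have "integral {0..pi} (\<lambda>t. D t * D t) = integral {0..pi} (\<lambda>t. D t * D t) - integral {0..pi} (\<lambda>t. D t * g t)"
      by simp
    also have "\<dots> = integral {0..pi} (\<lambda>t. D t * D t - D t * g t)"
      by (rule Henstock_Kurzweil_Integration.integral_diff[symmetric])
         (intro integrable_continuous_interval continuous_intros D cg)+
    also have "\<dots> \<le> integral {0..pi} (\<lambda>t. e * \<bar>D t\<bar>)"
    proof (rule integral_le)
      fix t assume t: "t \<in> {0..pi}"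
      have "D t * D t - D t * g t \<le> \<bar>D t * (D t - g t)\<bar>" by (simp add: algebra_simps)
      also have "\<dots> \<le> \<bar>D t\<bar> * e" unfolding abs_mult using g(2)[OF t] by (intro mult_left_mono) auto
      finally show "D t * D t - D t * g t \<le> e * \<bar>D t\<bar>" by (simp add: mult.commute)
    qed (intro integrable_continuous_interval continuous_intros D cg)+
    also have "\<dots> = e * J" unfolding J_def by simp
    finally show ?thesis .
  qed
  have "integral {0..pi} (\<lambda>t. D t * D t) \<le> 0"
  proof (rule field_le_epsilon)
    fix e :: real assume e: "e > 0"
    \<comment> \<open>The denominator \<open>J + 1\<close> also covers \<open>J = 0\<close>.\<close>
    have "e / (J + 1) * J \<le> e" using J0 e by (simp add: field_simps)
    with le[of "e / (J + 1)"] e J0 show "integral {0..pi} (\<lambda>t. D t * D t) \<le> 0 + e" by simp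
  qed
  moreover have "integral {0..pi} (\<lambda>t. D t * D t) \<ge> 0"
    by (intro integral_nonneg integrable_continuous_interval continuous_intros D) auto
  ultimately have "integral {0..pi} (\<lambda>t. D t * D t) = 0" by simp
  then have "\<forall>t\<in>{0..pi}. D t * D t = 0"
    by (subst (asm) integral_eq_0_iff) (auto intro!: continuous_intros D)
  then show ?thesis using t by auto
qed

text \<open>Absolute summability makes the series converge uniformly, so its sum is continuous and
  its moments can be taken termwise. The difference from \<open>F\<close> then has only zero
  moments. The \<open>c k\<close> are unnormalised moments, whence the factors pi / 2 and 1 /
  2.\<close>

lemma cosine_series:
  fixes F :: "real \<Rightarrow> real" and c :: "nat \<Rightarrow> real"
  assumes F: "continuous_on {0..pi} F"
    and c: "\<And>k::nat. integral {0..pi} (\<lambda>t. F t * cos (real k * t)) = c k"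
    and sum: "summable (\<lambda>k. \<bar>c k\<bar>)"
    and t: "t \<in> {0..pi}"
  shows "(\<lambda>k. c (Suc k) * cos (real (Suc k) * t)) sums (pi / 2 * F t - c 0 / 2)"
proof -
  have sum': "summable (\<lambda>k. \<bar>c (Suc k)\<bar>)" using sum summable_Suc_iff[of "\<lambda>k. \<bar>c k\<bar>"] by simp
  define S where "S t = (\<Sum>k. c (Suc k) * cos (real (Suc k) * t))" for t
  have ul: "uniform_limit {0..pi} (\<lambda>n t. \<Sum>k<n. c (Suc k) * cos (real (Suc k) * t)) S sequentially"
    unfolding S_def
    by (rule Weierstrass_m_test[OF _ sum']) (auto simp: abs_mult intro!: mult_left_le)
  have S: "continuous_on {0..pi} S"
    by (rule uniform_limit_theorem[OF _ ul]) (auto intro!: continuous_intros always_eventually)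
  have mom: "integral {0..pi} (\<lambda>t. (pi / 2 * F t - c 0 / 2 - S t) * cos (real m * t)) = 0" for m :: nat
  proof -
    have "uniform_limit {0..pi} (\<lambda>n t. (\<Sum>k<n. c (Suc k) * cos (real (Suc k) * t)) * cos (real m * t))
            (\<lambda>t. S t * cos (real m * t)) sequentially"
    proof (rule uniform_limit_cong'[THEN iffD1, OF _ _ uniform_lim_mult[OF ul uniform_limit_const]])
      show "bounded (S ` {0..pi})" by (intro compact_imp_bounded compact_continuous_image S) auto
      show "bounded ((\<lambda>t. cos (real m * t)) ` {0..pi})"
        by (intro compact_imp_bounded compact_continuous_image continuous_intros) auto
    qed auto
    then obtain I J where IJ: "\<And>n. ((\<lambda>t. (\<Sum>k<n. c (Suc k) * cos (real (Suc k) * t)) * cos (real m * t)) has_integral I n) {0..pi}"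
        "((\<lambda>t. S t * cos (real m * t)) has_integral J) {0..pi}" "I \<longlonglongrightarrow> J"
      by (rule uniform_limit_integral) (auto intro!: continuous_intros)
    have "I n = (\<Sum>k<n. c (Suc k) * (if Suc k = m then pi / 2 else 0))" for n
    proof -
      have "I n = integral {0..pi} (\<lambda>t. (\<Sum>k<n. c (Suc k) * (cos (real (Suc k) * t) * cos (real m * t))))"
        using IJ(1)[of n] by (simp add: integral_unique sum_distrib_right mult.assoc)
      also have "\<dots> = (\<Sum>k<n. integral {0..pi} (\<lambda>t. c (Suc k) * (cos (real (Suc k) * t) * cos (real m * t))))"
        by (intro integral_sum) (auto intro!: integrable_continuous_interval continuous_intros)
      also have "\<dots> = (\<Sum>k<n. c (Suc k) * (if Suc k = m then pi / 2 else 0))"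
        by (intro sum.cong refl) (simp only: integral_mult_right integral_cos_cos, simp)
      finally show ?thesis .
    qed
    moreover have "(\<lambda>n. \<Sum>k<n. c (Suc k) * (if Suc k = m then pi / 2 else 0))
        \<longlonglongrightarrow> (if m = 0 then 0 else c m * (pi / 2))"
    proof (cases m)
      case (Suc l)
      have "(\<lambda>k. if k = l then c (Suc k) * (pi / 2) else 0) sums (c (Suc l) * (pi / 2))"
        by (rule sums_single)
      also have "(\<lambda>k. if k = l then c (Suc k) * (pi / 2) else 0)
          = (\<lambda>k. c (Suc k) * (if Suc k = m then pi / 2 else 0))" using Suc by auto
      finally show ?thesis using Suc by (simp add: sums_def)
    qed simp
    ultimately have J: "J = (if m = 0 then 0 else c m * (pi / 2))"
      using IJ(3) by (intro LIMSEQ_unique[of I]) presburger+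
    have "integral {0..pi} (\<lambda>t. (pi / 2 * F t - c 0 / 2 - S t) * cos (real m * t))
        = integral {0..pi} (\<lambda>t. pi / 2 * (F t * cos (real m * t)) - c 0 / 2 * cos (real m * t) - S t * cos (real m * t))"
      by (simp add: algebra_simps)
    also have "\<dots> = pi / 2 * integral {0..pi} (\<lambda>t. F t * cos (real m * t))
         - c 0 / 2 * integral {0..pi} (\<lambda>t. cos (real m * t)) - integral {0..pi} (\<lambda>t. S t * cos (real m * t))"
      by (subst Henstock_Kurzweil_Integration.integral_diff,
          (auto intro!: integrable_continuous_interval continuous_intros F S)[2],
          subst Henstock_Kurzweil_Integration.integral_diff,
          (auto intro!: integrable_continuous_interval continuous_intros F S)[2], simp)
    also have "\<dots> = 0"
      using integral_cos_mult[of "int m"] J IJ(2) unfolding c by (auto simp: integral_unique)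
    finally show ?thesis .
  qed
  have "pi / 2 * F t - c 0 / 2 - S t = 0"
    by (rule cosine_moments_zero[OF _ mom t]) (intro continuous_intros F S)
  moreover have "summable (\<lambda>k. c (Suc k) * cos (real (Suc k) * t))"
    by (rule summable_comparison_test'[OF sum', of 0]) (auto simp: abs_mult intro!: mult_left_le)
  ultimately show ?thesis unfolding S_def by (auto simp: sums_iff)
qed

text \<open>The numbers \<open>c * sinh (c * pi) / (c^2 + k^2)\<close> are the cosine moments of
  \<open>cosh (c * (pi - t))\<close> on [0, pi]. Both sides are symmetric about \<open>pi\<close>,
  which extends the range to [0, 2 pi]; the series is later evaluated at 2 pi \<alpha>.\<close>

lemma sums_cos_over_square_plus:
  fixes c t :: real
  assumes c: "c > 0" and t: "0 \<le> t" "t \<le> 2 * pi"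
  shows "(\<lambda>k. cos (real (Suc k) * t) / ((real (Suc k))\<^sup>2 + c\<^sup>2)) sums
           (pi * cosh (c * (pi - t)) / (2 * c * sinh (c * pi)) - 1 / (2 * c\<^sup>2))"
proof -
  have main: "(\<lambda>k. cos (real (Suc k) * t) / ((real (Suc k))\<^sup>2 + c\<^sup>2)) sums
           (pi * cosh (c * (pi - t)) / (2 * c * sinh (c * pi)) - 1 / (2 * c\<^sup>2))"
    if t: "t \<in> {0..pi}" for t
  proof -
    have nz: "c\<^sup>2 + (real k)\<^sup>2 \<noteq> 0" for k
      using c by (metis add_pos_nonneg less_irrefl zero_less_power zero_le_power2)
    \<comment> \<open>Two integrations by parts give this antiderivative. At \<open>pi\<close> both
      \<open>sinh 0\<close> and \<open>sin (k * pi)\<close> vanish, so only the value at 0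
      remains.\<close>
    have "((\<lambda>t. cosh (c * (pi - t)) * cos (real k * t)) has_integral
        ((- c * sinh (c * (pi - pi)) * cos (real k * pi) + real k * cosh (c * (pi - pi)) * sin (real k * pi)) / (c\<^sup>2 + (real k)\<^sup>2)
       - (- c * sinh (c * (pi - 0)) * cos (real k * 0) + real k * cosh (c * (pi - 0)) * sin (real k * 0)) / (c\<^sup>2 + (real k)\<^sup>2))) {0..pi}"
      for k :: nat
    proof (intro fundamental_theorem_of_calculus)
      fix x
      have "((\<lambda>t. (- c * sinh (c * (pi - t)) * cos (real k * t) + real k * cosh (c * (pi - t)) * sin (real k * t)) / (c\<^sup>2 + (real k)\<^sup>2))
          has_real_derivative ((c\<^sup>2 + (real k)\<^sup>2) * (cosh (c * (pi - x)) * cos (real k * x))) / (c\<^sup>2 + (real k)\<^sup>2)) (at x within {0..pi})"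
        by (rule DERIV_cdivide, (rule derivative_eq_intros refl)+) (simp add: algebra_simps power2_eq_square)
      then show "((\<lambda>t. (- c * sinh (c * (pi - t)) * cos (real k * t) + real k * cosh (c * (pi - t)) * sin (real k * t)) / (c\<^sup>2 + (real k)\<^sup>2))
          has_vector_derivative cosh (c * (pi - x)) * cos (real k * x)) (at x within {0..pi})"
        using nz[of k] less_imp_neq[OF c] by (simp add: has_real_derivative_iff_has_vector_derivative)
    qed simp
    then have int: "integral {0..pi} (\<lambda>t. cosh (c * (pi - t)) * cos (real k * t)) = c * sinh (c * pi) / (c\<^sup>2 + (real k)\<^sup>2)"
      for k :: nat
      by (rule integral_unique[THEN trans]) simp
    have "summable (\<lambda>k. \<bar>c * sinh (c * pi) / (c\<^sup>2 + (real k)\<^sup>2)\<bar>)"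
    proof (rule summable_comparison_test'[of "\<lambda>k. \<bar>c * sinh (c * pi)\<bar> * (1 / (real k)\<^sup>2)" 1])
      show "summable (\<lambda>k. \<bar>c * sinh (c * pi)\<bar> * (1 / (real k)\<^sup>2))"
        using inverse_power_summable[of 2, where ?'a = real] by (intro summable_mult) (simp add: field_simps)
      fix k :: nat assume "k \<ge> 1"
      then have "\<bar>c * sinh (c * pi)\<bar> / (c\<^sup>2 + (real k)\<^sup>2) \<le> \<bar>c * sinh (c * pi)\<bar> / (real k)\<^sup>2"
        by (intro divide_left_mono mult_pos_pos add_nonneg_pos) auto
      then show "norm \<bar>c * sinh (c * pi) / (c\<^sup>2 + (real k)\<^sup>2)\<bar> \<le> \<bar>c * sinh (c * pi)\<bar> * (1 / (real k)\<^sup>2)"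
        by (simp add: abs_divide)
    qed
    moreover have "continuous_on {0..pi} (\<lambda>t. cosh (c * (pi - t)))" by (intro continuous_intros)
    ultimately have "(\<lambda>k. c * sinh (c * pi) / (c\<^sup>2 + (real (Suc k))\<^sup>2) * cos (real (Suc k) * t)) sums
         (pi / 2 * cosh (c * (pi - t)) - c * sinh (c * pi) / (c\<^sup>2 + (real 0)\<^sup>2) / 2)"
      using cosine_series[OF _ int _ t] by blast
    from sums_mult[OF this, of "1 / (c * sinh (c * pi))"]
    have "(\<lambda>k. 1 / (c * sinh (c * pi)) * (c * sinh (c * pi) / (c\<^sup>2 + (real (Suc k))\<^sup>2) * cos (real (Suc k) * t))) sums
         (1 / (c * sinh (c * pi)) * (pi / 2 * cosh (c * (pi - t)) - c * sinh (c * pi) / (c\<^sup>2 + (real 0)\<^sup>2) / 2))" .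
    moreover have "sinh (c * pi) > 0" using c by simp
    ultimately show ?thesis
      using c by (simp add: field_simps power2_eq_square)
  qed
  show ?thesis
  proof (cases "t \<le> pi")
    case False
    have cos_eq: "cos (real k * (2 * pi - t)) = cos (real k * t)" for k
      using cos_int_2pin[of "int k"] sin_int_2pin[of "int k"] by (simp add: right_diff_distrib cos_diff mult_ac)
    have cosh_eq: "cosh (c * (pi - (2 * pi - t))) = cosh (c * (pi - t))"
      using cosh_minus[of "c * (pi - t)"] by (simp add: algebra_simps)
    have "2 * pi - t \<in> {0..pi}" using False t by simp
    from main[OF this] show ?thesis unfolding cos_eq cosh_eq .
  qed (use main t in auto)
qed

text \<open>This is the limiting case \<open>c = 0\<close> of the preceding series, where the closed
  form there degenerates; it evaluates the Fourier transform at frequency 0. The generating function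
  is now \<open>(pi - t)^2\<close>.\<close>

lemma sums_cos_over_square:
  fixes t :: real
  assumes t: "0 \<le> t" "t \<le> 2 * pi"
  shows "(\<lambda>k. cos (real (Suc k) * t) / (real (Suc k))\<^sup>2) sums ((pi - t)\<^sup>2 / 4 - pi\<^sup>2 / 12)"
proof -
  have main: "(\<lambda>k. cos (real (Suc k) * t) / (real (Suc k))\<^sup>2) sums ((pi - t)\<^sup>2 / 4 - pi\<^sup>2 / 12)"
    if t: "t \<in> {0..pi}" for t
  proof -
    have int: "integral {0..pi} (\<lambda>t. (pi - t)\<^sup>2 * cos (real k * t)) = (if k = 0 then pi ^ 3 / 3 else 2 * pi / (real k)\<^sup>2)"
      for k :: nat
    proof (cases "k = 0")
      case True
      have "((\<lambda>t. (pi - t)\<^sup>2 * cos (real k * t)) has_integral (- ((pi - pi) ^ 3 / 3) - (- ((pi - 0) ^ 3 / 3)))) {0..pi}"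
        using True
        by (intro fundamental_theorem_of_calculus)
           (auto intro!: derivative_eq_intros simp: power2_eq_square simp flip: has_real_derivative_iff_has_vector_derivative)
      then show ?thesis using True by (simp add: integral_unique)
    next
      case False
      define F where "F = (\<lambda>t. (pi - t)\<^sup>2 * sin (real k * t) / real k - 2 * (pi - t) * cos (real k * t) / (real k)\<^sup>2
            - 2 * sin (real k * t) / (real k)^3)"
      have "((\<lambda>t. (pi - t)\<^sup>2 * cos (real k * t)) has_integral (F pi - F 0)) {0..pi}"
      proof (intro fundamental_theorem_of_calculus)
        fix x
        have "(F has_real_derivative (pi - x)\<^sup>2 * cos (real k * x)) (at x within {0..pi})"
          unfolding F_def using False
          by (auto intro!: derivative_eq_intros simp: field_simps power2_eq_square power3_eq_cube)
        then show "(F has_vector_derivative (pi - x)\<^sup>2 * cos (real k * x)) (at x within {0..pi})"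
          by (simp add: has_real_derivative_iff_has_vector_derivative)
      qed simp
      moreover have "F pi - F 0 = 2 * pi / (real k)\<^sup>2"
        unfolding F_def by (simp add: sin_npi)
      ultimately show ?thesis using False by (simp add: integral_unique)
    qed
    have "summable (\<lambda>k. \<bar>if k = 0 then pi ^ 3 / 3 else 2 * pi / (real k)\<^sup>2\<bar>)"
    proof (rule summable_comparison_test'[of "\<lambda>k. 2 * pi * (1 / (real k)\<^sup>2)" 1])
      show "summable (\<lambda>k. 2 * pi * (1 / (real k)\<^sup>2))"
        using inverse_power_summable[of 2, where ?'a = real] by (intro summable_mult) (simp add: field_simps)
    qed auto
    moreover have "continuous_on {0..pi} (\<lambda>t. (pi - t)\<^sup>2)" by (intro continuous_intros)
    ultimately have "(\<lambda>k. 2 * pi / (real (Suc k))\<^sup>2 * cos (real (Suc k) * t)) sums (pi / 2 * (pi - t)\<^sup>2 - pi ^ 3 / 3 / 2)"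
      using cosine_series[OF _ int _ t] by simp
    from sums_mult[OF this, of "1 / (2 * pi)"]
    have "(\<lambda>k. cos (real (Suc k) * t) / (real (Suc k))\<^sup>2) sums (1 / (2 * pi) * (pi / 2 * (pi - t)\<^sup>2 - pi ^ 3 / 3 / 2))"
      by simp
    also have "1 / (2 * pi) * (pi / 2 * (pi - t)\<^sup>2 - pi ^ 3 / 3 / 2) = (pi - t)\<^sup>2 / 4 - pi\<^sup>2 / 12"
      by (simp add: field_simps power2_eq_square power3_eq_cube)
    finally show ?thesis .
  qed
  show ?thesis
  proof (cases "t \<le> pi")
    case False
    have cos_eq: "cos (real k * (2 * pi - t)) = cos (real k * t)" for k
      using cos_int_2pin[of "int k"] sin_int_2pin[of "int k"] by (simp add: right_diff_distrib cos_diff mult_ac)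
    have square_eq: "(pi - (2 * pi - t))\<^sup>2 = (pi - t)\<^sup>2" by (simp add: power2_eq_square algebra_simps)
    have "2 * pi - t \<in> {0..pi}" using False t by simp
    from main[OF this] show ?thesis unfolding cos_eq square_eq .
  qed (use main t in auto)
qed

text \<open>With \<open>q = exp (- 2 * s)\<close> and \<open>w = q * cis (2 * a)\<close>, the
  argument of the logarithm equals \<open>(cmod (1 - w))^2 / (1 - q)^2\<close>. Both logarithms have
  a power series because \<open>q < 1\<close>.\<close>

lemma sums_ln_one_plus_sin_over_sinh:
  fixes a s :: real
  assumes s: "s > 0"
  shows "(\<lambda>k. 2 * (1 - cos (real (Suc k) * (2 * a))) / real (Suc k) * exp (- (2 * real (Suc k) * s)))
           sums ln (1 + (sin a / sinh s)\<^sup>2)"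
proof -
  define q where "q = exp (- (2 * s))"
  have q: "0 < q" "q < 1" using s by (auto simp: q_def)
  define w where "w = complex_of_real q * cis (2 * a)"
  have nw: "cmod (- w) < 1" using q by (simp add: w_def norm_mult)
  have w1: "1 - w \<noteq> 0" using nw by (auto simp: norm_minus_commute)
  from Ln_series'[OF nw] have "(\<lambda>n. - (w ^ n) / of_nat n) sums ln (1 - w)" by simp
  from sums_Re[OF this] have 1: "(\<lambda>n. - (q ^ n * cos (real n * (2 * a))) / real n) sums ln (cmod (1 - w))"
    using w1 by (simp add: w_def power_mult_distrib Complex.DeMoivre Re_divide_of_nat flip: of_real_power)
  have "(\<lambda>n. - (q ^ n) / real n) sums ln (1 - q)"
    using ln_series'[of "- q"] q by simp
  from sums_mult[OF sums_diff[OF 1 this], of 2]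
  have "(\<lambda>n. 2 * (1 - cos (real n * (2 * a))) / real n * q ^ n) sums (2 * (ln (cmod (1 - w)) - ln (1 - q)))"
    by (simp add: diff_divide_distrib algebra_simps)
  \<comment> \<open>The term with index 0 has denominator 0 and is therefore 0, so the sum may start
    at 1.\<close>
  then have "(\<lambda>n. 2 * (1 - cos (real (Suc n) * (2 * a))) / real (Suc n) * q ^ Suc n) sums (2 * (ln (cmod (1 - w)) - ln (1 - q)))"
    by (subst sums_Suc_iff) simp
  moreover have "q ^ n = exp (- (2 * real n * s))" for n
    unfolding q_def by (simp flip: exp_of_nat_mult) 
  moreover have "2 * (ln (cmod (1 - w)) - ln (1 - q)) = ln (1 + (sin a / sinh s)\<^sup>2)"
  proof -
    have "2 * (ln (cmod (1 - w)) - ln (1 - q)) = ln ((cmod (1 - w))\<^sup>2 / (1 - q)\<^sup>2)"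
      using w1 q by (subst ln_div) (auto simp: ln_realpow)
    also have "(cmod (1 - w))\<^sup>2 = (1 - q)\<^sup>2 + 4 * q * (sin a)\<^sup>2"
    proof -
      have "(cmod (1 - w))\<^sup>2 = (1 - q * cos (2 * a))\<^sup>2 + (q * sin (2 * a))\<^sup>2"
        by (simp add: cmod_power2 w_def)
      also have "\<dots> = 1 - 2 * q * cos (2 * a) + q\<^sup>2 * ((sin (2 * a))\<^sup>2 + (cos (2 * a))\<^sup>2)"
        by (simp only: power2_diff power_mult_distrib distrib_left) simp
      also have "\<dots> = (1 - q)\<^sup>2 + 4 * q * (sin a)\<^sup>2"
        unfolding sin_cos_squared_add unfolding cos_double_sin by (simp add: power2_diff algebra_simps)
      finally show ?thesis .
    qed
    also have "((1 - q)\<^sup>2 + 4 * q * (sin a)\<^sup>2) / (1 - q)\<^sup>2 = 1 + (sin a)\<^sup>2 * (4 * q / (1 - q)\<^sup>2)"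
      using q by (simp add: field_simps)
    also have "4 * q / (1 - q)\<^sup>2 = 1 / (sinh s)\<^sup>2"
    proof -
      have eq: "q = exp (- s) * exp (- s)" unfolding q_def by (simp flip: exp_add)
      have "1 - q = 2 * exp (- s) * sinh s"
        unfolding sinh_def eq by (simp add: algebra_simps flip: exp_add)
      then have "(1 - q)\<^sup>2 = 4 * q * (sinh s)\<^sup>2"
        by (simp add: eq power2_eq_square)
      then show ?thesis using q s by (simp add: field_simps)
    qed
    finally show ?thesis by (simp add: power_divide)
  qed
  ultimately show ?thesis by (simp only:)
qed

section \<open>The Fourier transform of the density\<close>

lemma has_bochner_integral_exp_halfline:
  fixes w :: complex
  assumes w: "Re w > 0"
  shows "has_bochner_integral lborel (\<lambda>t. indicator {0<..} t *\<^sub>R exp (- w * complex_of_real t)) (1 / w)"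
proof -
  have "(\<lambda>t. exp (- Re w * t)) absolutely_integrable_on {0..}"
    by (rule nonnegative_absolutely_integrable_1)
       (use integrable_on_exp_minus_to_infinity[OF w] in auto)
  \<comment> \<open>Absolute integrability refers to the completed measure; Borel measurability
    transfers it to \<open>lborel\<close>.\<close>
  then have "set_integrable lborel {0..} (\<lambda>t. exp (- Re w * t))"
    unfolding set_integrable_def by (rule integrable_completion[THEN iffD1, rotated]) measurable
  then have i0: "integrable lborel (\<lambda>t. indicator {0..} t *\<^sub>R exp (- Re w * t))"
    unfolding set_integrable_def .
  have int: "set_integrable lborel (einterval 0 \<infinity>) (\<lambda>t. exp (- w * complex_of_real t))"
    unfolding set_integrable_def
  proof (rule Bochner_Integration.integrable_bound[OF i0])
    show "(\<lambda>t. indicator (einterval 0 \<infinity>) t *\<^sub>R exp (- w * complex_of_real t)) \<in> borel_measurable lborel"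
      by (intro borel_measurable_scaleR borel_measurable_indicator) (auto intro!: borel_measurable_continuous_onI continuous_intros)
    show "AE t in lborel. norm (indicator (einterval 0 \<infinity>) t *\<^sub>R exp (- w * complex_of_real t)) \<le> norm (indicator {0..} t *\<^sub>R exp (- Re w * t))"
      by (auto simp: einterval_def indicator_def)
  qed
  have w0: "w \<noteq> 0" using w by (metis less_irrefl zero_complex.sel(1))
  have "(LBINT t=0..\<infinity>. exp (- w * complex_of_real t)) = 0 - (- 1 / w)"
  proof (rule interval_integral_FTC_integrable[where F = "\<lambda>t. - exp (- w * complex_of_real t) / w", OF _ _ _ int])
    fix x :: real
    show "((\<lambda>t. - exp (- w * complex_of_real t) / w) has_vector_derivative exp (- w * complex_of_real x)) (at x)"
      by (intro has_vector_derivative_real_field) (auto intro!: derivative_eq_intros simp: w0)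
    show "isCont (\<lambda>t. exp (- w * complex_of_real t)) x" by (intro continuous_intros)
  next
    have "((\<lambda>t. - exp (- w * complex_of_real t) / w) \<longlongrightarrow> - exp (- w * complex_of_real 0) / w) (at_right 0)"
      by (intro tendsto_intros) (simp_all add: w0)
    then show "(((\<lambda>t. - exp (- w * complex_of_real t) / w) \<circ> real_of_ereal) \<longlongrightarrow> - 1 / w) (at_right 0)"
      by (simp add: zero_ereal_def ereal_tendsto_simps1)
    have "((\<lambda>t. exp (- w * complex_of_real t)) \<longlongrightarrow> 0) at_top"
    proof (rule tendsto_norm_zero_cancel)
      have "((\<lambda>t. exp (- (Re w * t))) \<longlongrightarrow> 0) at_top"
        using w by real_asymp
      then show "((\<lambda>t. norm (exp (- w * complex_of_real t))) \<longlongrightarrow> 0) at_top" by simp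
    qed
    then have "((\<lambda>t. - exp (- w * complex_of_real t) / w) \<longlongrightarrow> - 0 / w) at_top"
      by (intro tendsto_intros) (simp_all add: w0)
    then show "(((\<lambda>t. - exp (- w * complex_of_real t) / w) \<circ> real_of_ereal) \<longlongrightarrow> 0) (at_left \<infinity>)"
      by (simp add: ereal_tendsto_simps1)
  qed auto
  moreover have "einterval 0 \<infinity> = {0<..}" by (auto simp: einterval_def)
  ultimately show ?thesis using int
    by (simp add: has_bochner_integral_iff interval_lebesgue_integral_def set_integrable_def set_lebesgue_integral_def)
qed

text \<open>The half-lines contribute \<open>1 / (l + i x)\<close> and, after reflection,
  \<open>1 / (l - i x)\<close>. Both omit \<open>t = 0\<close>, hence the comparison almost
  everywhere.\<close>

lemma has_bochner_integral_exp_abs_cis: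
  fixes l x :: real
  assumes l: "l > 0"
  shows "has_bochner_integral lborel (\<lambda>t. exp (- l * \<bar>t\<bar>) *\<^sub>R cis (- x * t)) (complex_of_real (2 * l / (l\<^sup>2 + x\<^sup>2)))"
proof -
  have 1: "has_bochner_integral lborel (\<lambda>t. indicator {0<..} t *\<^sub>R exp (- Complex l x * complex_of_real t)) (1 / Complex l x)"
    using l by (intro has_bochner_integral_exp_halfline) simp
  have "has_bochner_integral lborel (\<lambda>t. indicator {0<..} t *\<^sub>R exp (- Complex l (- x) * complex_of_real t)) (1 / Complex l (- x))"
    using l by (intro has_bochner_integral_exp_halfline) simp
  from lborel_has_bochner_integral_real_affine_iff[THEN iffD1, OF _ this, of "-1" 0]
  have 2: "has_bochner_integral lborel (\<lambda>t. indicator {0<..} (- t) *\<^sub>R exp (- Complex l (- x) * complex_of_real (- t))) (1 / Complex l (- x))"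
    by simp
  have nz: "l\<^sup>2 + x\<^sup>2 \<noteq> 0" using l by (metis add_pos_nonneg less_irrefl zero_less_power zero_le_power2)
  have "1 / Complex l x + 1 / Complex l (- x) = complex_of_real (2 * l / (l\<^sup>2 + x\<^sup>2))"
    using nz by (simp add: complex_eq_iff Re_divide Im_divide power2_eq_square[of "l\<^sup>2 + x\<^sup>2"])
  with has_bochner_integral_add[OF 1 2]
  have 3: "has_bochner_integral lborel (\<lambda>t. indicator {0<..} t *\<^sub>R exp (- Complex l x * complex_of_real t)
      + indicator {0<..} (- t) *\<^sub>R exp (- Complex l (- x) * complex_of_real (- t))) (complex_of_real (2 * l / (l\<^sup>2 + x\<^sup>2)))"
    by simp
  have exp_eq: "exp (Complex a b) = exp a *\<^sub>R cis b" for a b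
    by (simp add: exp_eq_polar scaleR_conv_of_real)
  show ?thesis
  proof (rule has_bochner_integralI_AE[OF 3])
    show "(\<lambda>t. exp (- l * \<bar>t\<bar>) *\<^sub>R cis (- x * t)) \<in> borel_measurable lborel"
      by (auto intro!: borel_measurable_continuous_onI continuous_intros)
    show "AE t in lborel. indicator {0<..} t *\<^sub>R exp (- Complex l x * complex_of_real t)
      + indicator {0<..} (- t) *\<^sub>R exp (- Complex l (- x) * complex_of_real (- t)) = exp (- l * \<bar>t\<bar>) *\<^sub>R cis (- x * t)"
    proof (rule AE_mp[OF AE_lborel_singleton[of 0]], rule AE_I2, intro impI)
      fix t :: real assume "t \<noteq> 0"
      moreover have "- Complex l x * complex_of_real t = Complex (- l * t) (- x * t)"
          "- Complex l (- x) * complex_of_real (- t) = Complex (l * t) (- x * t)"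
        by (simp_all add: complex_eq_iff)
      ultimately show "indicator {0<..} t *\<^sub>R exp (- Complex l x * complex_of_real t)
          + indicator {0<..} (- t) *\<^sub>R exp (- Complex l (- x) * complex_of_real (- t)) = exp (- l * \<bar>t\<bar>) *\<^sub>R cis (- x * t)"
        by (cases "t > 0") (simp_all only: exp_eq, auto simp: indicator_def)
    qed
  qed
qed

text \<open>The Fourier transform of \<open>p_az\<close>. The value 1 at 0 is the limit of the other
  branch, and is the total mass of the density.\<close>

definition p_az_hat :: "real \<Rightarrow> real \<Rightarrow> real \<Rightarrow> real" where
  "p_az_hat \<alpha> z x = (if x = 0 then 1 else 2 * z / (\<alpha> * (1 - \<alpha>) * x) *
     (sinh (\<alpha> * x / (2 * z)) * sinh ((1 - \<alpha>) * x / (2 * z)) / sinh (x / (2 * z))))"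

text \<open>Away from \<open>t = 0\<close> the density is a sum of terms
  \<open>e k * exp (- l k * |t|)\<close>, each with an explicit transform. Their L1 norms
  \<open>e k * (2 / l k)\<close> are of order 1 / k^2, which permits exchanging sum and integral
  despite the singularity.\<close>

lemma has_bochner_integral_p_az_cis:
  assumes \<alpha>: "0 < \<alpha>" "\<alpha> < 1" and z: "0 < z"
  shows "has_bochner_integral lborel (\<lambda>t. p_az \<alpha> z t *\<^sub>R cis (- x * t)) (complex_of_real (p_az_hat \<alpha> z x))"
proof -
  define C where "C = z / (2 * pi * \<alpha> * (1 - \<alpha>))"
  have C: "C > 0" using \<alpha> z by (simp add: C_def)
  define e where "e k = C * (2 * (1 - cos (real (Suc k) * (2 * (pi * \<alpha>)))) / real (Suc k))" for k
  have e0: "e k \<ge> 0" for k unfolding e_def using C by simp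
  have e4: "e k \<le> C * 4 / real (Suc k)" for k
  proof -
    have "2 * (1 - cos (real (Suc k) * (2 * (pi * \<alpha>)))) / real (Suc k) \<le> 4 / real (Suc k)"
    proof (intro divide_right_mono)
      show "2 * (1 - cos (real (Suc k) * (2 * (pi * \<alpha>)))) \<le> 4"
        using cos_ge_minus_one[of "real (Suc k) * (2 * (pi * \<alpha>))"] by argo
    qed simp
    from mult_left_mono[OF this, of C] C show ?thesis unfolding e_def by simp
  qed
  define l where "l k = 2 * real (Suc k) * (pi * z)" for k
  have l: "l k > 0" for k unfolding l_def using z by simp
  define f where "f k t = e k *\<^sub>R (exp (- l k * \<bar>t\<bar>) *\<^sub>R cis (- x * t))" for k t
  have f: "has_bochner_integral lborel (f k) (e k *\<^sub>R complex_of_real (2 * l k / ((l k)\<^sup>2 + x\<^sup>2)))" for k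
    unfolding f_def by (intro has_bochner_integral_scaleR_right has_bochner_integral_exp_abs_cis l)
  \<comment> \<open>The modulus of a term is the same term at frequency 0, so its L1 norm comes from
    the integral already known.\<close>
  have nf: "norm (f k t) = Re (e k *\<^sub>R (exp (- l k * \<bar>t\<bar>) *\<^sub>R cis (- 0 * t)))" for k t
    unfolding f_def using e0 by simp
  have "has_bochner_integral lborel (\<lambda>t. norm (f k t)) (Re (e k *\<^sub>R complex_of_real (2 * l k / ((l k)\<^sup>2 + 0\<^sup>2))))" for k
    unfolding nf by (intro has_bochner_integral_Re has_bochner_integral_scaleR_right has_bochner_integral_exp_abs_cis l)
  then have intnf: "(\<integral>t. norm (f k t) \<partial>lborel) = e k * (2 / l k)" for k
    using l[of k] by (simp add: has_bochner_integral_iff power2_eq_square)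
  have sers: "(\<lambda>k. e k * exp (- l k * \<bar>t\<bar>)) sums p_az \<alpha> z t" if "t \<noteq> 0" for t
  proof -
    \<comment> \<open>The density is even, and the logarithmic series is available for positive
      arguments only.\<close>
    have "(sin (pi * \<alpha>) / sinh (pi * z * \<bar>t\<bar>))\<^sup>2 = (sin (pi * \<alpha>) / sinh (pi * z * t))\<^sup>2"
      by (cases "t \<ge> 0") auto
    moreover have "(\<lambda>k. C * (2 * (1 - cos (real (Suc k) * (2 * (pi * \<alpha>)))) / real (Suc k) * exp (- (2 * real (Suc k) * (pi * z * \<bar>t\<bar>)))))
        sums (C * ln (1 + (sin (pi * \<alpha>) / sinh (pi * z * \<bar>t\<bar>))\<^sup>2))"
      using that z by (intro sums_mult sums_ln_one_plus_sin_over_sinh) simp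
    ultimately show ?thesis unfolding e_def l_def p_az_def C_def[symmetric] by (simp add: mult_ac)
  qed
  have AEsum: "AE t in lborel. summable (\<lambda>k. norm (f k t))"
  proof (rule AE_mp[OF AE_lborel_singleton[of 0]], rule AE_I2, intro impI)
    fix t :: real assume "t \<noteq> 0"
    from sums_summable[OF sers[OF this]] show "summable (\<lambda>k. norm (f k t))" unfolding nf by simp
  qed
  have sumint: "summable (\<lambda>k. \<integral>t. norm (f k t) \<partial>lborel)"
    unfolding intnf
  proof (rule summable_comparison_test'[of "\<lambda>k. C * 4 / (pi * z) * (1 / (real (Suc k))\<^sup>2)" 0])
    have "summable (\<lambda>k. 1 / (real k)\<^sup>2)"
      using inverse_power_summable[of 2, where ?'a = real] by (simp add: field_simps)
    then have "summable (\<lambda>k. 1 / (real (Suc k))\<^sup>2)" by (rule summable_Suc_iff[THEN iffD2])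
    then show "summable (\<lambda>k. C * 4 / (pi * z) * (1 / (real (Suc k))\<^sup>2))" by (rule summable_mult)
    fix k :: nat
    have "e k * (2 / l k) \<le> C * 4 / real (Suc k) * (2 / l k)"
      using e4[of k] l[of k] by (intro mult_right_mono) auto
    also have "\<dots> = C * 4 / (pi * z) * (1 / (real (Suc k))\<^sup>2)"
      unfolding l_def using z by (simp add: field_simps power2_eq_square del: of_nat_Suc)
    finally show "norm (e k * (2 / l k)) \<le> C * 4 / (pi * z) * (1 / (real (Suc k))\<^sup>2)"
      using e0[of k] l[of k] by simp
  qed
  have fi: "integrable lborel (f k)" for k using f[of k] by (simp add: has_bochner_integral_iff)
  have hs: "has_bochner_integral lborel (\<lambda>t. \<Sum>k. f k t) (\<integral>t. (\<Sum>k. f k t) \<partial>lborel)"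
    using integrable_suminf[OF fi AEsum sumint] by (simp add: has_bochner_integral_iff)
  have "(\<lambda>k. integral\<^sup>L lborel (f k)) sums (\<integral>t. (\<Sum>k. f k t) \<partial>lborel)"
    using sums_integral[OF fi AEsum sumint] .
  then have S1: "(\<lambda>k. complex_of_real (e k * (2 * l k / ((l k)\<^sup>2 + x\<^sup>2)))) sums (\<integral>t. (\<Sum>k. f k t) \<partial>lborel)"
    using f by (simp add: has_bochner_integral_iff scaleR_conv_of_real)
  \<comment> \<open>Each term is rewritten as a difference of two terms of the cosine series, at 0
    and at 2 pi \<alpha>, with \<open>c = |x| / (2 * pi * z)\<close>.\<close>
  have summand: "e k * (2 * l k / ((l k)\<^sup>2 + x\<^sup>2)) =
      1 / (pi\<^sup>2 * \<alpha> * (1 - \<alpha>)) * (cos (real (Suc k) * 0) / ((real (Suc k))\<^sup>2 + (\<bar>x\<bar> / (2 * pi * z))\<^sup>2)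
         - cos (real (Suc k) * (2 * (pi * \<alpha>))) / ((real (Suc k))\<^sup>2 + (\<bar>x\<bar> / (2 * pi * z))\<^sup>2))" for k
  proof -
    have "(l k)\<^sup>2 + x\<^sup>2 = 4 * pi\<^sup>2 * z\<^sup>2 * ((real (Suc k))\<^sup>2 + (\<bar>x\<bar> / (2 * pi * z))\<^sup>2)"
      unfolding l_def using z by (simp add: power2_eq_square field_simps del: of_nat_Suc)
    moreover have "(real (Suc k))\<^sup>2 + (\<bar>x\<bar> / (2 * pi * z))\<^sup>2 > 0" by (intro add_pos_nonneg) auto
    ultimately show ?thesis
      unfolding e_def C_def l_def using z \<alpha>
      by (simp add: divide_simps del: of_nat_Suc) (simp add: power2_eq_square algebra_simps del: of_nat_Suc)
  qed
  have t2: "0 \<le> 2 * (pi * \<alpha>)" "2 * (pi * \<alpha>) \<le> 2 * pi" using \<alpha> by (auto simp: mult_le_cancel_left1)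
  have S2: "(\<lambda>k. e k * (2 * l k / ((l k)\<^sup>2 + x\<^sup>2))) sums p_az_hat \<alpha> z x"
  proof (cases "x = 0")
    case True
    have "(\<lambda>k. 1 / (pi\<^sup>2 * \<alpha> * (1 - \<alpha>)) * (cos (real (Suc k) * 0) / (real (Suc k))\<^sup>2
         - cos (real (Suc k) * (2 * (pi * \<alpha>))) / (real (Suc k))\<^sup>2)) sums
       (1 / (pi\<^sup>2 * \<alpha> * (1 - \<alpha>)) * (((pi - 0)\<^sup>2 / 4 - pi\<^sup>2 / 12) - ((pi - 2 * (pi * \<alpha>))\<^sup>2 / 4 - pi\<^sup>2 / 12)))"
      by (intro sums_mult sums_diff sums_cos_over_square t2) auto
    moreover have "(((pi - 0)\<^sup>2 / 4 - pi\<^sup>2 / 12) - ((pi - 2 * (pi * \<alpha>))\<^sup>2 / 4 - pi\<^sup>2 / 12)) = pi\<^sup>2 * \<alpha> * (1 - \<alpha>)"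
      by (simp add: power2_eq_square field_simps)
    ultimately show ?thesis unfolding summand using True \<alpha> by (simp add: p_az_hat_def)
  next
    case False
    define c where "c = \<bar>x\<bar> / (2 * pi * z)"
    have c: "c > 0" using False z by (simp add: c_def)
    have cp: "c * pi = \<bar>x\<bar> / (2 * z)" using z by (simp add: c_def)
    have "(\<lambda>k. e k * (2 * l k / ((l k)\<^sup>2 + x\<^sup>2))) sums
       (1 / (pi\<^sup>2 * \<alpha> * (1 - \<alpha>)) * ((pi * cosh (c * (pi - 0)) / (2 * c * sinh (c * pi)) - 1 / (2 * c\<^sup>2))
           - (pi * cosh (c * (pi - 2 * (pi * \<alpha>))) / (2 * c * sinh (c * pi)) - 1 / (2 * c\<^sup>2))))"
      unfolding summand c_def[symmetric]
      by (intro sums_mult sums_diff sums_cos_over_square_plus t2 c) auto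
    also have "(1 / (pi\<^sup>2 * \<alpha> * (1 - \<alpha>)) * ((pi * cosh (c * (pi - 0)) / (2 * c * sinh (c * pi)) - 1 / (2 * c\<^sup>2))
           - (pi * cosh (c * (pi - 2 * (pi * \<alpha>))) / (2 * c * sinh (c * pi)) - 1 / (2 * c\<^sup>2))))
        = 1 / (pi\<^sup>2 * \<alpha> * (1 - \<alpha>)) * (pi / (2 * c * sinh (c * pi)) * (cosh (c * pi) - cosh (c * pi - 2 * (\<alpha> * (c * pi)))))"
      by (simp add: algebra_simps diff_divide_distrib)
    also have "cosh (c * pi) - cosh (c * pi - 2 * (\<alpha> * (c * pi))) = 2 * (sinh (\<alpha> * (c * pi)) * sinh ((1 - \<alpha>) * (c * pi)))"
    proof -
      have "cosh (a + b) - cosh (b - a) = 2 * (sinh a * sinh b)" for a b :: real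
        by (simp add: cosh_add cosh_diff)
      from this[of "\<alpha> * (c * pi)" "(1 - \<alpha>) * (c * pi)"] show ?thesis by (simp add: algebra_simps)
    qed
    also have "1 / (pi\<^sup>2 * \<alpha> * (1 - \<alpha>)) * (pi / (2 * c * sinh (c * pi)) * (2 * (sinh (\<alpha> * (c * pi)) * sinh ((1 - \<alpha>) * (c * pi)))))
        = 1 / ((c * pi) * (\<alpha> * (1 - \<alpha>))) * (sinh (\<alpha> * (c * pi)) * sinh ((1 - \<alpha>) * (c * pi)) / sinh (c * pi))"
      using c \<alpha> by (simp add: field_simps power2_eq_square)
    also have "\<dots> = p_az_hat \<alpha> z x"
      unfolding cp p_az_hat_def using False z by (cases "x > 0") (simp_all add: abs_if)
    finally show ?thesis .
  qed
  have "(\<integral>t. (\<Sum>k. f k t) \<partial>lborel) = complex_of_real (p_az_hat \<alpha> z x)"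
    using sums_unique2[OF S1 sums_of_real[OF S2]] .
  with hs have hs': "has_bochner_integral lborel (\<lambda>t. \<Sum>k. f k t) (complex_of_real (p_az_hat \<alpha> z x))" by simp
  show ?thesis
  proof (rule has_bochner_integralI_AE[OF hs'])
    show "(\<lambda>t. p_az \<alpha> z t *\<^sub>R cis (- x * t)) \<in> borel_measurable lborel"
      unfolding p_az_def sinh_def
      by (intro borel_measurable_scaleR) (auto intro!: borel_measurable_continuous_onI continuous_intros)
    show "AE t in lborel. (\<Sum>k. f k t) = p_az \<alpha> z t *\<^sub>R cis (- x * t)"
    proof (rule AE_mp[OF AE_lborel_singleton[of 0]], rule AE_I2, intro impI)
      fix t :: real assume "t \<noteq> 0"
      from sums_scaleR_left[OF sers[OF this], of "cis (- x * t)"]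
      show "(\<Sum>k. f k t) = p_az \<alpha> z t *\<^sub>R cis (- x * t)"
        unfolding f_def by (simp add: sums_iff)
    qed
  qed
qed

lemma is_prob_density_p_az:
  assumes "0 < \<alpha>" "\<alpha> < 1" "0 < z"
  shows "is_prob_density (p_az \<alpha> z)"
  unfolding is_prob_density_def
proof
  have "0 \<le> ln (1 + (sin (pi * \<alpha>) / sinh (pi * z * t))\<^sup>2)" for t
    by (intro ln_ge_zero) simp
  then show "\<forall>t. 0 \<le> p_az \<alpha> z t" unfolding p_az_def using assms by auto
  show "has_bochner_integral lborel (p_az \<alpha> z) 1"
    using has_bochner_integral_Re[OF has_bochner_integral_p_az_cis[OF assms, of 0]]
    by (simp add: p_az_hat_def)
qed

section \<open>Unitary diagonalization\<close>

text \<open>Complex diagonal entries are required for phases and for exponentials of skew-Hermitian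
  matrices.\<close>

definition cdiag :: "('n \<Rightarrow> complex) \<Rightarrow> complex^'n^'n" where
  "cdiag d = (\<chi> i j. if i = j then d i else 0)"

lemma real_diag_eq_cdiag: "real_diag d = cdiag (\<lambda>i. complex_of_real (d i))"
  by (simp add: real_diag_def cdiag_def)

lemma cdiag_mult_nth: "(cdiag d ** A) $ i $ j = d i * A $ i $ j"
  and mult_cdiag_nth: "(A ** cdiag d) $ i $ j = A $ i $ j * d j"
  by (simp_all add: cdiag_def matrix_matrix_mult_def if_distrib if_distribR cong: if_cong)

lemma cdiag_nth: "cdiag d $ i $ j = (if i = j then d i else 0)"
  by (simp add: cdiag_def)

lemma cdiag_mult: "cdiag d ** cdiag e = cdiag (\<lambda>i. d i * e i)"
  by (simp add: vec_eq_iff cdiag_mult_nth cdiag_nth)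

lemma mat_eq_cdiag: "mat c = cdiag (\<lambda>_. c)"
  by (simp add: mat_def cdiag_def)

lemma trace_cdiag: "trace (cdiag d) = (\<Sum>i\<in>UNIV. d i)"
  by (simp add: trace_def cdiag_nth)

lemma cscale_cdiag: "cscale c (cdiag d) = cdiag (\<lambda>i. c * d i)"
  by (simp add: cscale_def cdiag_def vec_eq_iff)

lemma dagger_cdiag: "dagger (cdiag d) = cdiag (\<lambda>i. cnj (d i))"
  by (simp add: dagger_def cdiag_def vec_eq_iff)

lemma dagger_mult: "dagger (A ** B) = dagger B ** dagger A"
  by (simp add: dagger_def matrix_matrix_mult_def vec_eq_iff mult.commute)

lemma dagger_dagger [simp]: "dagger (dagger A) = A"
  by (simp add: dagger_def vec_eq_iff)

lemma dagger_nth: "dagger A $ i $ j = cnj (A $ j $ i)"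
  by (simp add: dagger_def)

lemma dagger_add: "dagger (A + B) = dagger A + dagger B"
  and dagger_scaleR: "dagger (r *\<^sub>R A) = r *\<^sub>R dagger A"
  and dagger_cscale: "dagger (cscale c A) = cscale (cnj c) (dagger A)"
  by (simp_all add: dagger_def cscale_def vec_eq_iff)

lemma dagger_mat_1 [simp]: "dagger (mat 1) = mat 1"
  by (simp add: dagger_def mat_def vec_eq_iff)

lemma cscale_mult_left: "cscale c A ** B = cscale c (A ** B)"
  and cscale_mult_right: "A ** cscale c B = cscale c (A ** B)"
  by (simp_all add: cscale_def matrix_matrix_mult_def vec_eq_iff sum_distrib_left mult_ac)

lemma cscale_cscale: "cscale a (cscale b A) = cscale (a * b) A"
  and cscale_add: "cscale c (A + B) = cscale c A + cscale c B"
  and cscale_of_real: "cscale (complex_of_real r) A = r *\<^sub>R A"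
  and cscale_minus: "cscale c (- A) = cscale (- c) A"
  and cscale_scaleR: "cscale c (r *\<^sub>R A) = r *\<^sub>R cscale c A"
  and cscale_nth: "cscale c A $ i $ j = c * A $ i $ j"
  by (simp_all add: cscale_def vec_eq_iff distrib_left scaleR_conv_of_real[where 'a = complex] mult_ac)

lemma scaleR_mult_left: "(r *\<^sub>R A) ** B = r *\<^sub>R (A ** B)"
  and scaleR_mult_right: "A ** (r *\<^sub>R B) = r *\<^sub>R (A ** B)"
  for A B :: "complex^'n^'n"
  by (simp_all add: matrix_matrix_mult_def vec_eq_iff scaleR_sum_right)

lemma bounded_bilinear_matrix_mult:
  "bounded_bilinear (\<lambda>A B :: complex^'n^'n. A ** B)"
  unfolding bilinear_conv_bounded_bilinear[symmetric] bilinear_def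
  by (intro conjI allI linearI)
     (simp_all add: scaleR_mult_left scaleR_mult_right matrix_add_ldistrib
        matrix_matrix_mult_def vec_eq_iff sum.distrib distrib_left distrib_right scaleR_sum_right)

lemmas bounded_linear_mult_const = bounded_bilinear.bounded_linear_left[OF bounded_bilinear_matrix_mult]
lemmas bounded_linear_const_mult = bounded_bilinear.bounded_linear_right[OF bounded_bilinear_matrix_mult]

lemmas matrix_add_rdistrib = bounded_bilinear.add_left[OF bounded_bilinear_matrix_mult]

lemma bounded_linear_sandwich:
  fixes A B :: "complex^'n^'n"
  shows "bounded_linear (\<lambda>X. A ** X ** B)"
  by (rule bounded_linear_compose[OF bounded_linear_mult_const bounded_linear_const_mult])

lemma bounded_linear_dagger: "bounded_linear (dagger :: complex^'n^'n \<Rightarrow> _)"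
  unfolding linear_conv_bounded_linear[symmetric] by (intro linearI) (simp_all add: dagger_add dagger_scaleR)

lemma bounded_linear_cscale: "bounded_linear (cscale c :: complex^'n^'n \<Rightarrow> _)"
  unfolding linear_conv_bounded_linear[symmetric]
  by (intro linearI) (simp_all add: cscale_add cscale_scaleR)

lemma bounded_linear_trace: "bounded_linear (trace :: complex^'n^'n \<Rightarrow> _)"
  unfolding linear_conv_bounded_linear[symmetric]
  by (intro linearI) (simp_all add: trace_def sum.distrib scaleR_sum_right)

lemma bounded_linear_nth_nth: "bounded_linear (\<lambda>A :: complex^'n^'n. A $ i $ j)"
  unfolding linear_conv_bounded_linear[symmetric] by (intro linearI) simp_all

lemma unitary_dagger: "unitary U \<Longrightarrow> unitary (dagger U)"
  by (simp add: unitary_def)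

lemma unitary_cancel:
  assumes "unitary U"
  shows "dagger U ** (U ** A) = A" "U ** (dagger U ** A) = A" "A ** U ** dagger U = A" "A ** dagger U ** U = A"
proof -
  have U: "dagger U ** U = mat 1" "U ** dagger U = mat 1" using assms by (auto simp: unitary_def)
  show "dagger U ** (U ** A) = A" "U ** (dagger U ** A) = A"
    unfolding matrix_mul_assoc U by (rule matrix_mul_lid)+
  show "A ** U ** dagger U = A" "A ** dagger U ** U = A"
    unfolding matrix_mul_assoc[symmetric] U by (rule matrix_mul_rid)+
qed

lemma unitary_mult:
  assumes "unitary U" "unitary V"
  shows "unitary (U ** V)"
  using assms unfolding unitary_def dagger_mult
  by (metis assms matrix_mul_assoc unitary_cancel(1,3))

lemma trace_unitary_conj: "unitary U \<Longrightarrow> trace (U ** A ** dagger U) = trace A"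
  using trace_mul_sym[of "U ** A" "dagger U"] by (simp add: unitary_cancel)

section \<open>The complex inner product and the spectral theorem\<close>

text \<open>Conjugate-linear on the left. The inner product of the type class is only the real part
  of it, so complex orthogonality amounts to two real conditions.\<close>

definition cinner :: "complex^'n \<Rightarrow> complex^'n \<Rightarrow> complex" where
  "cinner x y = (\<Sum>i\<in>UNIV. cnj (x $ i) * y $ i)"

lemma Re_cinner: "Re (cinner x y) = x \<bullet> y"
  by (simp add: cinner_def inner_vec_def inner_complex_def)

lemma cinner_self: "cinner x x = complex_of_real (x \<bullet> x)"
proof -
  have "Im (cinner x x) = 0" by (simp add: cinner_def)
  then show ?thesis by (simp add: complex_eq_iff Re_cinner)
qed

lemma cinner_scale_left: "cinner (c *s x) y = cnj c * cinner x y"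
  and cinner_add_right: "cinner x (y + z) = cinner x y + cinner x z"
  and cinner_diff_right: "cinner x (y - z) = cinner x y - cinner x z"
  and cinner_scaleR_right: "cinner x (r *\<^sub>R y) = of_real r * cinner x y"
  and cnj_cinner: "cnj (cinner x y) = cinner y x"
  by (simp_all add: cinner_def sum_distrib_left distrib_left sum.distrib sum_subtractf
      right_diff_distrib mult_ac scaleR_conv_of_real[where 'a = complex])

lemma cinner_matrix: "cinner x (A *v y) = cinner (dagger A *v x) y"
  unfolding cinner_def matrix_vector_mult_def dagger_def
  by (simp add: sum_distrib_left sum_distrib_right, subst sum.swap) (simp add: mult_ac)

lemma hermitian_inner:
  assumes "hermitian A"
  shows "x \<bullet> (A *v y) = (A *v x) \<bullet> y"
  using cinner_matrix[of x A y] assms unfolding hermitian_def by (metis Re_cinner)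

text \<open>Induction on the index set: a maximiser of the Rayleigh quotient on the unit sphere of
  the orthogonal complement of the vectors found so far is a further eigenvector. The complement is
  invariant because \<open>A\<close> is Hermitian.\<close>

lemma hermitian_eigenvectors:
  fixes A :: "complex^'n^'n" and I :: "'n set"
  assumes A: "hermitian A"
  shows "\<exists>u d. (\<forall>i\<in>I. A *v u i = complex_of_real (d i) *s u i) \<and>
           (\<forall>i\<in>I. \<forall>j\<in>I. cinner (u i) (u j) = (if i = j then 1 else 0))"
  using finite[of I]
proof (induction I rule: finite_induct)
  case (insert k F)
  then obtain u d where u: "\<And>i. i \<in> F \<Longrightarrow> A *v u i = complex_of_real (d i) *s u i"
    and on: "\<And>i j. i \<in> F \<Longrightarrow> j \<in> F \<Longrightarrow> cinner (u i) (u j) = (if i = j then 1 else 0)" by blast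
  define S where "S = {x. \<forall>i\<in>F. cinner (u i) x = 0}"
  have S_scaleR: "r *\<^sub>R x \<in> S" if "x \<in> S" for r x
    using that by (auto simp: S_def cinner_scaleR_right)
  have S_add: "x + y \<in> S" and S_diff: "x - y \<in> S" if "x \<in> S" "y \<in> S" for x y
    using that by (auto simp: S_def cinner_add_right cinner_diff_right)
  have S_A: "A *v x \<in> S" if "x \<in> S" for x
    using that A u unfolding S_def by (auto simp: cinner_matrix hermitian_def cinner_scale_left)
  \<comment> \<open>The real span of \<open>T\<close> is the complex span of the \<open>u i\<close>.
    Real orthogonality to \<open>T\<close> therefore gives complex orthogonality, and the real
    dimension is at most 2 card F, below that of the space.\<close>
  define T where "T = u ` F \<union> (\<lambda>i. \<i> *s u i) ` F"
  have "dim T \<le> card T" by (intro dim_le_card') (simp add: T_def)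
  also have "card T \<le> card F + card F"
    unfolding T_def by (intro order_trans[OF card_Un_le] add_mono card_image_le) auto
  also have "\<dots> < 2 * CARD('n)"
    using insert.hyps psubset_card_mono[of "UNIV :: 'n set" F] by fastforce
  also have "\<dots> = DIM(complex^'n)" by simp
  finally obtain x0 where x0: "x0 \<noteq> 0" "\<And>y. y \<in> span T \<Longrightarrow> orthogonal x0 y"
    using orthogonal_to_subspace_exists by blast
  have x0S: "x0 \<in> S"
    unfolding S_def
  proof safe
    fix i assume i: "i \<in> F"
    then have "u i \<bullet> x0 = 0" "(\<i> *s u i) \<bullet> x0 = 0"
      using x0(2)[of "u i"] x0(2)[of "\<i> *s u i"] by (auto simp: T_def orthogonal_def inner_commute span_base)
    then show "cinner (u i) x0 = 0"
      unfolding Re_cinner[symmetric] cinner_scale_left by (simp add: complex_eq_iff)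
  qed
  define q where "q x = x \<bullet> (A *v x)" for x
  have contq: "continuous_on B q" for B
    unfolding q_def
    by (intro continuous_intros linear_continuous_on matrix_vector_mul_bounded_linear)
  have "closed {x. cinner (u i) x = 0}" for i
    unfolding cinner_def by (intro closed_Collect_eq continuous_intros)
  moreover have "S = (\<Inter>i\<in>F. {x. cinner (u i) x = 0})" by (auto simp: S_def)
  ultimately have closedS: "closed S" by auto
  have comp: "compact (S \<inter> sphere 0 1)" using closedS by (intro closed_Int_compact) auto
  have ne: "S \<inter> sphere 0 1 \<noteq> {}"
  proof -
    have "(1 / norm x0) *\<^sub>R x0 \<in> S \<inter> sphere 0 1" using S_scaleR[OF x0S] x0(1) by simp
    then show ?thesis by blast
  qed
  obtain x where x': "x \<in> S \<inter> sphere 0 1" and max': "\<forall>y\<in>S \<inter> sphere 0 1. q y \<le> q x"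
    using continuous_attains_sup[OF comp ne contq] by blast
  then have x: "x \<in> S" "norm x = 1" and max: "\<And>y. y \<in> S \<Longrightarrow> norm y = 1 \<Longrightarrow> q y \<le> q x"
    by auto
  define l where "l = q x"
  have lin: "A *v (a + b) = A *v a + A *v b" "A *v (r *\<^sub>R a) = r *\<^sub>R (A *v a)" for a b r
    using linear_add[OF matrix_vector_mul_linear[of A]] linear_cmul[OF matrix_vector_mul_linear[of A]]
    by metis+
  have le: "q y \<le> l * (y \<bullet> y)" if y: "y \<in> S" for y
  proof (cases "y = 0")
    case False
    have "q ((1 / norm y) *\<^sub>R y) \<le> l"
      unfolding l_def using max[of "(1 / norm y) *\<^sub>R y"] S_scaleR[OF y] False by simp
    moreover have "q ((1 / norm y) *\<^sub>R y) = q y / (y \<bullet> y)"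
      unfolding q_def lin
      by (simp add: power2_norm_eq_inner[symmetric] power2_eq_square)
    ultimately show ?thesis using False by (simp add: divide_le_eq)
  qed (simp add: q_def)
  \<comment> \<open>The residual of the eigenvalue equation. It lies in \<open>S\<close>, so
    \<open>x + t *\<^sub>R w\<close> is an admissible competitor, and the first-order variation in
    its direction is twice its squared norm.\<close>
  define w where "w = l *\<^sub>R x - A *v x"
  have wS: "w \<in> S" unfolding w_def using S_scaleR[OF x(1)] S_A[OF x(1)] S_diff by blast
  define c where "c = l * (w \<bullet> w) - q w"
  have quad: "0 \<le> 2 * t * (w \<bullet> w) + t\<^sup>2 * c" for t :: real
  proof -
    have "x + t *\<^sub>R w \<in> S" using S_add[OF x(1)] S_scaleR[OF wS] by blast
    from le[OF this] have "0 \<le> l * ((x + t *\<^sub>R w) \<bullet> (x + t *\<^sub>R w)) - q (x + t *\<^sub>R w)" by simp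
    also have "(x + t *\<^sub>R w) \<bullet> (x + t *\<^sub>R w) = 1 + 2 * t * (x \<bullet> w) + t\<^sup>2 * (w \<bullet> w)"
    proof -
      have "x \<bullet> x = 1" using x(2) by (simp add: norm_eq_1)
      then show ?thesis
        by (simp add: inner_add_left inner_add_right power2_eq_square inner_commute)
    qed
    also have "q (x + t *\<^sub>R w) = l + 2 * t * ((A *v x) \<bullet> w) + t\<^sup>2 * q w"
      unfolding l_def q_def lin using hermitian_inner[OF A, of x w]
      by (simp add: inner_add_left inner_add_right power2_eq_square inner_commute distrib_left)
    also have "l * (1 + 2 * t * (x \<bullet> w) + t\<^sup>2 * (w \<bullet> w)) - (l + 2 * t * ((A *v x) \<bullet> w) + t\<^sup>2 * q w)
        = 2 * t * ((l *\<^sub>R x - A *v x) \<bullet> w) + t\<^sup>2 * c"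
      unfolding c_def by (simp add: inner_diff_left algebra_simps)
    finally show ?thesis unfolding w_def[symmetric] .
  qed
  have "w \<bullet> w = 0"
  proof (rule ccontr)
    define a where "a = w \<bullet> w"
    assume "w \<bullet> w \<noteq> 0"
    then have a: "a > 0" unfolding a_def by (metis inner_eq_zero_iff inner_gt_zero_iff)
    \<comment> \<open>A step this short keeps \<open>s * c\<close> at most \<open>a\<close>, whereas
      \<open>quad\<close> at \<open>- s\<close> demands at least \<open>2 * a\<close>.\<close>
    define s where "s = a / (\<bar>c\<bar> + 1)"
    have s: "s > 0" using a by (simp add: s_def)
    have "s * (2 * a) \<le> s * (s * c)"
      using quad[of "- s"] unfolding a_def[symmetric] by (simp add: power2_eq_square algebra_simps)
    then have "2 * a \<le> s * c" using s by simp
    also have "s * c \<le> s * (\<bar>c\<bar> + 1)" using s by (intro mult_left_mono) auto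
    also have "\<dots> = a" by (simp add: s_def)
    finally show False using a by simp
  qed
  then have Ax: "A *v x = complex_of_real l *s x"
    by (simp add: w_def vec_eq_iff scaleR_conv_of_real[where 'a = complex])
  have "cinner x x = 1" using x(2) by (simp add: cinner_self norm_eq_1)
  moreover have "cinner (u i) x = 0 \<and> cinner x (u i) = 0" if "i \<in> F" for i
    using x(1) that unfolding S_def by (metis (mono_tags, lifting) cnj_cinner complex_cnj_zero mem_Collect_eq)
  ultimately show ?case
    using insert.hyps u on Ax
    by (intro exI[of _ "u(k := x)"] exI[of _ "d(k := l)"]) auto
qed simp

theorem hermitian_spectral:
  fixes A :: "complex^'n^'n"
  assumes "hermitian A"
  obtains U d where "unitary U" "A = U ** real_diag d ** dagger U"
proof -
  from hermitian_eigenvectors[OF assms, of UNIV]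
  obtain u :: "'n \<Rightarrow> complex^'n" and d where ud: "(\<forall>i\<in>UNIV. A *v u i = complex_of_real (d i) *s u i) \<and>
      (\<forall>i\<in>UNIV. \<forall>j\<in>UNIV. cinner (u i) (u j) = (if i = j then 1 else 0))"
    by blast
  have u: "A *v u i = complex_of_real (d i) *s u i" for i
    using conjunct1[OF ud] by (rule bspec) simp
  have on: "cinner (u i) (u j) = (if i = j then 1 else 0)" for i j
    using conjunct2[OF ud] by simp
  define U :: "complex^'n^'n" where "U = (\<chi> a i. u i $ a)"
  have "dagger U ** U = mat 1"
    using on by (simp add: vec_eq_iff matrix_matrix_mult_def dagger_def U_def mat_def cinner_def)
  then have U: "unitary U" unfolding unitary_def using matrix_left_right_inverse by blast
  have AU: "A ** U = U ** real_diag d"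
  proof -
    have "(A ** U) $ a $ i = (A *v u i) $ a" for a i
      by (simp add: matrix_matrix_mult_def matrix_vector_mult_def U_def)
    then show ?thesis
      by (simp add: vec_eq_iff real_diag_eq_cdiag mult_cdiag_nth u) (simp add: U_def)
  qed
  have "A = U ** real_diag d ** dagger U"
    unfolding AU[symmetric] by (rule unitary_cancel(3)[OF U, symmetric])
  with U that show thesis by blast
qed

section \<open>Functional calculus\<close>

text \<open>\<open>W = dagger V ** U\<close> intertwines the two diagonals, so an entry
  \<open>W $ p $ q\<close> is nonzero only if \<open>d q = e p\<close>, and then \<open>f\<close>
  agrees there too. This makes \<open>spectral_fun\<close> independent of the decomposition.\<close>

lemma unitary_diag_intertwine:
  fixes f :: "complex \<Rightarrow> complex"
  assumes U: "unitary U" and V: "unitary V"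
    and eq: "U ** cdiag d ** dagger U = V ** cdiag e ** dagger V"
  shows "U ** cdiag (\<lambda>i. f (d i)) ** dagger U = V ** cdiag (\<lambda>i. f (e i)) ** dagger V"
proof -
  define W where "W = dagger V ** U"
  have "W ** cdiag d = dagger V ** (U ** cdiag d ** dagger U) ** U"
    unfolding W_def by (simp add: matrix_mul_assoc unitary_cancel[OF U])
  also have "\<dots> = cdiag e ** W"
    unfolding eq W_def by (simp add: matrix_mul_assoc[symmetric] unitary_cancel[OF V])
  finally have "W $ p $ q * d q = e p * W $ p $ q" for p q
    by (metis cdiag_mult_nth mult_cdiag_nth)
  then have "W $ p $ q * f (d q) = f (e p) * W $ p $ q" for p q
    by (metis mult.commute mult_cancel_left)
  then have "W ** cdiag (\<lambda>i. f (d i)) = cdiag (\<lambda>i. f (e i)) ** W"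
    by (simp add: vec_eq_iff cdiag_mult_nth mult_cdiag_nth)
  then have "V ** (W ** cdiag (\<lambda>i. f (d i))) ** dagger U = V ** (cdiag (\<lambda>i. f (e i)) ** W) ** dagger U" by simp
  moreover have "V ** (W ** cdiag (\<lambda>i. f (d i))) ** dagger U = U ** cdiag (\<lambda>i. f (d i)) ** dagger U"
    unfolding W_def by (simp add: matrix_mul_assoc[symmetric] unitary_cancel[OF V])
  moreover have "V ** (cdiag (\<lambda>i. f (e i)) ** W) ** dagger U = V ** cdiag (\<lambda>i. f (e i)) ** dagger V"
    unfolding W_def by (simp add: matrix_mul_assoc unitary_cancel[OF U])
  ultimately show ?thesis by simp
qed

lemma spectral_fun_eq:
  assumes U: "unitary U"
  shows "spectral_fun f (U ** real_diag d ** dagger U) = U ** real_diag (\<lambda>i. f (d i)) ** dagger U"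
  unfolding spectral_fun_def
proof (rule the_equality)
  fix B assume "\<exists>V e. unitary V \<and> U ** real_diag d ** dagger U = V ** real_diag e ** dagger V
      \<and> B = V ** real_diag (\<lambda>i. f (e i)) ** dagger V"
  then obtain V e where V: "unitary V" "U ** real_diag d ** dagger U = V ** real_diag e ** dagger V"
      "B = V ** real_diag (\<lambda>i. f (e i)) ** dagger V" by blast
  then show "B = U ** real_diag (\<lambda>i. f (d i)) ** dagger U"
    using unitary_diag_intertwine[OF U V(1), of "\<lambda>i. complex_of_real (d i)" "\<lambda>i. complex_of_real (e i)"
        "\<lambda>c. complex_of_real (f (Re c))"]
    by (simp add: real_diag_eq_cdiag)
qed (use U in blast)

lemma mat_powr_eq:
  "unitary U \<Longrightarrow> mat_powr (U ** real_diag d ** dagger U) s = U ** real_diag (\<lambda>i. d i powr s) ** dagger U"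
  unfolding mat_powr_def by (rule spectral_fun_eq)

lemma mat_powr_unitary_conj:
  assumes U: "unitary U" and A: "hermitian A"
  shows "mat_powr (U ** A ** dagger U) s = U ** mat_powr A s ** dagger U"
proof -
  obtain V d where V: "unitary V" "A = V ** real_diag d ** dagger V" using hermitian_spectral[OF A] .
  have "U ** A ** dagger U = (U ** V) ** real_diag d ** dagger (U ** V)"
    unfolding V(2) dagger_mult by (simp add: matrix_mul_assoc)
  then have "mat_powr (U ** A ** dagger U) s = (U ** V) ** real_diag (\<lambda>i. d i powr s) ** dagger (U ** V)"
    using mat_powr_eq[OF unitary_mult[OF U V(1)]] by simp
  also have "\<dots> = U ** (V ** real_diag (\<lambda>i. d i powr s) ** dagger V) ** dagger U"
    unfolding dagger_mult by (simp add: matrix_mul_assoc)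
  finally show ?thesis unfolding V(2) by (simp add: mat_powr_eq V(1))
qed

section \<open>Matrix powers and the operator norm\<close>

lemma matpow_unitary_conj:
  assumes "unitary U"
  shows "matpow (U ** A ** dagger U) k = U ** matpow A k ** dagger U"
proof (induction k)
  case 0
  show ?case using assms by (simp add: unitary_def)
next
  case (Suc k)
  have "matpow (U ** A ** dagger U) (Suc k) = U ** A ** dagger U ** U ** matpow A k ** dagger U"
    using Suc by (simp add: matrix_mul_assoc)
  also have "\<dots> = U ** matpow A (Suc k) ** dagger U"
    unfolding unitary_cancel(4)[OF assms] by (simp add: matrix_mul_assoc)
  finally show ?case .
qed

lemma matpow_cdiag: "matpow (cdiag d) k = cdiag (\<lambda>i. d i ^ k)"
  by (induction k) (simp_all add: mat_eq_cdiag cdiag_mult)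

lemma matpow_add: "matpow A (m + k) = matpow A m ** matpow A k"
  by (induction m) (simp_all add: matrix_mul_assoc)

lemma sums_cdiag:
  assumes "\<And>i. (\<lambda>k. f k i) sums s i"
  shows "(\<lambda>k. cdiag (f k)) sums cdiag s"
  unfolding sums_def
proof (intro vec_tendstoI)
  fix i j
  have "(\<Sum>k<n. cdiag (f k)) $ i $ j = (if i = j then \<Sum>k<n. f k i else 0)" for n
    by (simp add: cdiag_nth)
  then show "(\<lambda>n. (\<Sum>k<n. cdiag (f k)) $ i $ j) \<longlonglongrightarrow> cdiag s $ i $ j"
    using assms[of i] by (cases "i = j") (simp_all add: cdiag_nth sums_def)
qed

lemma sums_matpow_diag:
  assumes U: "unitary U" and s: "\<And>i. (\<lambda>k. complex_of_real (c k) * d i ^ k) sums s i"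
  shows "(\<lambda>k. c k *\<^sub>R matpow (U ** cdiag d ** dagger U) k) sums (U ** cdiag s ** dagger U)"
proof -
  have "(\<lambda>k. U ** cdiag (\<lambda>i. complex_of_real (c k) * d i ^ k) ** dagger U) sums (U ** cdiag s ** dagger U)"
    by (rule bounded_linear.sums[OF bounded_linear_sandwich sums_cdiag[OF s]])
  moreover have "c k *\<^sub>R matpow (U ** cdiag d ** dagger U) k
       = U ** cdiag (\<lambda>i. complex_of_real (c k) * d i ^ k) ** dagger U" for k
    unfolding matpow_unitary_conj[OF U] matpow_cdiag cscale_cdiag[symmetric] cscale_of_real
    by (simp add: scaleR_mult_left scaleR_mult_right)
  ultimately show ?thesis by simp
qed

lemma mat_exp_diag:
  assumes U: "unitary U"
  shows "mat_exp (U ** cdiag d ** dagger U) = U ** cdiag (\<lambda>i. exp (d i)) ** dagger U"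
proof -
  have "(\<lambda>k. complex_of_real (1 / fact k) * d i ^ k) sums exp (d i)" for i
    using exp_converges[of "d i"] by (simp add: scaleR_conv_of_real divide_inverse)
  from sums_matpow_diag[OF U this] show ?thesis
    unfolding mat_exp_def by (simp add: sums_iff)
qed

section \<open>The operator norm\<close>

text \<open>The norm of the matrix type is the Frobenius norm, for which \<open>M - mat 1\<close>
  may exceed 1 already at the base point. The operator norm of a diagonal matrix is controlled by
  its largest entry, so it stays inside the radius 1 of the binomial series.\<close>

definition opnorm :: "complex^'n^'n \<Rightarrow> real" where
  "opnorm A = onorm ((*v) A)"

lemma opnorm_bound: "norm (A *v x) \<le> opnorm A * norm x"
  unfolding opnorm_def by (rule onorm[OF matrix_vector_mul_bounded_linear])

lemma opnorm_nonneg: "0 \<le> opnorm A"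
  unfolding opnorm_def by (rule onorm_pos_le[OF matrix_vector_mul_bounded_linear])

lemma opnorm_le: "(\<And>x. norm (A *v x) \<le> b * norm x) \<Longrightarrow> opnorm A \<le> b"
  unfolding opnorm_def by (rule onorm_le)

lemma opnorm_mult: "opnorm (A ** B) \<le> opnorm A * opnorm B"
proof (rule opnorm_le)
  fix x
  have "norm ((A ** B) *v x) \<le> opnorm A * norm (B *v x)"
    unfolding matrix_vector_mul_assoc[symmetric] by (rule opnorm_bound)
  also have "\<dots> \<le> opnorm A * (opnorm B * norm x)"
    by (intro mult_left_mono opnorm_bound opnorm_nonneg)
  finally show "norm ((A ** B) *v x) \<le> opnorm A * opnorm B * norm x" by (simp add: mult.assoc)
qed

lemma opnorm_triangle: "opnorm (A + B) \<le> opnorm A + opnorm B"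
proof (rule opnorm_le)
  fix x
  have "(A + B) *v x = A *v x + B *v x"
    by (simp add: vec_eq_iff matrix_vector_mult_def distrib_right sum.distrib)
  then show "norm ((A + B) *v x) \<le> (opnorm A + opnorm B) * norm x"
    unfolding distrib_right by (metis add_mono norm_triangle_le opnorm_bound)
qed

lemma opnorm_scaleR: "opnorm (r *\<^sub>R A) = \<bar>r\<bar> * opnorm A"
proof -
  have "(*v) (r *\<^sub>R A) = (\<lambda>x. r *\<^sub>R (A *v x))"
    by (simp add: fun_eq_iff vec_eq_iff matrix_vector_mult_def scaleR_sum_right)
  then show ?thesis
    unfolding opnorm_def by (simp add: onorm_scaleR matrix_vector_mul_bounded_linear)
qed

lemma opnorm_cdiag:
  assumes "\<And>i. cmod (d i) \<le> b"
  shows "opnorm (cdiag d) \<le> b"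
proof (rule opnorm_le)
  fix x
  have b: "0 \<le> b" using assms norm_ge_zero order_trans by blast
  have "(cdiag d *v x) $ i = d i * x $ i" for i
    by (simp add: cdiag_def matrix_vector_mult_def if_distrib if_distribR cong: if_cong)
  then have "norm ((cdiag d *v x) $ i) \<le> norm ((b *\<^sub>R x) $ i)" for i
    using assms[of i] b by (simp add: norm_mult mult_right_mono)
  then have "norm (cdiag d *v x) \<le> norm (b *\<^sub>R x)" by (rule norm_le_componentwise_cart)
  then show "norm (cdiag d *v x) \<le> b * norm x" using b by simp
qed

lemma opnorm_mat_1: "opnorm (mat 1) \<le> 1"
  unfolding mat_eq_cdiag by (rule opnorm_cdiag) simp

lemma matrix_vector_mult_axis_nth: "(A *v axis j 1) $ i = A $ i $ j"
  by (simp add: matrix_vector_mult_def axis_def if_distrib cong: if_cong)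

lemma norm_nth_le_opnorm:
  fixes A :: "complex^'n^'n"
  shows "cmod (A $ i $ j) \<le> opnorm A"
proof -
  have "cmod (A $ i $ j) = cmod ((A *v axis j 1) $ i)"
    by (simp add: matrix_vector_mult_axis_nth)
  also have "\<dots> \<le> norm (A *v axis j 1)" by (rule Finite_Cartesian_Product.norm_nth_le)
  also have "\<dots> \<le> opnorm A * norm (axis j 1 :: complex^'n)" by (rule opnorm_bound)
  finally show ?thesis by simp
qed

text \<open>Summability and derivatives refer to the norm of the type, power estimates to
  \<open>opnorm\<close>. A crude dimensional constant suffices to pass between them.\<close>

lemma norm_le_opnorm: "norm (A :: complex^'n^'n) \<le> (CARD('n))\<^sup>2 * opnorm A"
proof -
  have "norm A \<le> (\<Sum>i\<in>UNIV. norm (A $ i))"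
    unfolding norm_vec_def by (rule L2_set_le_sum) simp
  also have "\<dots> \<le> (\<Sum>i\<in>UNIV. \<Sum>j\<in>UNIV. norm (A $ i $ j))"
    by (intro sum_mono) (subst norm_vec_def, rule L2_set_le_sum, simp)
  also have "\<dots> \<le> (\<Sum>i\<in>(UNIV :: 'n set). \<Sum>j\<in>(UNIV :: 'n set). opnorm A)"
    by (intro sum_mono norm_nth_le_opnorm)
  finally show ?thesis by (simp add: power2_eq_square mult.assoc)
qed

lemma opnorm_le_norm: "opnorm (A :: complex^'n^'n) \<le> CARD('n) * norm A"
proof (rule opnorm_le)
  fix x
  have "norm ((A *v x) $ i) \<le> norm A * norm x" for i
  proof -
    have "(A *v x) $ i = (\<Sum>j\<in>UNIV. A $ i $ j * x $ j)" by (simp add: matrix_vector_mult_def)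
    also have "norm \<dots> \<le> (\<Sum>j\<in>UNIV. \<bar>norm (A $ i $ j)\<bar> * \<bar>norm (x $ j)\<bar>)"
      by (intro order_trans[OF norm_sum] sum_mono) (simp add: norm_mult)
    also have "\<dots> \<le> norm (A $ i) * norm x"
      unfolding norm_vec_def[of "A $ i"] norm_vec_def[of x] by (rule L2_set_mult_ineq)
    also have "\<dots> \<le> norm A * norm x"
      by (intro mult_right_mono Finite_Cartesian_Product.norm_nth_le) simp
    finally show ?thesis .
  qed
  then have "(\<Sum>i\<in>UNIV. norm ((A *v x) $ i)) \<le> (\<Sum>i\<in>(UNIV :: 'n set). norm A * norm x)"
    by (intro sum_mono)
  moreover have "norm (A *v x) \<le> (\<Sum>i\<in>UNIV. norm ((A *v x) $ i))"
    unfolding norm_vec_def[of "A *v x"] by (rule L2_set_le_sum) simp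
  ultimately show "norm (A *v x) \<le> CARD('n) * norm A * norm x" by simp
qed

lemma continuous_opnorm: "continuous_on S (opnorm :: complex^'n^'n \<Rightarrow> real)"
proof (rule lipschitz_on_continuous_on, rule lipschitz_onI)
  fix X Y :: "complex^'n^'n"
  have "opnorm X \<le> opnorm Y + opnorm (X - Y)" "opnorm Y \<le> opnorm X + opnorm (Y - X)"
    using opnorm_triangle[of Y "X - Y"] opnorm_triangle[of X "Y - X"] by simp_all
  moreover have "opnorm (X - Y) \<le> CARD('n) * dist X Y" "opnorm (Y - X) \<le> CARD('n) * dist X Y"
    using opnorm_le_norm[of "X - Y"] opnorm_le_norm[of "Y - X"] by (simp_all add: dist_norm norm_minus_commute)
  ultimately show "dist (opnorm X) (opnorm Y) \<le> CARD('n) * dist X Y"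
    by (auto simp: dist_real_def)
qed simp

lemma open_opnorm_less: "open {X. opnorm X < r}"
  by (intro open_Collect_less continuous_opnorm continuous_on_const)

text \<open>Convexity of the domain is the hypothesis under which series are differentiated
  termwise.\<close>

lemma convex_opnorm_less: "convex {X. opnorm X < r}"
proof (rule convexI, safe)
  fix X Y :: "complex^'n^'n" and u v :: real
  assume h: "opnorm X < r" "opnorm Y < r" "0 \<le> u" "0 \<le> v" "u + v = 1"
  have "opnorm (u *\<^sub>R X + v *\<^sub>R Y) \<le> u * opnorm X + v * opnorm Y"
    using opnorm_triangle[of "u *\<^sub>R X" "v *\<^sub>R Y"] h by (simp add: opnorm_scaleR)
  also have "\<dots> < r" using h by (intro convex_bound_lt)
  finally show "opnorm (u *\<^sub>R X + v *\<^sub>R Y) < r" .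
qed

lemma eigenvalue_le_opnorm:
  assumes U: "unitary U" and A: "A = U ** cdiag d ** dagger U"
  shows "cmod (d i) \<le> opnorm A"
proof -
  define x where "x = U *v axis i 1"
  have x: "x \<noteq> 0"
  proof
    assume "x = 0"
    then have "dagger U *v x = 0" by simp
    then have "axis i (1 :: complex) = 0"
      unfolding x_def matrix_vector_mul_assoc using U by (simp add: unitary_def)
    then show False by (simp add: axis_eq_0_iff)
  qed
  have "A *v x = U *v (cdiag d *v axis i 1)"
    unfolding A x_def by (simp add: matrix_vector_mul_assoc unitary_cancel[OF U])
  also have "cdiag d *v axis i 1 = d i *s axis i 1"
    by (simp add: vec_eq_iff matrix_vector_mult_axis_nth cdiag_nth) (simp add: axis_def)
  finally have "A *v x = d i *s x" unfolding x_def by (simp add: vector_scalar_commute)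
  moreover have "norm (d i *s x) = cmod (d i) * norm x"
    unfolding norm_vec_def by (simp add: norm_mult L2_set_right_distrib)
  ultimately have "cmod (d i) * norm x \<le> opnorm A * norm x" using opnorm_bound[of A x] by simp
  then show ?thesis using x by simp
qed

section \<open>Power series of matrices and their derivatives\<close>

text \<open>This is the sum of all \<open>X^a ** Y ** X^b\<close> with a + b + 1 = k; the recursion
  is the product rule for \<open>X ** X^k\<close>.\<close>

primrec matpow_deriv :: "nat \<Rightarrow> complex^'n^'n \<Rightarrow> complex^'n^'n \<Rightarrow> complex^'n^'n" where
  "matpow_deriv 0 X Y = 0"
| "matpow_deriv (Suc k) X Y = Y ** matpow X k + X ** matpow_deriv k X Y"

primrec matpow_deriv2 :: "nat \<Rightarrow> complex^'n^'n \<Rightarrow> complex^'n^'n \<Rightarrow> complex^'n^'n \<Rightarrow> complex^'n^'n" where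
  "matpow_deriv2 0 X Y Z = 0"
| "matpow_deriv2 (Suc k) X Y Z =
     Y ** matpow_deriv k X Z + (Z ** matpow_deriv k X Y + X ** matpow_deriv2 k X Y Z)"

lemma has_derivative_matpow: "((\<lambda>X. matpow X k) has_derivative matpow_deriv k X) (at X)"
proof (induction k)
  case (Suc k)
  have "((\<lambda>X. X ** matpow X k) has_derivative (\<lambda>Y. X ** matpow_deriv k X Y + Y ** matpow X k)) (at X)"
    by (rule bounded_bilinear.FDERIV[OF bounded_bilinear_matrix_mult has_derivative_ident Suc])
  then show ?case by (simp add: add.commute)
qed simp

lemma has_derivative_matpow_deriv:
  "((\<lambda>X. matpow_deriv k X Y) has_derivative matpow_deriv2 k X Y) (at X)"
proof (induction k)
  case (Suc k)
  have "((\<lambda>X. Y ** matpow X k + X ** matpow_deriv k X Y) has_derivative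
      (\<lambda>Z. Y ** matpow_deriv k X Z + (X ** matpow_deriv2 k X Y Z + Z ** matpow_deriv k X Y))) (at X)"
    by (intro has_derivative_add
        bounded_linear.has_derivative[OF bounded_linear_const_mult has_derivative_matpow]
        bounded_bilinear.FDERIV[OF bounded_bilinear_matrix_mult has_derivative_ident Suc])
  then show ?case by (simp add: add.commute[of "X ** matpow_deriv2 k X Y _"])
qed simp

lemma opnorm_matpow: "opnorm X \<le> r \<Longrightarrow> opnorm (matpow X k) \<le> r ^ k"
proof (induction k)
  case (Suc k)
  have "opnorm (X ** matpow X k) \<le> opnorm X * opnorm (matpow X k)" by (rule opnorm_mult)
  also have "\<dots> \<le> r * r ^ k"
    using Suc opnorm_nonneg by (intro mult_mono) (auto intro: order_trans)
  finally show ?case by simp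
qed (simp add: opnorm_mat_1)

text \<open>The bounds carry an extra factor \<open>r\<close> so that no truncated exponent \<open>k - 1\<close> occurs.\<close>

lemma opnorm_matpow_deriv:
  assumes r: "opnorm X \<le> r"
  shows "r * opnorm (matpow_deriv k X Y) \<le> real k * r ^ k * opnorm Y"
proof (induction k)
  case 0
  have "opnorm (0 :: complex^'a^'a) \<le> 0" by (rule opnorm_le) simp
  then show ?case using opnorm_nonneg[of "0 :: complex^'a^'a"] by simp
next
  case (Suc k)
  have r0: "0 \<le> r" using opnorm_nonneg order_trans r by blast
  have "opnorm (matpow_deriv (Suc k) X Y) \<le> opnorm Y * opnorm (matpow X k) + opnorm X * opnorm (matpow_deriv k X Y)"
    using opnorm_triangle[of "Y ** matpow X k" "X ** matpow_deriv k X Y"]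
      opnorm_mult[of Y "matpow X k"] opnorm_mult[of X "matpow_deriv k X Y"] by simp
  also have "\<dots> \<le> opnorm Y * r ^ k + r * opnorm (matpow_deriv k X Y)"
    by (intro add_mono mult_left_mono mult_right_mono opnorm_matpow opnorm_nonneg r)
  also have "\<dots> \<le> opnorm Y * r ^ k + real k * r ^ k * opnorm Y" using Suc by simp
  also have "\<dots> = real (Suc k) * r ^ k * opnorm Y" by (simp add: algebra_simps)
  finally have "r * opnorm (matpow_deriv (Suc k) X Y) \<le> r * (real (Suc k) * r ^ k * opnorm Y)"
    using r0 by (rule mult_left_mono)
  then show ?case by (simp add: mult_ac)
qed

lemma opnorm_matpow_deriv2:
  assumes r: "opnorm X \<le> r"
  shows "r * (r * opnorm (matpow_deriv2 k X Y Z)) \<le> real k * (real k * r ^ k) * (opnorm Y * opnorm Z)"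
proof (induction k)
  case 0
  have "opnorm (0 :: complex^'a^'a) \<le> 0" by (rule opnorm_le) simp
  then show ?case using opnorm_nonneg[of "0 :: complex^'a^'a"] by simp
next
  case (Suc k)
  have r0: "0 \<le> r" using opnorm_nonneg order_trans r by blast
  have "opnorm (matpow_deriv2 (Suc k) X Y Z) \<le> opnorm Y * opnorm (matpow_deriv k X Z)
      + (opnorm Z * opnorm (matpow_deriv k X Y) + opnorm X * opnorm (matpow_deriv2 k X Y Z))"
    unfolding matpow_deriv2.simps
    by (intro order_trans[OF opnorm_triangle] add_mono opnorm_mult)
  also have "opnorm X * opnorm (matpow_deriv2 k X Y Z) \<le> r * opnorm (matpow_deriv2 k X Y Z)"
    by (intro mult_right_mono r opnorm_nonneg)
  finally have "r * opnorm (matpow_deriv2 (Suc k) X Y Z) \<le> r * (opnorm Y * opnorm (matpow_deriv k X Z)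
      + (opnorm Z * opnorm (matpow_deriv k X Y) + r * opnorm (matpow_deriv2 k X Y Z)))"
    using r0 by (intro mult_left_mono) auto
  also have "\<dots> = opnorm Y * (r * opnorm (matpow_deriv k X Z)) + (opnorm Z * (r * opnorm (matpow_deriv k X Y))
      + r * (r * opnorm (matpow_deriv2 k X Y Z)))" by (simp add: algebra_simps)
  also have "\<dots> \<le> opnorm Y * (real k * r ^ k * opnorm Z) + (opnorm Z * (real k * r ^ k * opnorm Y)
      + real k * (real k * r ^ k) * (opnorm Y * opnorm Z))"
    by (intro add_mono mult_left_mono opnorm_matpow_deriv r opnorm_nonneg Suc)
  also have "\<dots> = (real k * (real k + 2)) * (r ^ k * (opnorm Y * opnorm Z))" by (simp add: algebra_simps)
  also have "\<dots> \<le> (real (Suc k) * real (Suc k)) * (r ^ k * (opnorm Y * opnorm Z))"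
    using r0 opnorm_nonneg[of Y] opnorm_nonneg[of Z]
    by (intro mult_right_mono mult_nonneg_nonneg zero_le_power) (simp_all add: algebra_simps)
  finally have "r * (r * opnorm (matpow_deriv2 (Suc k) X Y Z))
      \<le> r * ((real (Suc k) * real (Suc k)) * (r ^ k * (opnorm Y * opnorm Z)))"
    using r0 by (intro mult_left_mono) auto
  then show ?case by (simp add: mult_ac)
qed

text \<open>The bound \<open>B k * norm H\<close>, uniform over the ball, makes the differentiated
  series converge uniformly: its tails are at most the tails of \<open>B\<close> times
  \<open>norm H\<close>. Openness of the ball turns the derivative within it into a full
  one.\<close>

lemma has_derivative_suminf_opnorm:
  fixes f :: "nat \<Rightarrow> complex^'n^'n \<Rightarrow> complex^'n^'n"
    and f' :: "nat \<Rightarrow> complex^'n^'n \<Rightarrow> complex^'n^'n \<Rightarrow> complex^'n^'n"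
  assumes f: "\<And>k X. (f k has_derivative f' k X) (at X)"
    and bd: "\<And>k X H. opnorm X < r \<Longrightarrow> norm (f' k X H) \<le> B k * norm H"
    and B: "summable B"
    and sf: "\<And>X. opnorm X < r \<Longrightarrow> summable (\<lambda>k. f k X)"
    and X: "opnorm X < r"
  shows "((\<lambda>X. \<Sum>k. f k X) has_derivative (\<lambda>H. \<Sum>k. f' k X H)) (at X)"
proof -
  let ?S = "{X :: complex^'n^'n. opnorm X < r}"
  have sf': "summable (\<lambda>k. f' k X H)" if "opnorm X < r" for X H :: "complex^'n^'n"
    using bd[OF that] by (intro summable_comparison_test'[OF summable_mult2[OF B, of "norm H"]]) auto
  have "\<exists>g. \<forall>X\<in>?S. (\<lambda>k. f k X) sums (g X) \<and> (g has_derivative (\<lambda>H. \<Sum>k. f' k X H)) (at X within ?S)"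
  proof (rule has_derivative_series[OF convex_opnorm_less])
    show "(f k has_derivative f' k X) (at X within ?S)" if "X \<in> ?S" for k and X :: "complex^'n^'n"
      using f by (rule has_derivative_at_withinI)
    show "X \<in> ?S" using X by simp
    show "(\<lambda>k. f k X) sums (\<Sum>k. f k X)" using sf[OF X] by (rule summable_sums)
    fix e :: real assume e: "e > 0"
    have "\<forall>\<^sub>F n in sequentially. \<bar>\<Sum>k. B (k + n)\<bar> < e"
      using order_tendstoD(2)[OF tendsto_rabs_zero[OF suminf_exist_split2[OF B]] e] .
    then show "\<forall>\<^sub>F n in sequentially. \<forall>X\<in>?S. \<forall>H. norm ((\<Sum>k<n. f' k X H) - (\<Sum>k. f' k X H)) \<le> e * norm H"
    proof eventually_elim
      case (elim n)
      show ?case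
      proof safe
        fix X H :: "complex^'n^'n"
        assume X: "opnorm X < r"
        have B': "summable (\<lambda>k. B (k + n) * norm H)" by (intro summable_mult2 summable_ignore_initial_segment B)
        have "norm ((\<Sum>k<n. f' k X H) - (\<Sum>k. f' k X H)) = norm (\<Sum>k. f' (k + n) X H)"
          using suminf_split_initial_segment[OF sf'[OF X, of H], of n] by simp
        also have "\<dots> \<le> (\<Sum>k. B (k + n) * norm H)"
          by (rule norm_suminf_le[OF bd[OF X] B'])
        also have "\<dots> = (\<Sum>k. B (k + n)) * norm H"
          by (rule suminf_mult2[symmetric]) (intro summable_ignore_initial_segment B)
        also have "\<dots> \<le> e * norm H" using elim by (intro mult_right_mono) auto
        finally show "norm ((\<Sum>k<n. f' k X H) - (\<Sum>k. f' k X H)) \<le> e * norm H" .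
      qed
    qed
  qed
  then obtain g where g: "\<And>X. X \<in> ?S \<Longrightarrow> (\<lambda>k. f k X) sums (g X)"
    "\<And>X. X \<in> ?S \<Longrightarrow> (g has_derivative (\<lambda>H. \<Sum>k. f' k X H)) (at X within ?S)" by blast
  have XS: "X \<in> ?S" using X by simp
  have "(g has_derivative (\<lambda>H. \<Sum>k. f' k X H)) (at X)"
    using g(2)[OF XS] unfolding at_within_open[OF XS open_opnorm_less] .
  then show ?thesis
  proof (rule has_derivative_transform_within_open[OF _ open_opnorm_less])
    show "X \<in> ?S" using X by simp
    show "g Y = (\<Sum>k. f k Y)" if "Y \<in> ?S" for Y using g(1)[OF that] by (rule sums_unique)
  qed
qed

text \<open>Radius of convergence at least \<open>K\<close>, stated for real arguments so that the
  scalar binomial and exponential series apply directly.\<close>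

definition pow_summable :: "real \<Rightarrow> (nat \<Rightarrow> real) \<Rightarrow> bool" where
  "pow_summable K c \<longleftrightarrow> (\<forall>x. \<bar>x\<bar> < K \<longrightarrow> summable (\<lambda>k. c k * x ^ k))"

lemma pow_summable_abs:
  assumes c: "pow_summable K c" and r: "0 \<le> r" "r < K"
  shows "summable (\<lambda>k. \<bar>c k\<bar> * r ^ k)"
proof -
  obtain x where x: "r < x" "x < K" using dense[OF r(2)] by auto
  then have "summable (\<lambda>k. c k * x ^ k)" using c r by (simp add: pow_summable_def)
  from powser_insidea[OF this, of r] x r show ?thesis by (simp add: abs_mult)
qed

text \<open>Termwise differentiation preserves the radius; multiplying by \<open>x\<close> restores
  the index, and the term at \<open>k = 0\<close> is zero.\<close>

lemma pow_summable_mult_index: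
  assumes c: "pow_summable K c"
  shows "pow_summable K (\<lambda>k. real k * c k)"
  unfolding pow_summable_def
proof safe
  fix x :: real assume x: "\<bar>x\<bar> < K"
  have "summable (\<lambda>k. diffs c k * x ^ k)"
    using c x by (intro termdiff_converges[of _ K]) (auto simp: pow_summable_def)
  then have "summable (\<lambda>k. (diffs c k * x ^ k) * x)" by (rule summable_mult2)
  then have "summable (\<lambda>k. real (Suc k) * c (Suc k) * x ^ Suc k)" by (simp add: diffs_def mult_ac)
  then show "summable (\<lambda>k. real k * c k * x ^ k)"
    using summable_Suc_iff[of "\<lambda>k. real k * c k * x ^ k"] by simp
qed

definition matser :: "(nat \<Rightarrow> real) \<Rightarrow> complex^'n^'n \<Rightarrow> complex^'n^'n" where
  "matser c X = (\<Sum>k. c k *\<^sub>R matpow X k)"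

definition matser_deriv :: "(nat \<Rightarrow> real) \<Rightarrow> complex^'n^'n \<Rightarrow> complex^'n^'n \<Rightarrow> complex^'n^'n" where
  "matser_deriv c X Y = (\<Sum>k. c k *\<^sub>R matpow_deriv k X Y)"

context
  fixes K :: real and c :: "nat \<Rightarrow> real"
  assumes c: "pow_summable K c"
begin

lemma summable_matser:
  assumes X: "opnorm (X :: complex^'n^'n) < K"
  shows "summable (\<lambda>k. c k *\<^sub>R matpow X k)"
proof (rule summable_comparison_test'[of "\<lambda>k. (CARD('n))\<^sup>2 * (\<bar>c k\<bar> * opnorm X ^ k)" 0])
  show "summable (\<lambda>k. (CARD('n))\<^sup>2 * (\<bar>c k\<bar> * opnorm X ^ k))"
    by (intro summable_mult pow_summable_abs[OF c] opnorm_nonneg X)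
  fix k
  have "norm (matpow X k) \<le> (CARD('n))\<^sup>2 * opnorm X ^ k"
    by (rule order_trans[OF norm_le_opnorm]) (intro mult_left_mono opnorm_matpow, simp_all)
  then have "\<bar>c k\<bar> * norm (matpow X k) \<le> \<bar>c k\<bar> * ((CARD('n))\<^sup>2 * opnorm X ^ k)"
    by (intro mult_left_mono) auto
  then show "norm (c k *\<^sub>R matpow X k) \<le> (CARD('n))\<^sup>2 * (\<bar>c k\<bar> * opnorm X ^ k)" by (simp add: mult_ac)
qed

text \<open>The third power of the dimension consists of two factors from
  \<open>norm_le_opnorm\<close> and one from \<open>opnorm_le_norm\<close>; the division by
  \<open>r\<close> removes the extra factor in \<open>opnorm_matpow_deriv\<close>.\<close>

lemma matpow_deriv_bound:
  assumes r: "0 < r" and X: "opnorm (X :: complex^'n^'n) \<le> r"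
  shows "norm (c k *\<^sub>R matpow_deriv k X Y)
     \<le> real CARD('n) ^ 3 / r * (\<bar>real k * c k\<bar> * r ^ k) * norm Y"
proof -
  have "opnorm (matpow_deriv k X Y) \<le> real k * r ^ k * opnorm Y / r"
    using opnorm_matpow_deriv[OF X, of k Y] r by (simp add: field_simps)
  also have "\<dots> \<le> real k * r ^ k * (CARD('n) * norm Y) / r"
    using r by (intro divide_right_mono mult_left_mono opnorm_le_norm) auto
  finally have "norm (matpow_deriv k X Y) \<le> (CARD('n))\<^sup>2 * (real k * r ^ k * (CARD('n) * norm Y) / r)"
    by (intro order_trans[OF norm_le_opnorm] mult_left_mono) auto
  then have "\<bar>c k\<bar> * norm (matpow_deriv k X Y)
      \<le> \<bar>c k\<bar> * ((CARD('n))\<^sup>2 * (real k * r ^ k * (CARD('n) * norm Y) / r))"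
    by (rule mult_left_mono) simp
  then show ?thesis by (simp add: abs_mult mult_ac power2_eq_square power3_eq_cube)
qed

lemma summable_matser_deriv:
  assumes X: "opnorm (X :: complex^'n^'n) < K"
  shows "summable (\<lambda>k. c k *\<^sub>R matpow_deriv k X Y)"
proof -
  \<comment> \<open>Strictly above \<open>opnorm X\<close>, hence positive even for
    \<open>X = 0\<close>, so that the bounds can be divided by it.\<close>
  obtain r where r: "opnorm X < r" "r < K" using dense[OF X] by auto
  then have r0: "0 < r" using opnorm_nonneg[of X] by linarith
  have "summable (\<lambda>k. real CARD('n) ^ 3 / r * (\<bar>real k * c k\<bar> * r ^ k) * norm Y)"
    using r r0 by (intro summable_mult summable_mult2 pow_summable_abs[OF pow_summable_mult_index[OF c]]) auto
  then show ?thesis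
    by (rule summable_comparison_test'[of _ 0]) (rule matpow_deriv_bound[OF r0 less_imp_le[OF r(1)]])
qed

lemma has_derivative_matser:
  assumes X: "opnorm (X :: complex^'n^'n) < K"
  shows "(matser c has_derivative matser_deriv c X) (at X)"
proof -
  obtain r where r: "opnorm X < r" "r < K" using dense[OF X] by auto
  then have r0: "0 < r" using opnorm_nonneg[of X] by linarith
  have "((\<lambda>X. \<Sum>k. c k *\<^sub>R matpow X k) has_derivative (\<lambda>H. \<Sum>k. c k *\<^sub>R matpow_deriv k X H)) (at X)"
  proof (rule has_derivative_suminf_opnorm[where r = r])
    show "((\<lambda>X. c k *\<^sub>R matpow X k) has_derivative (\<lambda>H. c k *\<^sub>R matpow_deriv k X H)) (at X)" for k X
      by (intro has_derivative_scaleR_right has_derivative_matpow)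
    show "norm (c k *\<^sub>R matpow_deriv k X H)
        \<le> (real CARD('n) ^ 3 / r * (\<bar>real k * c k\<bar> * r ^ k)) * norm H"
      if "opnorm X < r" for k and X H :: "complex^'n^'n"
      using that by (intro matpow_deriv_bound[OF r0]) simp
    show "summable (\<lambda>k. real CARD('n) ^ 3 / r * (\<bar>real k * c k\<bar> * r ^ k))"
      using r r0 by (intro summable_mult pow_summable_abs[OF pow_summable_mult_index[OF c]]) auto
    show "summable (\<lambda>k. c k *\<^sub>R matpow X k)" if "opnorm X < r" for X :: "complex^'n^'n"
      using that r by (intro summable_matser) simp
  qed (rule r)
  then show ?thesis unfolding matser_def matser_deriv_def by simp
qed

lemma has_derivative_matser_deriv:
  assumes X: "opnorm (X :: complex^'n^'n) < K"
  shows "((\<lambda>X. matser_deriv c X Y) has_derivative (\<lambda>Z. \<Sum>k. c k *\<^sub>R matpow_deriv2 k X Y Z)) (at X)"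
proof -
  obtain r where r: "opnorm X < r" "r < K" using dense[OF X] by auto
  then have r0: "0 < r" using opnorm_nonneg[of X] by linarith
  define b where "b = real ((CARD('n))\<^sup>2) * opnorm Y * CARD('n) / (r * r)"
  have "((\<lambda>X. \<Sum>k. c k *\<^sub>R matpow_deriv k X Y) has_derivative (\<lambda>Z. \<Sum>k. c k *\<^sub>R matpow_deriv2 k X Y Z)) (at X)"
  proof (rule has_derivative_suminf_opnorm[where r = r])
    show "((\<lambda>X. c k *\<^sub>R matpow_deriv k X Y) has_derivative (\<lambda>Z. c k *\<^sub>R matpow_deriv2 k X Y Z)) (at X)" for k X
      by (intro has_derivative_scaleR_right has_derivative_matpow_deriv)
    show "norm (c k *\<^sub>R matpow_deriv2 k X Y Z) \<le> (b * (\<bar>real k * (real k * c k)\<bar> * r ^ k)) * norm Z"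
      if X: "opnorm X < r" for k and X Z :: "complex^'n^'n"
    proof -
      have "r * r * opnorm (matpow_deriv2 k X Y Z) \<le> real k * (real k * r ^ k) * (opnorm Y * opnorm Z)"
        using opnorm_matpow_deriv2[of X r k Y Z] X by (simp add: mult_ac)
      also have "\<dots> \<le> real k * (real k * r ^ k) * (opnorm Y * (CARD('n) * norm Z))"
        using r0 opnorm_nonneg by (intro mult_left_mono opnorm_le_norm) auto
      finally have "opnorm (matpow_deriv2 k X Y Z) \<le> real k * (real k * r ^ k) * (opnorm Y * (CARD('n) * norm Z)) / (r * r)"
        using r0 by (simp add: pos_le_divide_eq mult_ac)
      then have "norm (matpow_deriv2 k X Y Z)
          \<le> (CARD('n))\<^sup>2 * (real k * (real k * r ^ k) * (opnorm Y * (CARD('n) * norm Z)) / (r * r))"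
        by (intro order_trans[OF norm_le_opnorm] mult_left_mono) auto
      then have "\<bar>c k\<bar> * norm (matpow_deriv2 k X Y Z)
          \<le> \<bar>c k\<bar> * ((CARD('n))\<^sup>2 * (real k * (real k * r ^ k) * (opnorm Y * (CARD('n) * norm Z)) / (r * r)))"
        by (rule mult_left_mono) simp
      then show ?thesis by (simp add: b_def abs_mult mult_ac)
    qed
    show "summable (\<lambda>k. b * (\<bar>real k * (real k * c k)\<bar> * r ^ k))"
      using r r0
      by (intro summable_mult pow_summable_abs[OF pow_summable_mult_index[OF pow_summable_mult_index[OF c]]]) auto
    show "summable (\<lambda>k. c k *\<^sub>R matpow_deriv k X Y)" if "opnorm X < r" for X :: "complex^'n^'n"
      using that r by (intro summable_matser_deriv) simp
  qed (rule r)
  then show ?thesis unfolding matser_deriv_def .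
qed

end

section \<open>Traces and eigenbasis entries of the derivatives\<close>

lemma trace_zero: "trace (0 :: complex^'n^'n) = 0"
  by (simp add: trace_def)

text \<open>By cyclicity all \<open>k\<close> summands of the derivative have the same trace. The
  prefix \<open>matpow X m\<close> absorbs the left factors during the induction; the exponent is
  truncated only where the factor \<open>k\<close> is zero.\<close>

lemma trace_matpow_deriv:
  "trace (matpow X m ** matpow_deriv k X Y) = of_nat k * trace (matpow X (m + k - 1) ** Y)"
proof (induction k arbitrary: m)
  case (Suc k)
  have "trace (matpow X m ** matpow_deriv (Suc k) X Y)
      = trace (matpow X m ** (Y ** matpow X k)) + trace (matpow X m ** (X ** matpow_deriv k X Y))"
    by (simp add: matrix_add_ldistrib trace_add)
  also have "trace (matpow X m ** (Y ** matpow X k)) = trace (matpow X (m + k) ** Y)"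
    using trace_mul_sym[of "matpow X m ** Y" "matpow X k"]
    by (simp add: matrix_mul_assoc add.commute[of m] matpow_add)
  also have "matpow X m ** (X ** matpow_deriv k X Y) = matpow X (Suc m) ** matpow_deriv k X Y"
    using matpow_add[of X m 1] by (simp add: matrix_mul_assoc)
  also have "trace \<dots> = of_nat k * trace (matpow X (m + k) ** Y)"
    unfolding Suc by simp
  finally show ?case by (simp add: algebra_simps)
qed (simp add: trace_zero)

text \<open>Under the trace the noncommutative derivative collapses to the scalar rule: the
  differential of Tr f(X) is Tr (f'(X) Y), with \<open>diffs c\<close> the coefficients of
  f'.\<close>

lemma trace_matser_deriv:
  assumes c: "pow_summable K c" and X: "opnorm X < K" and K: "pow_summable K (diffs c)"
  shows "trace (matser_deriv c X Y) = trace (matser (diffs c) X ** Y)"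
proof -
  have bl: "bounded_linear (\<lambda>A. trace (A ** Y))"
    by (rule bounded_linear_compose[OF bounded_linear_trace bounded_linear_mult_const])
  have "trace (matser_deriv c X Y) = (\<Sum>k. trace (c k *\<^sub>R matpow_deriv k X Y))"
    unfolding matser_deriv_def
    by (rule bounded_linear.suminf[OF bounded_linear_trace summable_matser_deriv[OF c X]])
  also have "\<dots> = (\<Sum>k. trace (c (Suc k) *\<^sub>R matpow_deriv (Suc k) X Y))"
    using bounded_linear.summable[OF bounded_linear_trace summable_matser_deriv[OF c X, of Y]]
    by (subst suminf_split_head) (simp_all add: trace_zero)
  also have "\<dots> = (\<Sum>k. trace (diffs c k *\<^sub>R matpow X k ** Y))"
  proof (rule suminf_cong)
    fix k
    have "trace (c (Suc k) *\<^sub>R matpow_deriv (Suc k) X Y) = c (Suc k) *\<^sub>R trace (matpow X 0 ** matpow_deriv (Suc k) X Y)"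
      by (simp add: linear_cmul[OF bounded_linear.linear[OF bounded_linear_trace]] del: matpow_deriv.simps)
    also have "\<dots> = trace (diffs c k *\<^sub>R matpow X k ** Y)"
      unfolding trace_matpow_deriv
      by (simp add: diffs_def scaleR_mult_left linear_cmul[OF bounded_linear.linear[OF bounded_linear_trace]]
          scaleR_conv_of_real[where 'a = complex])
    finally show "trace (c (Suc k) *\<^sub>R matpow_deriv (Suc k) X Y) = trace (diffs c k *\<^sub>R matpow X k ** Y)" .
  qed
  also have "\<dots> = trace (matser (diffs c) X ** Y)"
    unfolding matser_def
    by (rule bounded_linear.suminf[OF bl summable_matser[OF K X], symmetric])
  finally show ?thesis .
qed

text \<open>The sum of \<open>d p ^ a * d q ^ b\<close> over a + b + 1 = k is the divided difference
  of the k-th power. It is stated multiplied out so that it also covers equal eigenvalues.\<close>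

lemma matpow_deriv_cdiag:
  "(d p - d q) * matpow_deriv k (cdiag d) Y $ p $ q = (d p ^ k - d q ^ k) * Y $ p $ q"
proof (induction k)
  case (Suc k)
  have "(d p - d q) * matpow_deriv (Suc k) (cdiag d) Y $ p $ q
      = (d p - d q) * (Y $ p $ q * d q ^ k) + d p * ((d p - d q) * matpow_deriv k (cdiag d) Y $ p $ q)"
    by (simp add: matpow_cdiag mult_cdiag_nth cdiag_mult_nth algebra_simps)
  then show ?case unfolding Suc by (simp add: algebra_simps)
qed simp

text \<open>The confluent case, where the divided difference becomes a derivative. It serves
  Duhamel's formula, which must hold on the diagonal as well.\<close>

lemma matpow_deriv_cdiag_eq:
  "d p = d q \<Longrightarrow> matpow_deriv (Suc k) (cdiag d) Y $ p $ q = of_nat (Suc k) * d p ^ k * Y $ p $ q"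
proof (induction k)
  case (Suc k)
  have "matpow_deriv (Suc (Suc k)) (cdiag d) Y $ p $ q
      = Y $ p $ q * d q ^ Suc k + d p * matpow_deriv (Suc k) (cdiag d) Y $ p $ q"
    by (subst matpow_deriv.simps) (simp only: matpow_cdiag mult_cdiag_nth cdiag_mult_nth vector_add_component)
  also have "\<dots> = of_nat (Suc (Suc k)) * d p ^ Suc k * Y $ p $ q"
    unfolding Suc.IH[OF Suc.prems] Suc.prems[symmetric] by (simp add: algebra_simps)
  finally show ?case .
qed (simp add: mat_eq_cdiag mult_cdiag_nth)

lemma matpow_deriv_unitary_conj:
  assumes U: "unitary U"
  shows "dagger U ** matpow_deriv k (U ** A ** dagger U) Y ** U = matpow_deriv k A (dagger U ** Y ** U)"
proof (induction k)
  case (Suc k)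
  have "dagger U ** matpow_deriv (Suc k) (U ** A ** dagger U) Y ** U
     = dagger U ** Y ** (U ** matpow A k ** dagger U) ** U + dagger U ** (U ** A ** dagger U) ** matpow_deriv k (U ** A ** dagger U) Y ** U"
    by (simp add: matpow_unitary_conj[OF U] matrix_add_ldistrib matrix_add_rdistrib matrix_mul_assoc)
  also have "dagger U ** Y ** (U ** matpow A k ** dagger U) ** U = dagger U ** Y ** U ** matpow A k"
    by (simp add: matrix_mul_assoc unitary_cancel[OF U])
  also have "dagger U ** (U ** A ** dagger U) ** matpow_deriv k (U ** A ** dagger U) Y ** U
      = A ** (dagger U ** matpow_deriv k (U ** A ** dagger U) Y ** U)"
    by (simp add: matrix_mul_assoc[symmetric] unitary_cancel[OF U])
  finally show ?case unfolding Suc by simp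
qed simp

text \<open>The Daleckii-Krein formula: in an eigenbasis the derivative of a matrix function
  multiplies each entry of the direction by a divided difference.\<close>

lemma matser_deriv_cdiag:
  assumes c: "pow_summable K c" and d: "opnorm (cdiag d) < K"
    and s: "(\<lambda>k. of_real (c k) * d p ^ k) sums s p" "(\<lambda>k. of_real (c k) * d q ^ k) sums s q"
  shows "(d p - d q) * matser_deriv c (cdiag d) Y $ p $ q = (s p - s q) * Y $ p $ q"
proof -
  have "(\<lambda>k. (d p - d q) * (c k *\<^sub>R matpow_deriv k (cdiag d) Y) $ p $ q)
      sums ((d p - d q) * matser_deriv c (cdiag d) Y $ p $ q)"
    unfolding matser_deriv_def
    by (intro sums_mult bounded_linear.sums[OF bounded_linear_nth_nth] summable_sums
        summable_matser_deriv[OF c d])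
  moreover have "(d p - d q) * (c k *\<^sub>R matpow_deriv k (cdiag d) Y) $ p $ q
      = (of_real (c k) * d p ^ k - of_real (c k) * d q ^ k) * Y $ p $ q" for k
  proof -
    have "(d p - d q) * (c k *\<^sub>R matpow_deriv k (cdiag d) Y) $ p $ q
       = of_real (c k) * ((d p - d q) * matpow_deriv k (cdiag d) Y $ p $ q)"
      by (simp add: scaleR_conv_of_real[where 'a = complex])
    then show ?thesis unfolding matpow_deriv_cdiag by (simp add: algebra_simps)
  qed
  moreover have "(\<lambda>k. (of_real (c k) * d p ^ k - of_real (c k) * d q ^ k) * Y $ p $ q) sums ((s p - s q) * Y $ p $ q)"
    by (intro sums_mult2 sums_diff s)
  ultimately show ?thesis by (simp add: sums_iff)
qed

section \<open>The channels in an eigenbasis\<close>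

lemma mat_exp_cscale_diag:
  assumes U: "unitary U"
  shows "mat_exp (cscale c (U ** real_diag g ** dagger U)) = U ** cdiag (\<lambda>a. exp (c * complex_of_real (g a))) ** dagger U"
proof -
  have "cscale c (U ** real_diag g ** dagger U) = U ** cdiag (\<lambda>a. c * complex_of_real (g a)) ** dagger U"
    unfolding real_diag_eq_cdiag cscale_cdiag[symmetric] cscale_mult_left cscale_mult_right ..
  then show ?thesis by (simp add: mat_exp_diag[OF U])
qed

lemma unitary_cdiag:
  assumes "\<And>i. cmod (d i) = 1"
  shows "unitary (cdiag d)"
proof -
  have "d i * cnj (d i) = 1" "cnj (d i) * d i = 1" for i
    using complex_norm_square[of "d i"] assms[of i] by (simp_all add: mult.commute)
  then show ?thesis by (simp add: unitary_def dagger_cdiag cdiag_mult mat_eq_cdiag)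
qed

lemma exp_i_eq_cis: "exp (\<i> * complex_of_real r * complex_of_real g) = cis (g * r)"
  "exp (- \<i> * complex_of_real r * complex_of_real g) = cis (- g * r)"
  by (simp_all add: cis_conv_exp mult_ac)

lemma mat_exp_i:
  assumes U: "unitary U"
  shows "mat_exp (cscale (\<i> * complex_of_real t) (U ** real_diag g ** dagger U)) = U ** cdiag (\<lambda>a. cis (g a * t)) ** dagger U"
    "mat_exp (cscale (- \<i> * complex_of_real t) (U ** real_diag g ** dagger U)) = U ** cdiag (\<lambda>a. cis (- g a * t)) ** dagger U"
  unfolding mat_exp_cscale_diag[OF U] exp_i_eq_cis by (rule refl)+

lemma mat_exp_i_hermitian:
  assumes G: "hermitian G"
  shows "unitary (mat_exp (cscale (- \<i> * complex_of_real t) G))"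
    "dagger (mat_exp (cscale (- \<i> * complex_of_real t) G)) = mat_exp (cscale (\<i> * complex_of_real t) G)"
proof -
  obtain U g where U: "unitary U" and Geq: "G = U ** real_diag g ** dagger U"
    using hermitian_spectral[OF G] .
  show "unitary (mat_exp (cscale (- \<i> * complex_of_real t) G))"
    unfolding Geq mat_exp_i[OF U] by (intro unitary_mult unitary_dagger unitary_cdiag U) simp
  show "dagger (mat_exp (cscale (- \<i> * complex_of_real t) G)) = mat_exp (cscale (\<i> * complex_of_real t) G)"
    unfolding Geq mat_exp_i[OF U] by (simp add: dagger_mult dagger_cdiag cis_cnj matrix_mul_assoc)
qed

definition std_mat :: "'n \<Rightarrow> 'n \<Rightarrow> complex \<Rightarrow> complex^'n^'n" where
  "std_mat a b c = (\<chi> i j. if i = a \<and> j = b then c else 0)"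

lemma bounded_linear_std_mat: "bounded_linear (std_mat a b)"
  unfolding linear_conv_bounded_linear[symmetric]
  by (intro linearI) (simp_all add: std_mat_def vec_eq_iff)

lemma sum_std_mat: "A = (\<Sum>a\<in>UNIV. \<Sum>b\<in>UNIV. std_mat a b (A $ a $ b))"
proof -
  have "(\<Sum>a\<in>UNIV. \<Sum>b\<in>UNIV. if i = a \<and> j = b then A $ a $ b else 0) = A $ i $ j" for i j
  proof -
    have "(\<Sum>b\<in>UNIV. if i = a \<and> j = b then A $ a $ b else 0) = (if i = a then A $ a $ j else 0)" for a
      by (cases "i = a") simp_all
    then show ?thesis by simp
  qed
  then show ?thesis by (simp add: vec_eq_iff std_mat_def)
qed

text \<open>Each entry enters through a bounded linear map into a matrix unit, which commutes with
  the integral.\<close>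

lemma has_bochner_integral_matrix:
  fixes I :: "'n::finite \<Rightarrow> 'n \<Rightarrow> complex"
  assumes "\<And>a b. has_bochner_integral M (\<lambda>t. f t $ a $ b) (I a b)"
  shows "has_bochner_integral M f (\<chi> a b. I a b)"
proof -
  have "has_bochner_integral M (\<lambda>t. \<Sum>a\<in>UNIV. \<Sum>b\<in>UNIV. std_mat a b (f t $ a $ b))
     (\<Sum>a\<in>UNIV. \<Sum>b\<in>UNIV. std_mat a b (I a b))"
    by (intro has_bochner_integral_sum has_bochner_integral_bounded_linear[OF bounded_linear_std_mat] assms)
  moreover have "(\<Sum>a\<in>UNIV. \<Sum>b\<in>UNIV. std_mat a b (I a b)) = (\<chi> a b. I a b)"
    by (subst sum_std_mat[of "\<chi> a b. I a b"]) simp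
  ultimately show ?thesis unfolding sum_std_mat[symmetric] by simp
qed

text \<open>In an eigenbasis of \<open>G\<close> conjugation multiplies the entry at (a, b) by the
  phase \<open>cis (- (g a - g b) * t)\<close>, so averaging replaces the phase by the Fourier
  transform at the eigenvalue gap. The transform is complex because the weight of \<open>Psi\<close>
  is not even.\<close>

lemma has_bochner_integral_Phi:
  assumes U: "unitary U" and G: "G = U ** real_diag g ** dagger U"
    and p: "\<And>x. has_bochner_integral lborel (\<lambda>t. p t *\<^sub>R cis (- x * t)) (p' x)"
  shows "has_bochner_integral lborel (\<lambda>t. p t *\<^sub>R
     (mat_exp (cscale (- \<i> * complex_of_real t) G) ** X ** mat_exp (cscale (\<i> * complex_of_real t) G)))
     (U ** (\<chi> a b. p' (g a - g b) * (dagger U ** X ** U) $ a $ b) ** dagger U)"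
proof -
  define Y where "Y = dagger U ** X ** U"
  define F where "F t = (\<chi> a b. (p t *\<^sub>R cis (- (g a - g b) * t)) * Y $ a $ b)" for t
  have "has_bochner_integral lborel F (\<chi> a b. p' (g a - g b) * Y $ a $ b)"
    by (intro has_bochner_integral_matrix)
       (simp only: F_def vec_lambda_beta, intro has_bochner_integral_mult_left p)
  then have "has_bochner_integral lborel (\<lambda>t. U ** F t ** dagger U) (U ** (\<chi> a b. p' (g a - g b) * Y $ a $ b) ** dagger U)"
    by (rule has_bochner_integral_bounded_linear[OF bounded_linear_sandwich])
  moreover have "U ** F t ** dagger U = p t *\<^sub>R
     (mat_exp (cscale (- \<i> * complex_of_real t) G) ** X ** mat_exp (cscale (\<i> * complex_of_real t) G))" for t
  proof -
    have e1: "mat_exp (cscale (- \<i> * complex_of_real t) G) ** X ** mat_exp (cscale (\<i> * complex_of_real t) G)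
       = U ** (cdiag (\<lambda>a. cis (- g a * t)) ** Y ** cdiag (\<lambda>a. cis (g a * t))) ** dagger U"
      unfolding G mat_exp_i[OF U] Y_def by (simp add: matrix_mul_assoc)
    have e2: "p t *\<^sub>R (cdiag (\<lambda>a. cis (- g a * t)) ** Y ** cdiag (\<lambda>a. cis (g a * t))) = F t"
    proof -
      have "cis (- g a * t) * y * cis (g b * t) = cis (- (g a - g b) * t) * y" for a b y
      proof -
        have "cis (- g a * t) * y * cis (g b * t) = (cis (- g a * t) * cis (g b * t)) * y"
          by (simp only: mult_ac)
        also have "cis (- g a * t) * cis (g b * t) = cis (- (g a - g b) * t)"
          unfolding cis_mult by (simp add: algebra_simps)
        finally show ?thesis .
      qed
      then show ?thesis
        by (simp add: F_def vec_eq_iff cdiag_mult_nth mult_cdiag_nth)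
    qed
    show ?thesis unfolding e1 e2[symmetric] by (simp only: scaleR_mult_left scaleR_mult_right)
  qed
  ultimately show ?thesis unfolding Y_def by simp
qed

lemma block_psd_form:
  "(\<Sum>k<m. \<Sum>l<m. \<Sum>a\<in>UNIV. cnj (v k $ a) * (X k l *v w l) $ a) = (\<Sum>k<m. \<Sum>l<m. cinner (v k) (X k l *v w l))"
  by (simp add: cinner_def)

lemma bounded_linear_cinner_matrix: "bounded_linear (\<lambda>X :: complex^'n^'n. cinner v (X *v w))"
  unfolding linear_conv_bounded_linear[symmetric]
proof (rule linearI)
  fix X Y :: "complex^'n^'n" and r :: real
  have "(X + Y) *v w = X *v w + Y *v w" "(r *\<^sub>R X) *v w = r *\<^sub>R (X *v w)"
    by (simp_all add: vec_eq_iff matrix_vector_mult_def distrib_right sum.distrib scaleR_sum_right)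
  then show "cinner v ((X + Y) *v w) = cinner v (X *v w) + cinner v (Y *v w)"
    "cinner v ((r *\<^sub>R X) *v w) = r *\<^sub>R cinner v (X *v w)"
    by (simp_all add: cinner_add_right cinner_scaleR_right scaleR_conv_of_real[where 'a = complex])
qed

text \<open>An average of unitary conjugations. Linearity and trace preservation are read off the
  eigenbasis form, where diagonal entries have gap 0 and factor \<open>p' 0 = 1\<close>; complete
  positivity comes from the integral, whose weight is nonnegative.\<close>

lemma is_channel_Phi:
  assumes G: "hermitian G" and p0: "\<And>t. 0 \<le> p t"
    and p: "\<And>x. has_bochner_integral lborel (\<lambda>t. p t *\<^sub>R cis (- x * t)) (p' x)" and p1: "p' 0 = 1"
  shows "is_channel (Phi p G)"
proof -
  obtain U g where U: "unitary U" and Geq: "G = U ** real_diag g ** dagger U"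
    using hermitian_spectral[OF G] .
  define E where "E t = mat_exp (cscale (- \<i> * complex_of_real t) G)" for t
  have dE: "mat_exp (cscale (\<i> * complex_of_real t) G) = dagger (E t)" for t
    using mat_exp_i_hermitian[OF G] by (simp add: E_def)
  have int: "has_bochner_integral lborel (\<lambda>t. p t *\<^sub>R (E t ** X ** dagger (E t)))
      (U ** (\<chi> a b. p' (g a - g b) * (dagger U ** X ** U) $ a $ b) ** dagger U)" for X
    using has_bochner_integral_Phi[OF U Geq p] unfolding dE E_def[symmetric] .
  have Phi: "Phi p G X = U ** (\<chi> a b. p' (g a - g b) * (dagger U ** X ** U) $ a $ b) ** dagger U" for X
    unfolding Phi_def dE E_def[symmetric] using int[of X] by (simp add: has_bochner_integral_iff)
  have int': "has_bochner_integral lborel (\<lambda>t. p t *\<^sub>R (E t ** X ** dagger (E t))) (Phi p G X)" for X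
    using int unfolding Phi .
  show ?thesis
    unfolding is_channel_def
  proof (intro conjI allI)
    fix X Y :: "complex^'a^'a" and c
    have "Phi p G (X + Y) = U ** ((\<chi> a b. p' (g a - g b) * (dagger U ** X ** U) $ a $ b)
         + (\<chi> a b. p' (g a - g b) * (dagger U ** Y ** U) $ a $ b)) ** dagger U"
      unfolding Phi
      by (intro arg_cong2[of _ _ _ _ "(**)"] refl)
         (simp add: vec_eq_iff matrix_add_ldistrib matrix_add_rdistrib distrib_left)
    then show "Phi p G (X + Y) = Phi p G X + Phi p G Y"
      unfolding Phi by (simp add: matrix_add_ldistrib matrix_add_rdistrib)
    have "(\<chi> a b. p' (g a - g b) * (dagger U ** cscale c X ** U) $ a $ b)
        = cscale c (\<chi> a b. p' (g a - g b) * (dagger U ** X ** U) $ a $ b)"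
      by (simp add: vec_eq_iff cscale_mult_left cscale_mult_right cscale_nth mult_ac)
    then show "Phi p G (cscale c X) = cscale c (Phi p G X)"
      unfolding Phi by (simp add: cscale_mult_left cscale_mult_right)
    have "trace (Phi p G X) = (\<Sum>a\<in>UNIV. (dagger U ** X ** U) $ a $ a)"
      unfolding Phi trace_unitary_conj[OF U] by (simp add: trace_def p1)
    also have "\<dots> = trace X"
      using trace_unitary_conj[OF unitary_dagger[OF U], of X] by (simp add: trace_def)
    finally show "trace (Phi p G X) = trace X" .
  next
    show "completely_positive (Phi p G)"
      unfolding completely_positive_def block_psd_def block_psd_form
    proof (intro allI impI)
      fix m :: nat and X :: "nat \<Rightarrow> nat \<Rightarrow> complex^'a^'a" and v :: "nat \<Rightarrow> complex^'a"
      assume pos: "\<forall>v. (\<Sum>k<m. \<Sum>l<m. cinner (v k) (X k l *v v l)) \<in> \<real>\<^sub>\<ge>\<^sub>0"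
      \<comment> \<open>The quadratic form of the conjugated blocks at \<open>v\<close> is the form
        of \<open>X\<close> at the rotated vectors, which the hypothesis covers.\<close>
      define q where "q t = (\<Sum>k<m. \<Sum>l<m. cinner (dagger (E t) *v v k) (X k l *v (dagger (E t) *v v l)))" for t
      have q: "q t \<in> \<real>\<^sub>\<ge>\<^sub>0" for t
        unfolding q_def using pos[rule_format, of "\<lambda>k. dagger (E t) *v v k"] .
      have "has_bochner_integral lborel (\<lambda>t. \<Sum>k<m. \<Sum>l<m. cinner (v k) ((p t *\<^sub>R (E t ** X k l ** dagger (E t))) *v v l))
         (\<Sum>k<m. \<Sum>l<m. cinner (v k) (Phi p G (X k l) *v v l))"
        by (intro has_bochner_integral_sum has_bochner_integral_bounded_linear[OF bounded_linear_cinner_matrix] int')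
      moreover have "(\<Sum>k<m. \<Sum>l<m. cinner (v k) ((p t *\<^sub>R (E t ** X k l ** dagger (E t))) *v v l)) = complex_of_real (p t * Re (q t))" for t
      proof -
        have e: "cinner (v k) ((p t *\<^sub>R (E t ** X k l ** dagger (E t))) *v v l)
            = of_real (p t) * cinner (dagger (E t) *v v k) (X k l *v (dagger (E t) *v v l))" for k l
          unfolding linear_cmul[OF bounded_linear.linear[OF bounded_linear_cinner_matrix]]
          by (simp add: scaleR_conv_of_real[where 'a = complex] matrix_vector_mul_assoc[symmetric] cinner_matrix)
        have "complex_of_real (Re (q t)) = q t" using q[of t] by (auto elim!: nonneg_Reals_cases)
        then show ?thesis unfolding e of_real_mult by (simp only: q_def sum_distrib_left)
      qed
      ultimately have *: "has_bochner_integral lborel (\<lambda>t. complex_of_real (p t * Re (q t)))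
         (\<Sum>k<m. \<Sum>l<m. cinner (v k) (Phi p G (X k l) *v v l))" by simp
      have "0 \<le> p t * Re (q t)" for t
        using p0[of t] q[of t] by (auto simp: complex_nonneg_Reals_iff)
      then have "0 \<le> (\<integral>t. p t * Re (q t) \<partial>lborel)" by (intro integral_nonneg_AE) auto
      moreover have "(\<Sum>k<m. \<Sum>l<m. cinner (v k) (Phi p G (X k l) *v v l)) = complex_of_real (\<integral>t. p t * Re (q t) \<partial>lborel)"
        using * by (simp add: has_bochner_integral_iff del: of_real_mult)
      ultimately show "(\<Sum>k<m. \<Sum>l<m. cinner (v k) (Phi p G (X k l) *v v l)) \<in> \<real>\<^sub>\<ge>\<^sub>0" by simp
    qed
  qed
qed

lemma Phi_eigenbasis:
  assumes U: "unitary U" and G: "G = U ** real_diag g ** dagger U"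
    and p: "\<And>x. has_bochner_integral lborel (\<lambda>t. p t *\<^sub>R cis (- x * t)) (p' x)"
  shows "Phi p G X = U ** (\<chi> a b. p' (g a - g b) * (dagger U ** X ** U) $ a $ b) ** dagger U"
  unfolding Phi_def using has_bochner_integral_Phi[OF assms] by (simp add: has_bochner_integral_iff)

section \<open>The channel Psi as a uniform average\<close>

definition unit_interval_hat :: "real \<Rightarrow> complex" where
  "unit_interval_hat x = (if x = 0 then 1 else (cis (- x) - 1) / (- \<i> * complex_of_real x))"

lemma has_bochner_integral_unit_interval_cis:
  "has_bochner_integral lborel (\<lambda>t. indicator {0..1} t *\<^sub>R cis (- x * t)) (unit_interval_hat x)"
proof (cases "x = 0")
  case True
  have "has_bochner_integral lborel (\<lambda>t :: real. complex_of_real (indicator {0..1} t)) (complex_of_real 1)"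
    using has_bochner_integral_real_indicator[of "{0..1::real}" lborel]
    by (intro has_bochner_integral_of_real) simp
  then show ?thesis using True by (simp add: unit_interval_hat_def scaleR_conv_of_real[where 'a = complex])
next
  case False
  have "has_bochner_integral lborel (\<lambda>t. indicator {0..1} t *\<^sub>R cis (- x * t))
     (exp (- \<i> * x * complex_of_real 1) / (- \<i> * x) - exp (- \<i> * x * complex_of_real 0) / (- \<i> * x))"
  proof (rule has_bochner_integral_FTC_Icc)
    fix t :: real
    have "((\<lambda>t. exp (- \<i> * x * complex_of_real t) / (- \<i> * x)) has_vector_derivative exp (- \<i> * x * complex_of_real t)) (at t within {0..1})"
      using False by (intro has_vector_derivative_real_field) (auto intro!: derivative_eq_intros)
    then show "((\<lambda>t. exp (- \<i> * x * complex_of_real t) / (- \<i> * x)) has_vector_derivative cis (- x * t)) (at t within {0..1})"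
      by (simp add: cis_conv_exp mult_ac)
  qed (auto intro!: continuous_intros)
  then show ?thesis
    using False by (simp add: unit_interval_hat_def diff_divide_distrib cis_conv_exp)
qed

lemma hermitian_minus: "hermitian A \<Longrightarrow> hermitian (- A)"
  by (simp add: hermitian_def dagger_def vec_eq_iff)

lemma hermitian_add: "hermitian A \<Longrightarrow> hermitian B \<Longrightarrow> hermitian (A + B)"
  by (simp add: hermitian_def dagger_add)

lemma hermitian_scaleR: "hermitian A \<Longrightarrow> hermitian (r *\<^sub>R A)"
  by (simp add: hermitian_def dagger_scaleR)

lemma hermitian_hamiltonian:
  assumes "\<And>k. hermitian (H k)"
  shows "hermitian (hamiltonian H \<phi>)"
proof -
  have "hermitian (\<Sum>k\<in>S. (\<phi> $ k) *\<^sub>R H k)" if "finite S" for S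
    using that
    by induction (auto intro!: hermitian_add hermitian_scaleR assms simp: hermitian_def[of 0] dagger_def vec_eq_iff)
  then show ?thesis unfolding hamiltonian_def by simp
qed

text \<open>The exponents in \<open>Psi\<close> have the opposite sign, hence the generator
  \<open>- hamiltonian H \<phi>\<close>. One eigenbasis computation then serves both
  channels.\<close>

lemma Psi_eq_Phi: "Psi H \<phi> = Phi (indicator {0..1}) (- hamiltonian H \<phi>)"
  unfolding Psi_def Phi_def set_lebesgue_integral_def cscale_minus by simp

lemma is_channel_Psi:
  assumes "\<And>k. hermitian (H k)"
  shows "is_channel (Psi H \<phi>)"
  unfolding Psi_eq_Phi
  by (rule is_channel_Phi[OF hermitian_minus[OF hermitian_hamiltonian[OF assms]]
        _ has_bochner_integral_unit_interval_cis]) (simp_all add: unit_interval_hat_def)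

section \<open>Binomial and exponential series of matrices\<close>

lemma pow_summable_gbinomial: "pow_summable 1 (\<lambda>k. s gchoose k)"
  unfolding pow_summable_def using gen_binomial_real sums_summable by blast

text \<open>The coefficient form of the rule that (1 + x)^s has derivative s (1 + x)^(s - 1);
  differentiation stays within the binomial family.\<close>

lemma diffs_gbinomial: "diffs (\<lambda>k. s gchoose k) = (\<lambda>k. s * ((s - 1) gchoose k))" for s :: real
  using gbinomial_absorption[of _ s] by (auto simp: diffs_def fun_eq_iff)

lemma pow_summable_cmult: "pow_summable K c \<Longrightarrow> pow_summable K (\<lambda>k. s * c k)"
  unfolding pow_summable_def by (simp add: mult.assoc summable_mult)

text \<open>The power \<open>(mat 1 + X)^s\<close> for \<open>opnorm X < 1\<close>.\<close>

definition binomial_matser :: "real \<Rightarrow> complex^'n^'n \<Rightarrow> complex^'n^'n" where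
  "binomial_matser s = matser (\<lambda>k. s gchoose k)"

lemma has_derivative_binomial_matser:
  "opnorm X < 1 \<Longrightarrow> (binomial_matser s has_derivative matser_deriv (\<lambda>k. s gchoose k) X) (at X)"
  unfolding binomial_matser_def by (rule has_derivative_matser[OF pow_summable_gbinomial])

lemma trace_binomial_matser_deriv:
  assumes X: "opnorm X < 1"
  shows "trace (matser_deriv (\<lambda>k. s gchoose k) X Y) = complex_of_real s * trace (binomial_matser (s - 1) X ** Y)"
proof -
  have "trace (matser_deriv (\<lambda>k. s gchoose k) X Y) = trace (matser (diffs (\<lambda>k. s gchoose k)) X ** Y)"
    by (rule trace_matser_deriv[OF pow_summable_gbinomial X])
       (simp add: diffs_gbinomial pow_summable_cmult pow_summable_gbinomial)
  also have "matser (diffs (\<lambda>k. s gchoose k)) X = s *\<^sub>R binomial_matser (s - 1) X"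
    unfolding matser_def binomial_matser_def diffs_gbinomial scaleR_scaleR[symmetric]
    by (rule suminf_scaleR_right[OF summable_matser[OF pow_summable_gbinomial X], symmetric])
  also have "trace (s *\<^sub>R binomial_matser (s - 1) X ** Y) = complex_of_real s * trace (binomial_matser (s - 1) X ** Y)"
    unfolding scaleR_mult_left linear_cmul[OF bounded_linear.linear[OF bounded_linear_trace]]
    by (rule scaleR_conv_of_real)
  finally show ?thesis .
qed

lemma gbinomial_sums_powr:
  assumes "\<bar>x - 1\<bar> < 1"
  shows "(\<lambda>k. complex_of_real (s gchoose k) * (complex_of_real (x - 1)) ^ k) sums complex_of_real (x powr s)"
  using sums_of_real[OF gen_binomial_real[OF assms, of s], where 'a = complex] by simp

lemma hermitian_near_1_eigenvalues:
  assumes M: "hermitian M" and near: "opnorm (M - mat 1) < 1"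
  obtains U d where "unitary U" "M = U ** real_diag d ** dagger U" "\<And>i. \<bar>d i - 1\<bar> < 1"
    "M - mat 1 = U ** cdiag (\<lambda>i. complex_of_real (d i - 1)) ** dagger U"
proof -
  obtain U d where U: "unitary U" and Meq: "M = U ** real_diag d ** dagger U"
    using hermitian_spectral[OF M] .
  have "cdiag (\<lambda>i. complex_of_real (d i - 1)) = real_diag d - mat 1"
    by (simp add: real_diag_eq_cdiag mat_eq_cdiag vec_eq_iff cdiag_nth)
  moreover have "U ** (real_diag d - mat 1) ** dagger U = U ** real_diag d ** dagger U - U ** mat 1 ** dagger U"
    by (rule linear_diff[OF bounded_linear.linear[OF bounded_linear_sandwich]])
  ultimately have eq: "M - mat 1 = U ** cdiag (\<lambda>i. complex_of_real (d i - 1)) ** dagger U"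
    using U Meq by (simp add: unitary_def)
  have "\<bar>d i - 1\<bar> < 1" for i
    using eigenvalue_le_opnorm[OF U eq, of i] near by (simp only: norm_of_real)
  with U Meq eq that show thesis by blast
qed

text \<open>Replaces the spectral definition, whose eigenvectors cannot be differentiated directly,
  by a differentiable series.\<close>

lemma mat_powr_eq_binomial_matser:
  assumes M: "hermitian M" and near: "opnorm (M - mat 1) < 1"
  shows "mat_powr M s = binomial_matser s (M - mat 1)"
proof -
  obtain U d where U: "unitary U" and Meq: "M = U ** real_diag d ** dagger U"
    and d: "\<And>i. \<bar>d i - 1\<bar> < 1" and eq: "M - mat 1 = U ** cdiag (\<lambda>i. complex_of_real (d i - 1)) ** dagger U"
    using hermitian_near_1_eigenvalues[OF assms] by metis
  have "binomial_matser s (M - mat 1) = U ** cdiag (\<lambda>i. complex_of_real (d i powr s)) ** dagger U"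
    unfolding eq binomial_matser_def matser_def
    by (rule sums_unique[OF sums_matpow_diag[OF U gbinomial_sums_powr[OF d]], symmetric])
  then show ?thesis unfolding Meq mat_powr_eq[OF U] by (simp add: real_diag_eq_cdiag)
qed

lemma trace_mat_powr_pos:
  fixes M :: "complex^'n^'n"
  assumes M: "hermitian M" and near: "opnorm (M - mat 1) < 1"
  shows "0 < Re (trace (mat_powr M s))"
proof -
  obtain U d where U: "unitary U" and Meq: "M = U ** real_diag d ** dagger U"
    and d: "\<And>i. \<bar>d i - 1\<bar> < 1"
    using hermitian_near_1_eigenvalues[OF assms] by metis
  have "Re (trace (mat_powr M s)) = (\<Sum>i\<in>UNIV. d i powr s)"
    unfolding Meq mat_powr_eq[OF U] trace_unitary_conj[OF U] by (simp add: real_diag_eq_cdiag trace_cdiag)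
  also have "\<dots> > 0"
  proof (rule sum_pos)
    fix i show "0 < d i powr s" using d[of i] by (auto simp: abs_if split: if_splits)
  qed auto
  finally show ?thesis .
qed

section \<open>The exponential series and Duhamel's formula\<close>

lemma pow_summable_exp: "pow_summable K (\<lambda>k. 1 / fact k)"
  unfolding pow_summable_def using summable_exp[where 'a = real] by (simp add: divide_inverse)

lemma mat_exp_eq_matser: "mat_exp = matser (\<lambda>k. 1 / fact k)"
  by (simp add: fun_eq_iff mat_exp_def matser_def)

lemma has_derivative_mat_exp: "(mat_exp has_derivative matser_deriv (\<lambda>k. 1 / fact k) X) (at X)"
  unfolding mat_exp_eq_matser
  by (rule has_derivative_matser[OF pow_summable_exp, of _ "opnorm X + 1"]) simp

lemma has_derivative_mat_exp_deriv:
  "((\<lambda>X. matser_deriv (\<lambda>k. 1 / fact k) X Y) has_derivative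
     (\<lambda>Z. \<Sum>k. (1 / fact k) *\<^sub>R matpow_deriv2 k X Y Z)) (at X)"
  by (rule has_derivative_matser_deriv[OF pow_summable_exp, of _ "opnorm X + 1"]) simp

lemma mat_exp_deriv_cdiag:
  "matser_deriv (\<lambda>k. 1 / fact k) (cdiag d) Y $ p $ q =
     (if d p = d q then exp (d p) else (exp (d p) - exp (d q)) / (d p - d q)) * Y $ p $ q"
proof (cases "d p = d q")
  case True
  have "(\<lambda>k. ((1 / fact k) *\<^sub>R matpow_deriv k (cdiag d) Y) $ p $ q)
      sums (matser_deriv (\<lambda>k. 1 / fact k) (cdiag d) Y $ p $ q)"
    unfolding matser_deriv_def
    by (intro bounded_linear.sums[OF bounded_linear_nth_nth] summable_sums
        summable_matser_deriv[OF pow_summable_exp, of _ "opnorm (cdiag d) + 1"]) simp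
  \<comment> \<open>The derivative of the zeroth power vanishes; after the shift, (k + 1) / (k + 1)!
    becomes 1 / k!.\<close>
  then have "(\<lambda>k. ((1 / fact (Suc k)) *\<^sub>R matpow_deriv (Suc k) (cdiag d) Y) $ p $ q)
      sums (matser_deriv (\<lambda>k. 1 / fact k) (cdiag d) Y $ p $ q)"
    by (subst sums_Suc_iff) simp
  moreover have "((1 / fact (Suc k)) *\<^sub>R matpow_deriv (Suc k) (cdiag d) Y) $ p $ q
      = (d p ^ k /\<^sub>R fact k) * Y $ p $ q" for k
  proof -
    have "complex_of_real (1 / fact (Suc k)) * of_nat (Suc k) = complex_of_real (1 / fact k)"
      by (simp add: field_simps del: of_nat_Suc)
    then show ?thesis
      unfolding vector_scaleR_component matpow_deriv_cdiag_eq[OF True]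
      by (simp add: scaleR_conv_of_real[where 'a = complex] divide_inverse mult.assoc[symmetric] del: of_nat_Suc fact_Suc)
  qed
  ultimately have "(\<lambda>k. (d p ^ k /\<^sub>R fact k) * Y $ p $ q) sums (matser_deriv (\<lambda>k. 1 / fact k) (cdiag d) Y $ p $ q)"
    by simp
  from sums_unique2[OF this sums_mult2[OF exp_converges]] True show ?thesis by simp
next
  case False
  have ex: "(\<lambda>k. complex_of_real (1 / fact k) * x ^ k) sums exp x" for x
    using exp_converges[of x] by (simp add: scaleR_conv_of_real divide_inverse)
  have "(d p - d q) * matser_deriv (\<lambda>k. 1 / fact k) (cdiag d) Y $ p $ q = (exp (d p) - exp (d q)) * Y $ p $ q"
    by (rule matser_deriv_cdiag[OF pow_summable_exp, of _ "opnorm (cdiag d) + 1"]) (simp_all add: ex[simplified])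
  with False show ?thesis by (simp add: field_simps)
qed

lemma matser_deriv_unitary_conj:
  assumes c: "pow_summable K c" and U: "unitary U"
    and A: "opnorm A < K" "opnorm (U ** A ** dagger U) < K"
  shows "dagger U ** matser_deriv c (U ** A ** dagger U) Y ** U = matser_deriv c A (dagger U ** Y ** U)"
proof -
  have "dagger U ** matser_deriv c (U ** A ** dagger U) Y ** U
      = (\<Sum>k. dagger U ** (c k *\<^sub>R matpow_deriv k (U ** A ** dagger U) Y) ** U)"
    unfolding matser_deriv_def
    by (rule bounded_linear.suminf[OF bounded_linear_sandwich summable_matser_deriv[OF c A(2)]])
  also have "\<dots> = matser_deriv c A (dagger U ** Y ** U)"
    unfolding scaleR_mult_left scaleR_mult_right matpow_deriv_unitary_conj[OF U] matser_deriv_def ..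
  finally show ?thesis .
qed

text \<open>Duhamel's formula, proved by comparing entries in an eigenbasis of the Hamiltonian.\<close>

lemma mat_exp_deriv_eq_Psi:
  assumes H: "\<And>k. hermitian (H k)"
  shows "matser_deriv (\<lambda>k. 1 / fact k) (cscale \<i> (hamiltonian H \<phi>)) (cscale \<i> Y)
           ** mat_exp (cscale (- \<i>) (hamiltonian H \<phi>)) = cscale \<i> (Psi H \<phi> Y)"
proof -
  obtain Q h where Q: "unitary Q" and X: "hamiltonian H \<phi> = Q ** real_diag h ** dagger Q"
    using hermitian_spectral[OF hermitian_hamiltonian[OF H]] .
  have minus_X: "- hamiltonian H \<phi> = Q ** real_diag (\<lambda>i. - h i) ** dagger Q"
  proof -
    have "real_diag (\<lambda>i. - h i) = - real_diag h" by (simp add: real_diag_def vec_eq_iff)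
    then show ?thesis unfolding X
      using linear_neg[OF bounded_linear.linear[OF bounded_linear_sandwich[of Q "dagger Q"]]] by simp
  qed
  define Y' where "Y' = dagger Q ** Y ** Q"
  define D where "D = cdiag (\<lambda>i. \<i> * complex_of_real (h i))"
  have iX: "cscale \<i> (hamiltonian H \<phi>) = Q ** D ** dagger Q"
    unfolding X D_def cscale_cdiag[symmetric] real_diag_eq_cdiag by (simp add: cscale_mult_left cscale_mult_right)
  have exp_mX: "mat_exp (cscale (- \<i>) (hamiltonian H \<phi>)) = Q ** cdiag (\<lambda>a. cis (- h a)) ** dagger Q"
    using mat_exp_i(2)[OF Q, of 1 h] unfolding X by simp
  \<comment> \<open>Any radius above both norms will do, since the exponential series is
    entire.\<close>
  define K where "K = max (opnorm D) (opnorm (Q ** D ** dagger Q)) + 1"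
  define E where "E = matser_deriv (\<lambda>k. 1 / fact k) (cscale \<i> (hamiltonian H \<phi>)) (cscale \<i> Y)"
  have E: "dagger Q ** E ** Q = matser_deriv (\<lambda>k. 1 / fact k) D (cscale \<i> Y')"
    unfolding E_def iX Y'_def
    by (subst matser_deriv_unitary_conj[OF pow_summable_exp[of K] Q])
       (simp_all add: K_def cscale_mult_left cscale_mult_right less_max_iff_disj add_strict_increasing2)
  \<comment> \<open>Multiplication by \<open>cis (- h q)\<close> turns the divided difference of exp
    at \<open>\<i> * h p\<close> and \<open>\<i> * h q\<close> into the integral of
    \<open>cis ((h p - h q) * t)\<close> over [0, 1], which is
    \<open>unit_interval_hat (h q - h p)\<close>.\<close>
  have "dagger Q ** E ** Q ** cdiag (\<lambda>a. cis (- h a)) = cscale \<i> (\<chi> a b. unit_interval_hat (- h a - - h b) * Y' $ a $ b)"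
    unfolding E
  proof (simp add: vec_eq_iff mult_cdiag_nth cscale_nth, intro allI)
    fix p q
    show "matser_deriv (\<lambda>k. 1 / fact k) D (cscale \<i> Y') $ p $ q * cis (- h q) = \<i> * (unit_interval_hat (h q - h p) * Y' $ p $ q)"
    proof (cases "h p = h q")
      case True
      have "exp (\<i> * complex_of_real (h q)) * cis (- h q) = 1"
        by (simp add: cis_conv_exp exp_add[symmetric])
      then show ?thesis
        unfolding D_def mat_exp_deriv_cdiag using True by (simp add: unit_interval_hat_def cscale_nth mult_ac)
    next
      case False
      have e: "(exp (\<i> * complex_of_real (h p)) - exp (\<i> * complex_of_real (h q))) * cis (- h q) = cis (- (h q - h p)) - 1"
        by (simp add: cis_conv_exp left_diff_distrib exp_add[symmetric] algebra_simps)
      have "matser_deriv (\<lambda>k. 1 / fact k) D (cscale \<i> Y') $ p $ q * cis (- h q)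
          = ((exp (\<i> * complex_of_real (h p)) - exp (\<i> * complex_of_real (h q))) * cis (- h q))
             / (\<i> * complex_of_real (h p) - \<i> * complex_of_real (h q)) * (\<i> * Y' $ p $ q)"
        unfolding D_def mat_exp_deriv_cdiag using False by (simp add: cscale_nth mult_ac)
      also have "\<dots> = \<i> * ((cis (- (h q - h p)) - 1) / (- \<i> * complex_of_real (h q - h p)) * Y' $ p $ q)"
        unfolding e by (simp add: algebra_simps)
      finally show ?thesis using False by (simp add: unit_interval_hat_def)
    qed
  qed
  then have "Q ** (dagger Q ** E ** Q ** cdiag (\<lambda>a. cis (- h a))) ** dagger Q
      = Q ** cscale \<i> (\<chi> a b. unit_interval_hat (- h a - - h b) * Y' $ a $ b) ** dagger Q" by simp
  also have "\<dots> = cscale \<i> (Psi H \<phi> Y)"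
    unfolding Psi_eq_Phi Phi_eigenbasis[OF Q minus_X has_bochner_integral_unit_interval_cis] Y'_def
    by (simp only: cscale_mult_left cscale_mult_right)
  also have "Q ** (dagger Q ** E ** Q ** cdiag (\<lambda>a. cis (- h a))) ** dagger Q = E ** mat_exp (cscale (- \<i>) (hamiltonian H \<phi>))"
    unfolding exp_mX by (simp add: matrix_mul_assoc[symmetric] unitary_cancel[OF Q])
  finally show ?thesis unfolding E_def .
qed

section \<open>Second derivative of the trace functional\<close>

lemma has_vector_derivative_chain:
  assumes "(f has_derivative D) (at (g t))" "(g has_vector_derivative v) (at t)"
  shows "((\<lambda>s. f (g s)) has_vector_derivative D v) (at t)"
  using vector_derivative_diff_chain_within[OF assms(2) has_derivative_at_withinI[OF assms(1)]]
  by (simp add: o_def)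

lemmas has_vector_derivative_matrix_mult =
  bounded_bilinear.has_vector_derivative[OF bounded_bilinear_matrix_mult]

lemmas has_vector_derivative_dagger =
  bounded_linear.has_vector_derivative[OF bounded_linear_dagger]

lemma has_vector_derivative_sandwich:
  fixes f :: "real \<Rightarrow> complex^'n^'n" and A B :: "complex^'n^'n"
  assumes "(f has_vector_derivative f') F"
  shows "((\<lambda>x. A ** f x ** B) has_vector_derivative A ** f' ** B) F"
  by (rule bounded_linear.has_vector_derivative[OF bounded_linear_sandwich assms])

text \<open>One pair (p, q) of the second derivative, with \<open>x\<close> an entry of the
  derivative of \<open>M ^ (z - 1)\<close> and \<open>k\<close>, \<open>l\<close> entries of
  \<open>K\<close>, \<open>L\<close>. The first summand pairs \<open>x\<close> with
  \<open>Mj\<close>; the second is \<open>M ^ (z - 1)\<close> against the second derivative of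
  \<open>M\<close>. Over the common denominator \<open>m\<close> they combine by a polynomial
  identity; if the denominator is zero, both sides vanish.\<close>

lemma second_derivative_coefficient:
  fixes a b h :: "'n \<Rightarrow> real"
  assumes deg: "a p * b p = a q * b q \<Longrightarrow> a p = a q \<and> b p = b q"
    and x: "(of_real (a p * b p) - of_real (a q * b q)) * x
        = (of_real (h p) - of_real (h q)) * (\<i> * of_real (c p * c q * (a q - a p)) * k)"
    and c: "c p * c p = b p" "c q * c q = b q"
    and h: "h p = h q \<or> a p * b p \<noteq> a q * b q"
  shows "x * (\<i> * of_real (c q * c p * (a p - a q)) * l)
      + complex_of_real (h p * b p * a q - h p * (a p * b p) + h q * b q * a p - h q * (a q * b q)) * (k * l)
    = complex_of_real (- ((a p - a q) * (b p - b q) * (h p * (a p * b p) - h q * (a q * b q)) / (a p * b p - a q * b q))) * (k * l)"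
proof (cases "a p * b p = a q * b q")
  case True
  with deg h have "a p = a q" "b p = b q" "h p = h q" by auto
  then show ?thesis by simp
next
  case False
  define m where "m = a p * b p - a q * b q"
  have m: "m \<noteq> 0" using False by (simp add: m_def)
  have cc: "(c p * c q) * (c q * c p) = b p * b q" using c by (metis mult.assoc mult.commute)
  have "complex_of_real m * x = complex_of_real ((h p - h q) * (c p * c q * (a q - a p))) * (\<i> * k)"
    using x by (simp add: m_def mult_ac)
  then have "x = complex_of_real ((h p - h q) * (c p * c q * (a q - a p)) / m) * (\<i> * k)"
    using m by (simp add: field_simps)
  then have "x * (\<i> * of_real (c q * c p * (a p - a q)) * l)
     = complex_of_real (- ((h p - h q) * (c p * c q * (a q - a p)) / m * (c q * c p * (a p - a q)))) * (k * l)"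
    by (simp add: mult_ac)
  also have "- ((h p - h q) * (c p * c q * (a q - a p)) / m * (c q * c p * (a p - a q)))
      = (h p - h q) * ((c p * c q) * (c q * c p)) * (a p - a q)\<^sup>2 / m"
  proof -
    have "- (x * (u * - d) / m * (v * d)) = x * (u * v) * d\<^sup>2 / m" for x u v d :: real
      by (simp add: power2_eq_square)
    from this[of "h p - h q" "c p * c q" "a p - a q" "c q * c p"] show ?thesis by (simp only: minus_diff_eq)
  qed
  also have "\<dots> = (h p - h q) * (b p * b q) * (a p - a q)\<^sup>2 / m" unfolding cc ..
  finally have 1: "x * (\<i> * of_real (c q * c p * (a p - a q)) * l)
      = complex_of_real ((h p - h q) * (b p * b q) * (a p - a q)\<^sup>2 / m) * (k * l)" .
  have "(h p - h q) * (b p * b q) * (a p - a q)\<^sup>2 / m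
      + (h p * b p * a q - h p * (a p * b p) + h q * b q * a p - h q * (a q * b q))
     = ((h p - h q) * (b p * b q) * (a p - a q)\<^sup>2
      + (h p * b p * a q - h p * (a p * b p) + h q * b q * a p - h q * (a q * b q)) * m) / m"
    using m by (simp add: add_divide_distrib)
  also have "(h p - h q) * (b p * b q) * (a p - a q)\<^sup>2
      + (h p * b p * a q - h p * (a p * b p) + h q * b q * a p - h q * (a q * b q)) * m
     = - ((a p - a q) * (b p - b q) * (h p * (a p * b p) - h q * (a q * b q)))"
    unfolding m_def by (simp add: power2_eq_square algebra_simps)
  also have "\<dots> / m = - ((a p - a q) * (b p - b q) * (h p * (a p * b p) - h q * (a q * b q)) / m)"
    by simp
  finally show ?thesis unfolding 1 m_def[symmetric] distrib_right[symmetric] of_real_add[symmetric] by simp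
qed

text \<open>
  Up to a unitary conjugation this is the operator whose \<open>z\<close>-th power is traced in \<open>renyi_az\<close>, for the states
  \<open>W ** \<rho> ** dagger W\<close> and \<open>\<rho>\<close> with \<open>\<rho>\<close> diagonal: \<open>a\<close> and \<open>c\<close> are the eigenvalues of the powers of \<open>\<rho>\<close> with
  exponents \<open>\<alpha> / z\<close> and \<open>(1 - \<alpha>) / (2 * z)\<close>.
\<close>

definition sandwiched :: "('n \<Rightarrow> real) \<Rightarrow> ('n \<Rightarrow> real) \<Rightarrow> complex^'n^'n \<Rightarrow> complex^'n^'n" where
  "sandwiched c a W = real_diag c ** (W ** real_diag a ** dagger W) ** real_diag c"

lemma dagger_real_diag: "dagger (real_diag a) = real_diag a"
  by (simp add: real_diag_eq_cdiag dagger_cdiag)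

lemma hermitian_sandwiched: "hermitian (sandwiched c a W)"
  by (simp add: hermitian_def sandwiched_def dagger_mult dagger_real_diag matrix_mul_assoc)

lemma has_vector_derivative_sandwiched:
  assumes "(W has_vector_derivative W') (at t)"
  shows "((\<lambda>s. sandwiched c a (W s)) has_vector_derivative
     real_diag c ** (W t ** real_diag a ** dagger W' + W' ** real_diag a ** dagger (W t)) ** real_diag c) (at t)"
proof -
  have "((\<lambda>s. W s ** real_diag a) has_vector_derivative W' ** real_diag a) (at t)"
    by (rule bounded_linear.has_vector_derivative[OF bounded_linear_mult_const assms])
  from has_vector_derivative_sandwich[OF
      has_vector_derivative_matrix_mult[OF this has_vector_derivative_dagger[OF assms]]]
  show ?thesis unfolding sandwiched_def .
qed

text \<open>
  Only existence of the second derivative \<open>Wij\<close> is needed: unitarity of \<open>W\<close> determines the real part of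
  its diagonal, which is all that enters the trace.
\<close>

locale unitary_family =
  fixes W Wj :: "real^'l \<Rightarrow> complex^'n^'n" and Wi Wij K L :: "complex^'n^'n"
    and a b c r m :: "'n \<Rightarrow> real" and z :: real and i j :: 'l
  assumes uW: "\<And>y. unitary (W y)" and W0: "W 0 = mat 1"
    and contW: "continuous_on UNIV W"
    and dWj: "\<And>y. ((\<lambda>s. W (y + s *\<^sub>R axis j 1)) has_vector_derivative Wj y) (at 0)"
    and dWi: "((\<lambda>s. W (s *\<^sub>R axis i 1)) has_vector_derivative Wi) (at 0)"
    and dWij: "((\<lambda>s. Wj (s *\<^sub>R axis i 1)) has_vector_derivative Wij) (at 0)"
    and Wi: "Wi = cscale \<i> K" and Wj0: "Wj 0 = cscale \<i> L"
    and c: "\<And>p. c p * c p = b p" and m: "\<And>p. m p = a p * b p" and m01: "\<And>p. 0 < m p \<and> m p \<le> 1"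
    and r: "\<And>p. r p = m p powr z" and sum_r: "(\<Sum>p\<in>UNIV. r p) = 1"
    and deg: "\<And>p q. m p = m q \<Longrightarrow> a p = a q \<and> b p = b q"
begin

abbreviation M where "M y \<equiv> sandwiched c a (W y)"

definition Mj where
  "Mj y = real_diag c ** (W y ** real_diag a ** dagger (Wj y) + Wj y ** real_diag a ** dagger (W y)) ** real_diag c"

definition Tr where "Tr y = trace (mat_powr (M y) z)"

definition Trj where
  "Trj y = complex_of_real z * trace (binomial_matser (z - 1) (M y - mat 1) ** Mj y)"

text \<open>Here the binomial series represents the powers of \<open>M y\<close>.\<close>

definition near where "near = {y. opnorm (M y - mat 1) < 1}"

lemma Tr_eq: "y \<in> near \<Longrightarrow> Tr y = trace (binomial_matser z (M y - mat 1))"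
  unfolding near_def Tr_def by (simp add: mat_powr_eq_binomial_matser hermitian_sandwiched)

lemma M0: "M 0 - mat 1 = cdiag (\<lambda>p. complex_of_real (m p - 1))"
proof -
  have "complex_of_real (c p) * complex_of_real (a p) * complex_of_real (c p) = complex_of_real (m p)" for p
    using c[of p] by (simp add: m mult_ac flip: of_real_mult)
  then have "M 0 = cdiag (\<lambda>p. complex_of_real (m p))"
    unfolding sandwiched_def W0 real_diag_eq_cdiag by (simp add: cdiag_mult)
  then show ?thesis by (simp add: mat_eq_cdiag vec_eq_iff cdiag_nth)
qed

lemma m_near_1: "\<bar>m p - 1\<bar> < 1" using m01[of p] by auto

lemma zero_in_near: "0 \<in> near"
proof -
  \<comment> \<open>A maximum of finitely many numbers below 1 is still below 1, which gives the
    strict inequality.\<close>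
  define b where "b = Max (range (\<lambda>p. \<bar>m p - 1\<bar>))"
  have le: "\<bar>m p - 1\<bar> \<le> b" for p unfolding b_def by (rule Max_ge) auto
  have "opnorm (M 0 - mat 1) \<le> b"
    unfolding M0 by (rule opnorm_cdiag) (simp only: norm_of_real le)
  also have "b < 1"
  proof -
    have "b \<in> range (\<lambda>p. \<bar>m p - 1\<bar>)" unfolding b_def by (rule Max_in) auto
    then obtain p where "b = \<bar>m p - 1\<bar>" by blast
    then show ?thesis using m_near_1[of p] by simp
  qed
  finally show ?thesis by (simp add: near_def)
qed

lemma open_near: "open near"
proof -
  have "continuous_on UNIV (\<lambda>y. M y - mat 1)"
    unfolding sandwiched_def
    by (intro continuous_intros bounded_bilinear.continuous_on[OF bounded_bilinear_matrix_mult] contW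
        bounded_linear.continuous_on[OF bounded_linear_dagger])
  then have "continuous_on UNIV (\<lambda>y. opnorm (M y - mat 1))"
    by (rule continuous_on_compose2[OF continuous_opnorm _ subset_UNIV])
  then show ?thesis unfolding near_def by (intro open_Collect_less continuous_on_const)
qed

lemma eventually_line_in_near:
  assumes "y \<in> near"
  shows "\<forall>\<^sub>F s in nhds 0. y + s *\<^sub>R v \<in> near"
proof -
  have "((\<lambda>s. y + s *\<^sub>R v) \<longlongrightarrow> y + 0 *\<^sub>R v) (nhds 0)"
    by (intro tendsto_intros filterlim_ident)
  then show ?thesis using open_near assms by (intro topological_tendstoD) auto
qed

lemma Tr_pos: "y \<in> near \<Longrightarrow> 0 < Re (Tr y)"
  unfolding Tr_def near_def by (auto intro!: trace_mat_powr_pos hermitian_sandwiched)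

lemma has_vector_derivative_Tr:
  assumes y: "y \<in> near" and d: "((\<lambda>s. M (y + s *\<^sub>R v)) has_vector_derivative M') (at 0)"
  shows "((\<lambda>s. Tr (y + s *\<^sub>R v)) has_vector_derivative
     complex_of_real z * trace (binomial_matser (z - 1) (M y - mat 1) ** M')) (at 0)"
proof -
  have y': "opnorm (M y - mat 1) < 1" using y by (simp add: near_def)
  have "((\<lambda>s. M (y + s *\<^sub>R v) - mat 1) has_vector_derivative M' - 0) (at 0)"
    by (intro has_vector_derivative_diff d has_vector_derivative_const)
  then have d': "((\<lambda>s. M (y + s *\<^sub>R v) - mat 1) has_vector_derivative M') (at 0)" by simp
  have "(binomial_matser z has_derivative matser_deriv (\<lambda>k. z gchoose k) (M y - mat 1)) (at (M (y + 0 *\<^sub>R v) - mat 1))"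
    using has_derivative_binomial_matser[OF y'] by simp
  from bounded_linear.has_vector_derivative[OF bounded_linear_trace has_vector_derivative_chain[OF this d']]
  have "((\<lambda>s. trace (binomial_matser z (M (y + s *\<^sub>R v) - mat 1))) has_vector_derivative
     trace (matser_deriv (\<lambda>k. z gchoose k) (M y - mat 1) M')) (at 0)" .
  moreover have "\<forall>\<^sub>F s in nhds 0. trace (binomial_matser z (M (y + s *\<^sub>R v) - mat 1)) = Tr (y + s *\<^sub>R v)"
    using eventually_line_in_near[OF y, of v] by eventually_elim (simp add: Tr_eq)
  moreover have "trace (binomial_matser z (M (y + 0 *\<^sub>R v) - mat 1)) = Tr (y + 0 *\<^sub>R v)"
    using y by (simp add: Tr_eq)
  ultimately show ?thesis
    unfolding trace_binomial_matser_deriv[OF y']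
    by (subst has_vector_derivative_cong_ev[symmetric]) auto
qed

lemma has_vector_derivative_Tr_j:
  "y \<in> near \<Longrightarrow> ((\<lambda>s. Tr (y + s *\<^sub>R axis j 1)) has_vector_derivative Trj y) (at 0)"
  unfolding Trj_def Mj_def
  using has_vector_derivative_Tr[OF _ has_vector_derivative_sandwiched[OF dWj]] by simp

text \<open>Differentiating \<open>W ** dagger W = mat 1\<close> at 0 shows that the first
  derivatives of \<open>W\<close> are skew-Hermitian.\<close>

lemma K_L_hermitian: "cnj (K $ q $ p) = K $ p $ q" "cnj (L $ q $ p) = L $ p $ q"
proof -
  have skew: "cnj (X $ q $ p) = X $ p $ q"
    if d: "((\<lambda>s. W (s *\<^sub>R v)) has_vector_derivative cscale \<i> X) (at 0)" for v X
  proof -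
    have "((\<lambda>s. W (s *\<^sub>R v) ** dagger (W (s *\<^sub>R v))) has_vector_derivative
        W (0 *\<^sub>R v) ** dagger (cscale \<i> X) + cscale \<i> X ** dagger (W (0 *\<^sub>R v))) (at 0)"
      by (intro has_vector_derivative_matrix_mult has_vector_derivative_dagger d)
    then have "((\<lambda>s. mat 1) has_vector_derivative dagger (cscale \<i> X) + cscale \<i> X) (at (0 :: real))"
      using uW by (simp add: W0 unitary_def)
    then have "dagger (cscale \<i> X) + cscale \<i> X = 0"
      using vector_derivative_unique_at has_vector_derivative_const by blast
    then have "(dagger (cscale \<i> X) + cscale \<i> X) $ p $ q = 0" by simp
    then have "\<i> * (X $ p $ q - cnj (X $ q $ p)) = 0"
      by (simp add: dagger_nth cscale_nth right_diff_distrib)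
    then show ?thesis by simp
  qed
  show "cnj (K $ q $ p) = K $ p $ q" using skew dWi Wi by blast
  show "cnj (L $ q $ p) = L $ p $ q" using skew dWj[of 0] Wj0 by simp
qed

lemma dagger_Wi: "dagger Wi = cscale (- \<i>) K" and dagger_Wj0: "dagger (Wj 0) = cscale (- \<i>) L"
  unfolding Wi Wj0 dagger_cscale by (simp_all add: vec_eq_iff dagger_nth cscale_nth K_L_hermitian)

text \<open>The unitarity relation is differentiated in direction \<open>j\<close> at every point
  and the result in direction \<open>i\<close> at 0; the identity is its diagonal.\<close>

lemma Wij_diag:
  "Wij $ p $ p + cnj (Wij $ p $ p) = - (\<Sum>q\<in>UNIV. L $ p $ q * K $ q $ p + K $ p $ q * L $ q $ p)"
proof -
  have "Wj y ** dagger (W y) + W y ** dagger (Wj y) = 0" for y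
  proof -
    have "((\<lambda>s. W (y + s *\<^sub>R axis j 1) ** dagger (W (y + s *\<^sub>R axis j 1))) has_vector_derivative
        W (y + 0 *\<^sub>R axis j 1) ** dagger (Wj y) + Wj y ** dagger (W (y + 0 *\<^sub>R axis j 1))) (at 0)"
      by (intro has_vector_derivative_matrix_mult has_vector_derivative_dagger dWj)
    then have "((\<lambda>s. mat 1) has_vector_derivative W y ** dagger (Wj y) + Wj y ** dagger (W y)) (at (0 :: real))"
      using uW by (simp add: unitary_def)
    then have "W y ** dagger (Wj y) + Wj y ** dagger (W y) = 0"
      using vector_derivative_unique_at has_vector_derivative_const by blast
    then show ?thesis by (simp add: add.commute)
  qed
  then have zero: "((\<lambda>s. Wj (s *\<^sub>R axis i 1) ** dagger (W (s *\<^sub>R axis i 1)) + W (s *\<^sub>R axis i 1) ** dagger (Wj (s *\<^sub>R axis i 1)))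
      has_vector_derivative 0) (at 0)" by simp
  have "((\<lambda>s. Wj (s *\<^sub>R axis i 1) ** dagger (W (s *\<^sub>R axis i 1)) + W (s *\<^sub>R axis i 1) ** dagger (Wj (s *\<^sub>R axis i 1)))
      has_vector_derivative (Wj (0 *\<^sub>R axis i 1) ** dagger Wi + Wij ** dagger (W (0 *\<^sub>R axis i 1)))
        + (W (0 *\<^sub>R axis i 1) ** dagger Wij + Wi ** dagger (Wj (0 *\<^sub>R axis i 1)))) (at 0)"
    by (intro has_vector_derivative_add has_vector_derivative_matrix_mult has_vector_derivative_dagger dWi dWij)
  from vector_derivative_unique_at[OF this zero]
  have "(Wj 0 ** dagger Wi + Wij + (dagger Wij + Wi ** dagger (Wj 0))) $ p $ p = 0" by (simp add: W0)
  then have "(L ** K) $ p $ p + Wij $ p $ p + (cnj (Wij $ p $ p) + (K ** L) $ p $ p) = 0"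
    unfolding dagger_Wi dagger_Wj0 unfolding Wi Wj0
    by (simp add: cscale_mult_left cscale_mult_right cscale_cscale cscale_nth dagger_nth)
  then have "Wij $ p $ p + cnj (Wij $ p $ p) = - ((L ** K) $ p $ p + (K ** L) $ p $ p)"
    unfolding eq_neg_iff_add_eq_0 by (simp add: ac_simps)
  then show ?thesis by (simp add: matrix_matrix_mult_def sum.distrib)
qed

section \<open>Values and derivatives at the base point\<close>

text \<open>The eigenvalues of \<open>M ^ (z - 1)\<close> at the base point.\<close>

definition h where "h p = m p powr (z - 1)"

lemma h_mult_m: "h p * (a p * b p) = r p"
proof -
  have "m p powr (z - 1) * m p powr 1 = m p powr z" unfolding powr_add[symmetric] by simp
  then show ?thesis unfolding h_def r m[symmetric] using m01[of p] by simp
qed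

lemma binomial_matser_M0: "binomial_matser s (M 0 - mat 1) = cdiag (\<lambda>p. complex_of_real (m p powr s))"
proof -
  have U: "unitary (mat 1 :: complex^'n^'n)" by (simp add: unitary_def)
  show ?thesis
    unfolding M0 binomial_matser_def matser_def
    using sums_unique[OF sums_matpow_diag[OF U gbinomial_sums_powr[OF m_near_1]], symmetric] by simp
qed

definition Mi where
  "Mi = real_diag c ** (W 0 ** real_diag a ** dagger Wi + Wi ** real_diag a ** dagger (W 0)) ** real_diag c"

lemma Mi_nth: "Mi $ p $ q = \<i> * of_real (c p * c q * (a q - a p)) * K $ p $ q"
  unfolding Mi_def W0 dagger_Wi unfolding Wi
  by (simp add: real_diag_eq_cdiag cdiag_mult_nth mult_cdiag_nth cscale_nth algebra_simps)

lemma Mj0_nth: "Mj 0 $ p $ q = \<i> * of_real (c p * c q * (a q - a p)) * L $ p $ q"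
  unfolding Mj_def W0 dagger_Wj0 unfolding Wj0
  by (simp add: real_diag_eq_cdiag cdiag_mult_nth mult_cdiag_nth cscale_nth algebra_simps)

lemma Tr_0: "Tr 0 = 1"
  unfolding Tr_eq[OF zero_in_near] binomial_matser_M0 trace_cdiag r[symmetric]
  using sum_r by (simp flip: of_real_sum)

text \<open>The factor \<open>a q - a p\<close> clears the diagonal of \<open>Mj 0\<close>, and it
  is paired with a diagonal matrix.\<close>

lemma Trj_0: "Trj 0 = 0"
  unfolding Trj_def binomial_matser_M0 by (simp add: trace_def cdiag_mult_nth Mj0_nth)

lemma has_vector_derivative_Tr_i: "((\<lambda>s. Tr (s *\<^sub>R axis i 1)) has_vector_derivative 0) (at 0)"
proof -
  have "((\<lambda>s. M (0 + s *\<^sub>R axis i 1)) has_vector_derivative Mi) (at 0)"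
    using has_vector_derivative_sandwiched[OF dWi] by (simp add: Mi_def)
  from has_vector_derivative_Tr[OF zero_in_near this]
  show ?thesis unfolding binomial_matser_M0 by (simp add: trace_def cdiag_mult_nth Mi_nth)
qed

lemma mult_cdiag_mult_nth:
  fixes X Y :: "complex^'n^'n"
  shows "(X ** cdiag d ** Y) $ p $ q = (\<Sum>k\<in>UNIV. X $ p $ k * d k * Y $ k $ q)"
  by (simp add: matrix_matrix_mult_def[of "X ** cdiag d" Y] mult_cdiag_nth)

definition weight where
  "weight p q = (a p - a q) * (b p - b q) * (r p - r q) / (m p - m q)"

definition Trij where
  "Trij = - complex_of_real z * (\<Sum>p\<in>UNIV. \<Sum>q\<in>UNIV. of_real (weight p q) * (K $ p $ q * L $ q $ p))"

text \<open>Product rule: \<open>D\<close> comes from \<open>M ^ (z - 1)\<close> and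
  \<open>N\<close> from \<open>Mj\<close>. The first contribution is evaluated by divided
  differences; the second involves only the diagonal of \<open>N\<close>.\<close>

lemma has_vector_derivative_Trj: "((\<lambda>s. Trj (s *\<^sub>R axis i 1)) has_vector_derivative Trij) (at 0)"
proof -
  define D where "D = matser_deriv (\<lambda>k. (z - 1) gchoose k) (M 0 - mat 1) Mi"
  define N where "N = (W 0 ** real_diag a ** dagger Wij + Wi ** real_diag a ** dagger (Wj 0))
      + (Wj 0 ** real_diag a ** dagger Wi + Wij ** real_diag a ** dagger (W 0))"
  have near0: "opnorm (M 0 - mat 1) < 1" using zero_in_near by (simp add: near_def)
  have dA: "((\<lambda>s. f s ** real_diag a) has_vector_derivative f' ** real_diag a) F"
    if "(f has_vector_derivative f') F" for f :: "real \<Rightarrow> complex^'n^'n" and f' F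
    by (rule bounded_linear.has_vector_derivative[OF bounded_linear_mult_const that])
  have dMj: "((\<lambda>s. Mj (s *\<^sub>R axis i 1)) has_vector_derivative real_diag c ** N ** real_diag c) (at 0)"
  proof -
    have "((\<lambda>s. W (s *\<^sub>R axis i 1) ** real_diag a ** dagger (Wj (s *\<^sub>R axis i 1))
          + Wj (s *\<^sub>R axis i 1) ** real_diag a ** dagger (W (s *\<^sub>R axis i 1)))
       has_vector_derivative (W (0 *\<^sub>R axis i 1) ** real_diag a ** dagger Wij + Wi ** real_diag a ** dagger (Wj (0 *\<^sub>R axis i 1)))
         + (Wj (0 *\<^sub>R axis i 1) ** real_diag a ** dagger Wi + Wij ** real_diag a ** dagger (W (0 *\<^sub>R axis i 1)))) (at 0)"
      by (intro has_vector_derivative_add has_vector_derivative_matrix_mult has_vector_derivative_dagger dA dWi dWij)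
    then show ?thesis unfolding Mj_def N_def by (intro has_vector_derivative_sandwich) simp
  qed
  have dM: "((\<lambda>s. M (s *\<^sub>R axis i 1) - mat 1) has_vector_derivative Mi) (at 0)"
    using has_vector_derivative_diff[OF has_vector_derivative_sandwiched[OF dWi] has_vector_derivative_const]
    by (simp add: Mi_def)
  have "((\<lambda>s. binomial_matser (z - 1) (M (s *\<^sub>R axis i 1) - mat 1)) has_vector_derivative D) (at 0)"
    unfolding D_def
    by (rule has_vector_derivative_chain[OF _ dM]) (simp add: has_derivative_binomial_matser[OF near0])
  from has_vector_derivative_mult_right[OF bounded_linear.has_vector_derivative[OF bounded_linear_trace
        has_vector_derivative_matrix_mult[OF this dMj]], of "complex_of_real z"]
  have "((\<lambda>s. Trj (s *\<^sub>R axis i 1)) has_vector_derivative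
      complex_of_real z * trace (binomial_matser (z - 1) (M 0 - mat 1) ** (real_diag c ** N ** real_diag c) + D ** Mj 0)) (at 0)"
    unfolding Trj_def by simp
  also have "trace (binomial_matser (z - 1) (M 0 - mat 1) ** (real_diag c ** N ** real_diag c) + D ** Mj 0)
      = trace (D ** Mj 0) + trace (cdiag (\<lambda>p. complex_of_real (h p)) ** (real_diag c ** N ** real_diag c))"
    unfolding binomial_matser_M0 h_def by (simp add: trace_add add.commute)
  also have "trace (D ** Mj 0) = (\<Sum>p\<in>UNIV. \<Sum>q\<in>UNIV. D $ p $ q * (\<i> * of_real (c q * c p * (a p - a q)) * L $ q $ p))"
    unfolding Mj0_nth[symmetric] by (simp add: trace_def matrix_matrix_mult_def)
  also have "trace (cdiag (\<lambda>p. complex_of_real (h p)) ** (real_diag c ** N ** real_diag c))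
      = (\<Sum>p\<in>UNIV. \<Sum>q\<in>UNIV. complex_of_real (h p * b p * a q - h p * (a p * b p) + h q * b q * a p - h q * (a q * b q)) * (K $ p $ q * L $ q $ p))"
  proof -
    \<comment> \<open>The unknown \<open>Wij\<close> enters through twice the real part of its
      diagonal, which \<open>Wij_diag\<close> eliminates.\<close>
    have N: "N $ p $ p = (\<Sum>q\<in>UNIV. of_real (a q - a p) * (K $ p $ q * L $ q $ p + L $ p $ q * K $ q $ p))" for p
    proof -
      have "(cscale \<i> X ** real_diag a ** cscale (- \<i>) Y) $ p $ p = (\<Sum>q\<in>UNIV. of_real (a q) * (X $ p $ q * Y $ q $ p))"
        for X Y :: "complex^'n^'n"
        unfolding cscale_mult_left cscale_mult_right cscale_cscale real_diag_eq_cdiag mult_cdiag_mult_nth cscale_nth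
        by (simp add: mult_ac)
      moreover have "(mat 1 ** real_diag a ** dagger Wij) $ p $ p = of_real (a p) * cnj (Wij $ p $ p)"
        "(Wij ** real_diag a ** dagger (mat 1)) $ p $ p = of_real (a p) * Wij $ p $ p"
        by (simp_all add: real_diag_eq_cdiag cdiag_mult_nth mult_cdiag_nth dagger_nth)
      ultimately have "N $ p $ p = of_real (a p) * (Wij $ p $ p + cnj (Wij $ p $ p))
          + (\<Sum>q\<in>UNIV. of_real (a q) * (K $ p $ q * L $ q $ p + L $ p $ q * K $ q $ p))"
        unfolding N_def W0 dagger_Wi dagger_Wj0 unfolding Wi Wj0 vector_add_component
        by (simp only: sum.distrib distrib_left) (simp only: ac_simps)
      also have "\<dots> = (\<Sum>q\<in>UNIV. of_real (a q) * (K $ p $ q * L $ q $ p + L $ p $ q * K $ q $ p))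
          - of_real (a p) * (\<Sum>q\<in>UNIV. K $ p $ q * L $ q $ p + L $ p $ q * K $ q $ p)"
        unfolding Wij_diag by (simp add: add.commute)
      also have "\<dots> = (\<Sum>q\<in>UNIV. of_real (a q - a p) * (K $ p $ q * L $ q $ p + L $ p $ q * K $ q $ p))"
        unfolding sum_distrib_left sum_subtractf[symmetric] by (simp add: left_diff_distrib)
      finally show ?thesis .
    qed
    have "trace (cdiag (\<lambda>p. complex_of_real (h p)) ** (real_diag c ** N ** real_diag c))
        = (\<Sum>p\<in>UNIV. of_real (h p) * (of_real (c p) * N $ p $ p * of_real (c p)))"
      by (simp add: trace_def real_diag_eq_cdiag cdiag_mult_nth mult_cdiag_nth)
    also have "\<dots> = (\<Sum>p\<in>UNIV. of_real (h p * b p) * N $ p $ p)"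
      by (intro sum.cong refl) (simp add: c[symmetric])
    also have "\<dots> = (\<Sum>p\<in>UNIV. \<Sum>q\<in>UNIV. of_real (h p * b p * (a q - a p)) * (K $ p $ q * L $ q $ p))
        + (\<Sum>p\<in>UNIV. \<Sum>q\<in>UNIV. of_real (h p * b p * (a q - a p)) * (L $ p $ q * K $ q $ p))"
      unfolding N sum_distrib_left sum.distrib[symmetric]
    proof (intro sum.cong refl)
      fix p q
      have "complex_of_real (h p * b p) * (of_real (a q - a p) * (K $ p $ q * L $ q $ p + L $ p $ q * K $ q $ p))
          = complex_of_real (h p * b p) * of_real (a q - a p) * (K $ p $ q * L $ q $ p)
          + complex_of_real (h p * b p) * of_real (a q - a p) * (L $ p $ q * K $ q $ p)"
        by (simp only: distrib_left mult.assoc)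
      then show "complex_of_real (h p * b p) * (of_real (a q - a p) * (K $ p $ q * L $ q $ p + L $ p $ q * K $ q $ p))
          = complex_of_real (h p * b p * (a q - a p)) * (K $ p $ q * L $ q $ p)
          + complex_of_real (h p * b p * (a q - a p)) * (L $ p $ q * K $ q $ p)"
        by (simp only: of_real_mult)
    qed
    \<comment> \<open>Exchanging \<open>p\<close> and \<open>q\<close> lets both halves multiply the
      same product of entries of \<open>K\<close> and \<open>L\<close>.\<close>
    also have "(\<Sum>p\<in>UNIV. \<Sum>q\<in>UNIV. complex_of_real (h p * b p * (a q - a p)) * (L $ p $ q * K $ q $ p))
        = (\<Sum>p\<in>UNIV. \<Sum>q\<in>UNIV. of_real (h q * b q * (a p - a q)) * (K $ p $ q * L $ q $ p))"
      by (subst sum.swap) (simp add: mult_ac)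
    also have "(\<Sum>p\<in>UNIV. \<Sum>q\<in>UNIV. complex_of_real (h p * b p * (a q - a p)) * (K $ p $ q * L $ q $ p)) + \<dots>
       = (\<Sum>p\<in>UNIV. \<Sum>q\<in>UNIV. complex_of_real (h p * b p * a q - h p * (a p * b p) + h q * b q * a p - h q * (a q * b q)) * (K $ p $ q * L $ q $ p))"
      unfolding sum.distrib[symmetric] distrib_right[symmetric] of_real_add[symmetric]
      by (intro sum.cong refl arg_cong2[of _ _ _ _ "(*)"] arg_cong[of _ _ complex_of_real]) (simp add: algebra_simps)
    finally show ?thesis .
  qed
  also have "(\<Sum>p\<in>UNIV. \<Sum>q\<in>UNIV. D $ p $ q * (\<i> * of_real (c q * c p * (a p - a q)) * L $ q $ p)) + \<dots>
      = (\<Sum>p\<in>UNIV. \<Sum>q\<in>UNIV. - (of_real (weight p q) * (K $ p $ q * L $ q $ p)))"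
    unfolding sum.distrib[symmetric]
  proof (intro sum.cong refl)
    fix p q
    have eq: "(complex_of_real (m p - 1) - complex_of_real (m q - 1)) * D $ p $ q
        = (complex_of_real (m p powr (z - 1)) - complex_of_real (m q powr (z - 1))) * Mi $ p $ q"
      unfolding D_def M0
    proof (rule matser_deriv_cdiag[where d = "\<lambda>p. complex_of_real (m p - 1)"
            and s = "\<lambda>p. complex_of_real (m p powr (z - 1))", OF pow_summable_gbinomial])
      show "opnorm (cdiag (\<lambda>p. complex_of_real (m p - 1))) < 1" using near0 unfolding M0 .
      show "(\<lambda>k. complex_of_real ((z - 1) gchoose k) * complex_of_real (m p - 1) ^ k) sums complex_of_real (m p powr (z - 1))" for p
        by (rule gbinomial_sums_powr[OF m_near_1])
      then show "(\<lambda>k. complex_of_real ((z - 1) gchoose k) * complex_of_real (m q - 1) ^ k) sums complex_of_real (m q powr (z - 1))" .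
    qed
    have x: "(of_real (a p * b p) - of_real (a q * b q)) * D $ p $ q
        = (of_real (h p) - of_real (h q)) * (\<i> * of_real (c p * c q * (a q - a p)) * K $ p $ q)"
    proof -
      have diff: "complex_of_real (m p - 1) - complex_of_real (m q - 1) = of_real (m p) - of_real (m q)" by simp
      show ?thesis using eq unfolding diff Mi_nth h_def m[symmetric] .
    qed
    have "D $ p $ q * (\<i> * of_real (c q * c p * (a p - a q)) * L $ q $ p)
      + complex_of_real (h p * b p * a q - h p * (a p * b p) + h q * b q * a p - h q * (a q * b q)) * (K $ p $ q * L $ q $ p)
      = complex_of_real (- ((a p - a q) * (b p - b q) * (h p * (a p * b p) - h q * (a q * b q)) / (a p * b p - a q * b q))) * (K $ p $ q * L $ q $ p)"
    proof (rule second_derivative_coefficient[where a = a and b = b and c = c and h = h and p = p and q = q, OF _ x c c])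
      show "a p = a q \<and> b p = b q" if "a p * b p = a q * b q"
        by (rule deg) (simp only: m that)
      have "h p = h q" if "a p * b p = a q * b q" by (simp only: h_def m that)
      then show "h p = h q \<or> a p * b p \<noteq> a q * b q" by blast
    qed
    moreover have "(a p - a q) * (b p - b q) * (h p * (a p * b p) - h q * (a q * b q)) / (a p * b p - a q * b q) = weight p q"
      unfolding weight_def m h_mult_m ..
    ultimately show "D $ p $ q * (\<i> * of_real (c q * c p * (a p - a q)) * L $ q $ p)
      + complex_of_real (h p * b p * a q - h p * (a p * b p) + h q * b q * a p - h q * (a q * b q)) * (K $ p $ q * L $ q $ p)
      = - (of_real (weight p q) * (K $ p $ q * L $ q $ p))"
      by (simp only: of_real_minus mult_minus_left)
  qed
  finally show ?thesis by (simp add: Trij_def sum_negf)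
qed

text \<open>Conjugation exchanges \<open>p\<close> and \<open>q\<close> because \<open>K\<close> and
  \<open>L\<close> are Hermitian, and the weights are symmetric. This links the real information
  matrix to the complex expectation.\<close>

lemma Trij_real: "complex_of_real (Re Trij) = Trij"
proof -
  have sym: "weight q p = weight p q" for p q
  proof -
    have "(a q - a p) * (b q - b p) = (a p - a q) * (b p - b q)" by (simp add: algebra_simps)
    moreover have "(r q - r p) / (m q - m p) = (r p - r q) / (m p - m q)"
      using minus_divide_divide[of "r p - r q" "m p - m q"] by simp
    ultimately show ?thesis unfolding weight_def by (metis times_divide_eq_right)
  qed
  have "cnj Trij = - complex_of_real z * (\<Sum>p\<in>UNIV. \<Sum>q\<in>UNIV. of_real (weight p q) * (K $ q $ p * L $ p $ q))"
    unfolding Trij_def by (simp add: K_L_hermitian)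
  also have "\<dots> = Trij"
    unfolding Trij_def by (subst sum.swap) (simp add: sym)
  finally show ?thesis by (metis Reals_cnj_iff of_real_Re)
qed

lemma partial_deriv_ln_Tr:
  assumes y: "y \<in> near"
  shows "has_partial_at j (\<lambda>y. k * ln (Re (Tr y))) y"
    "partial_deriv j (\<lambda>y. k * ln (Re (Tr y))) y = k * (Re (Trj y) / Re (Tr y))"
proof -
  have "((\<lambda>s. Re (Tr (y + s *\<^sub>R axis j 1))) has_real_derivative Re (Trj y)) (at 0)"
    using bounded_linear.has_vector_derivative[OF bounded_linear_Re has_vector_derivative_Tr_j[OF y]]
    by (simp add: has_real_derivative_iff_has_vector_derivative)
  moreover have "((\<lambda>s. k * ln (f s)) has_real_derivative k * (d / f 0)) (at 0)"
    if "(f has_real_derivative d) (at 0)" "0 < f 0" for f :: "real \<Rightarrow> real" and d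
    using that by (auto intro!: derivative_eq_intros)
  ultimately have "((\<lambda>s. k * ln (Re (Tr (y + s *\<^sub>R axis j 1)))) has_real_derivative k * (Re (Trj y) / Re (Tr y))) (at 0)"
    using Tr_pos[OF y] by fastforce
  then show "has_partial_at j (\<lambda>y. k * ln (Re (Tr y))) y"
    "partial_deriv j (\<lambda>y. k * ln (Re (Tr y))) y = k * (Re (Trj y) / Re (Tr y))"
    unfolding has_partial_at_def partial_deriv_def field_differentiable_def by (auto intro: DERIV_imp_deriv)
qed

text \<open>The first partial derivative is \<open>k * Trj / Tr\<close> in real parts. As
  \<open>Tr 0 = 1\<close> and \<open>Trj 0 = 0\<close>, the quotient rule leaves only the derivative
  of \<open>Trj\<close>.\<close>

lemma second_partial_deriv_ln_Tr:
  "has_second_partial_at i j (\<lambda>y. k * ln (Re (Tr y))) 0"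
  "partial_deriv i (partial_deriv j (\<lambda>y. k * ln (Re (Tr y)))) 0 = k * Re Trij"
proof -
  let ?R = "\<lambda>y. k * ln (Re (Tr y))"
  have "((\<lambda>s. Re (Tr (s *\<^sub>R axis i 1))) has_real_derivative 0) (at 0)"
    "((\<lambda>s. Re (Trj (s *\<^sub>R axis i 1))) has_real_derivative Re Trij) (at 0)"
    using bounded_linear.has_vector_derivative[OF bounded_linear_Re has_vector_derivative_Tr_i]
      bounded_linear.has_vector_derivative[OF bounded_linear_Re has_vector_derivative_Trj]
    by (simp_all add: has_real_derivative_iff_has_vector_derivative)
  moreover have "((\<lambda>s. k * (g s / f s)) has_real_derivative k * d) (at 0)"
    if "(f has_real_derivative 0) (at 0)" "(g has_real_derivative d) (at 0)" "f 0 = 1" "g 0 = 0"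
    for f g :: "real \<Rightarrow> real" and d
    using that by (auto intro!: derivative_eq_intros)
  ultimately have "((\<lambda>s. k * (Re (Trj (s *\<^sub>R axis i 1)) / Re (Tr (s *\<^sub>R axis i 1)))) has_real_derivative k * Re Trij) (at 0)"
    by (simp add: Tr_0 Trj_0)
  \<comment> \<open>The formula for the first partial derivative holds only in \<open>near\<close>,
    which suffices for a derivative at 0.\<close>
  moreover have "\<forall>\<^sub>F s in nhds 0. k * (Re (Trj (s *\<^sub>R axis i 1)) / Re (Tr (s *\<^sub>R axis i 1)))
      = partial_deriv j ?R (0 + s *\<^sub>R axis i 1)"
    using eventually_line_in_near[OF zero_in_near, of "axis i 1"]
    by eventually_elim (simp add: partial_deriv_ln_Tr)
  ultimately have d: "((\<lambda>s. partial_deriv j ?R (0 + s *\<^sub>R axis i 1)) has_real_derivative k * Re Trij) (at 0)"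
    by (subst DERIV_cong_ev[OF refl _ refl, symmetric]) auto
  have "\<forall>\<^sub>F y in nhds 0. y \<in> near" using open_near zero_in_near by (rule eventually_nhds_in_open)
  then have "\<forall>\<^sub>F y in nhds 0. has_partial_at j ?R y" by eventually_elim (rule partial_deriv_ln_Tr)
  then show "has_second_partial_at i j ?R 0"
    unfolding has_second_partial_at_def
  proof
    show "has_partial_at i (partial_deriv j ?R) 0"
      unfolding has_partial_at_def field_differentiable_def using d by blast
  qed
  show "partial_deriv i (partial_deriv j ?R) 0 = k * Re Trij"
    unfolding partial_deriv_def[of i] by (rule DERIV_imp_deriv[OF d])
qed

end

section \<open>The information matrix\<close>

lemma hamiltonian_line: "hamiltonian H (\<phi> + s *\<^sub>R axis k 1) = hamiltonian H \<phi> + s *\<^sub>R H k"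
proof -
  have "(s * axis k (1 :: real) $ l) *\<^sub>R H l = (if l = k then s *\<^sub>R H l else 0)" for l
    by (simp add: axis_def)
  then show ?thesis by (simp add: hamiltonian_def scaleR_add_left sum.distrib)
qed

lemma has_vector_derivative_hamiltonian:
  "((\<lambda>s. cscale \<i> (hamiltonian H (\<phi> + s *\<^sub>R axis k 1))) has_vector_derivative cscale \<i> (H k)) (at 0)"
proof -
  have "((\<lambda>s. hamiltonian H \<phi> + s *\<^sub>R H k) has_vector_derivative H k) (at 0)"
    by (auto intro!: derivative_eq_intros)
  from bounded_linear.has_vector_derivative[OF bounded_linear_cscale this]
  show ?thesis unfolding hamiltonian_line .
qed

lemma continuous_on_mat_exp_hamiltonian:
  "continuous_on UNIV (\<lambda>y. mat_exp (cscale \<i> (hamiltonian H (\<phi> + y))))"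
proof (rule continuous_on_compose2[of UNIV mat_exp])
  show "continuous_on UNIV mat_exp"
    by (intro continuous_at_imp_continuous_on ballI has_derivative_continuous[OF has_derivative_mat_exp])
  show "continuous_on UNIV (\<lambda>y. cscale \<i> (hamiltonian H (\<phi> + y)))"
    unfolding hamiltonian_def
    by (intro bounded_linear.continuous_on[OF bounded_linear_cscale] continuous_intros)
qed simp

lemma unitary_conj_mult:
  assumes "unitary V"
  shows "(V ** A ** dagger V) ** (V ** B ** dagger V) = V ** (A ** B) ** dagger V"
  by (simp add: matrix_mul_assoc[symmetric] unitary_cancel[OF assms])

lemma unitary_conj_commutator:
  fixes A B :: "complex^'n^'n"
  assumes "unitary V"
  shows "commutator (V ** A ** dagger V) (V ** B ** dagger V) = V ** commutator A B ** dagger V"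
  unfolding commutator_def unitary_conj_mult[OF assms]
  by (rule linear_diff[OF bounded_linear.linear[OF bounded_linear_sandwich], symmetric])

lemma expect_unitary_conj:
  assumes "unitary V"
  shows "expect (V ** R ** dagger V) (V ** X ** dagger V) = trace (X ** R)"
  unfolding expect_def unitary_conj_mult[OF assms] by (rule trace_unitary_conj[OF assms])

text \<open>The inner commutator multiplies entries by eigenvalue gaps; after exchanging
  \<open>p\<close> and \<open>q\<close> in one half, the outer one contributes
  \<open>r p - r q\<close>. The result has the shape of \<open>Trij\<close>.\<close>

lemma trace_commutator_diag:
  fixes P L :: "complex^'n^'n"
  shows "trace (commutator P (commutator (real_diag g) L) ** real_diag r)
    = (\<Sum>p\<in>UNIV. \<Sum>q\<in>UNIV. complex_of_real ((g q - g p) * (r p - r q)) * (P $ p $ q * L $ q $ p))"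
proof -
  define C where "C = commutator (real_diag g) L"
  have C: "C $ p $ q = complex_of_real (g p - g q) * L $ p $ q" for p q
    by (simp add: C_def commutator_def real_diag_eq_cdiag cdiag_mult_nth mult_cdiag_nth left_diff_distrib mult.commute[of "L $ p $ q"])
  have "trace (commutator P C ** real_diag r) = (\<Sum>p\<in>UNIV. ((P ** C) $ p $ p - (C ** P) $ p $ p) * complex_of_real (r p))"
    by (simp add: trace_def real_diag_eq_cdiag mult_cdiag_nth commutator_def)
  also have "\<dots> = (\<Sum>p\<in>UNIV. \<Sum>q\<in>UNIV. P $ p $ q * C $ q $ p * of_real (r p)) - (\<Sum>p\<in>UNIV. \<Sum>q\<in>UNIV. C $ p $ q * P $ q $ p * of_real (r p))"
    by (simp add: matrix_matrix_mult_def left_diff_distrib sum_distrib_right sum_subtractf)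
  also have "(\<Sum>p\<in>UNIV. \<Sum>q\<in>UNIV. C $ p $ q * P $ q $ p * of_real (r p)) = (\<Sum>p\<in>UNIV. \<Sum>q\<in>UNIV. C $ q $ p * P $ p $ q * of_real (r q))"
    by (rule sum.swap)
  also have "(\<Sum>p\<in>UNIV. \<Sum>q\<in>UNIV. P $ p $ q * C $ q $ p * of_real (r p)) - \<dots>
      = (\<Sum>p\<in>UNIV. \<Sum>q\<in>UNIV. complex_of_real ((g q - g p) * (r p - r q)) * (P $ p $ q * L $ q $ p))"
    unfolding sum_subtractf[symmetric]
  proof (intro sum.cong refl)
    fix p q
    have "x * (y * w) * u - y * w * x * v = (y * (u - v)) * (x * w)" for x y w u v :: complex
      by (simp add: algebra_simps)
    then show "P $ p $ q * C $ q $ p * of_real (r p) - C $ q $ p * P $ p $ q * of_real (r q)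
        = complex_of_real ((g q - g p) * (r p - r q)) * (P $ p $ q * L $ q $ p)"
      unfolding C by simp
  qed
  finally show ?thesis unfolding C_def .
qed

text \<open>A difference of exponentials is an exponential at the mean times \<open>sinh\<close> of
  half the gap. In the quotient the mean factors cancel, since \<alpha> / z + (1 - \<alpha>) / z = 1
  / z, and the three \<open>sinh\<close> terms of \<open>p_az_hat\<close> remain.\<close>

lemma p_az_hat_weight:
  fixes u v Z \<alpha> z :: real
  assumes \<alpha>: "0 < \<alpha>" "\<alpha> < 1" and z: "0 < z" and Z: "0 < Z"
  defines "f s \<equiv> \<lambda>x. (exp (- x) / Z) powr s"
  shows "p_az_hat \<alpha> z (u - v) * ((v - u) * (exp (- u) / Z - exp (- v) / Z))
    = z / (\<alpha> * (1 - \<alpha>)) * ((f (\<alpha> / z) u - f (\<alpha> / z) v) * (f ((1 - \<alpha>) / z) u - f ((1 - \<alpha>) / z) v)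
         * (exp (- u) / Z - exp (- v) / Z) / (f (1 / z) u - f (1 / z) v))"
proof (cases "u = v")
  case False
  \<comment> \<open>The mean of \<open>u + ln Z\<close> and \<open>v + ln Z\<close>; the logarithm
    absorbs the normalisation of the Gibbs state.\<close>
  define S where "S = (u + v + 2 * ln Z) / 2"
  define x where "x = u - v"
  have x: "x \<noteq> 0" using False by (simp add: x_def)
  have f: "f s w = exp (- s * (w + ln Z))" for s w
  proof -
    have "exp (- w) / Z = exp (- (w + ln Z))" using Z by (simp add: exp_diff exp_minus exp_add field_simps)
    then show ?thesis unfolding f_def by (simp add: powr_def algebra_simps)
  qed
  have d: "f s u - f s v = - 2 * exp (- s * S) * sinh (s * x / 2)" for s
  proof -
    have "- s * (u + ln Z) = - s * S + - (s * x / 2)" "- s * (v + ln Z) = - s * S + s * x / 2"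
      unfolding S_def x_def by (simp_all add: field_simps)
    then show ?thesis unfolding f by (simp only: exp_add) (simp add: sinh_def algebra_simps)
  qed
  have e: "exp (- (\<alpha> / z) * S) * exp (- ((1 - \<alpha>) / z) * S) = exp (- (1 / z) * S)"
    by (simp add: exp_add[symmetric] diff_divide_distrib algebra_simps)
  have s: "sinh (1 / z * x / 2) \<noteq> 0" using x z by simp
  have "(f (\<alpha> / z) u - f (\<alpha> / z) v) * (f ((1 - \<alpha>) / z) u - f ((1 - \<alpha>) / z) v) / (f (1 / z) u - f (1 / z) v)
      = (4 * (exp (- (\<alpha> / z) * S) * exp (- ((1 - \<alpha>) / z) * S)) * (sinh (\<alpha> / z * x / 2) * sinh ((1 - \<alpha>) / z * x / 2)))
        / (- 2 * exp (- (1 / z) * S) * sinh (1 / z * x / 2))"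
    unfolding d by (simp add: mult_ac)
  also have "\<dots> = - 2 * (sinh (\<alpha> / z * x / 2) * sinh ((1 - \<alpha>) / z * x / 2) / sinh (1 / z * x / 2))"
    unfolding e using s by (simp add: field_simps)
  finally have quot: "(f (\<alpha> / z) u - f (\<alpha> / z) v) * (f ((1 - \<alpha>) / z) u - f ((1 - \<alpha>) / z) v) / (f (1 / z) u - f (1 / z) v)
      = - 2 * (sinh (\<alpha> / z * x / 2) * sinh ((1 - \<alpha>) / z * x / 2) / sinh (1 / z * x / 2))" .
  have arg: "\<alpha> * x / (2 * z) = \<alpha> / z * x / 2" "(1 - \<alpha>) * x / (2 * z) = (1 - \<alpha>) / z * x / 2" "x / (2 * z) = 1 / z * x / 2"
    by (simp_all add: field_simps)
  define Q where "Q = sinh (\<alpha> / z * x / 2) * sinh ((1 - \<alpha>) / z * x / 2) / sinh (1 / z * x / 2)"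
  define R where "R = exp (- u) / Z - exp (- v) / Z"
  have "p_az_hat \<alpha> z x = 2 * z / (\<alpha> * (1 - \<alpha>) * x) * Q"
    unfolding p_az_hat_def arg Q_def using x by simp
  then have "p_az_hat \<alpha> z x * (- x * R) = 2 * z / (\<alpha> * (1 - \<alpha>) * x) * Q * (- x * R)" by (simp only:)
  also have "\<dots> = z / (\<alpha> * (1 - \<alpha>)) * (- 2 * Q * R)"
    using x \<alpha> by (simp add: field_simps)
  also have "- 2 * Q * R = (f (\<alpha> / z) u - f (\<alpha> / z) v) * (f ((1 - \<alpha>) / z) u - f ((1 - \<alpha>) / z) v) * R / (f (1 / z) u - f (1 / z) v)"
    unfolding Q_def quot[symmetric] by simp
  finally show ?thesis unfolding R_def x_def by simp
qed simp

lemma gibbs_diag: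
  fixes V :: "complex^'n^'n"
  assumes V: "unitary V"
  shows "gibbs (V ** real_diag g ** dagger V) = V ** real_diag (\<lambda>p. exp (- g p) / (\<Sum>q\<in>UNIV. exp (- g q))) ** dagger V"
proof -
  have "cscale (- 1) (V ** real_diag g ** dagger V) = - (V ** real_diag g ** dagger V)"
    by (simp add: cscale_def vec_eq_iff)
  then have e: "mat_exp (- (V ** real_diag g ** dagger V)) = V ** cdiag (\<lambda>p. complex_of_real (exp (- g p))) ** dagger V"
    using mat_exp_cscale_diag[OF V, of "- 1" g] by (simp add: exp_of_real[symmetric])
  have "cscale (1 / complex_of_real (\<Sum>q\<in>UNIV. exp (- g q))) (V ** cdiag (\<lambda>p. complex_of_real (exp (- g p))) ** dagger V)
      = V ** cscale (1 / complex_of_real (\<Sum>q\<in>UNIV. exp (- g q))) (cdiag (\<lambda>p. complex_of_real (exp (- g p)))) ** dagger V"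
    by (simp only: cscale_mult_left cscale_mult_right)
  then show ?thesis
    unfolding gibbs_def e unfolding trace_unitary_conj[OF V] trace_cdiag of_real_sum[symmetric] cscale_cdiag real_diag_eq_cdiag
    by simp
qed

theorem theorem35:
  fixes H :: "'l::finite \<Rightarrow> complex^'n^'n" and G :: "complex^'n^'n"
    and \<alpha> z :: real and \<phi> :: "real^'l" and i j :: 'l
  assumes "\<And>k. hermitian (H k)" and "hermitian G"
    and "0 < \<alpha>" and "\<alpha> < 1" and "0 < z"
  shows "is_prob_density (p_az \<alpha> z)
    \<and> is_channel (Psi H \<phi>)
    \<and> is_channel (Phi (p_az \<alpha> z) G)
    \<and> has_second_partial_at i j
        (\<lambda>\<epsilon>. renyi_az \<alpha> z (evolved H (gibbs G) \<phi>) (evolved H (gibbs G) (\<phi> + \<epsilon>))) 0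
    \<and> complex_of_real (info_matrix \<alpha> z (evolved H (gibbs G)) \<phi> $ i $ j)
        = expect (gibbs G)
            (commutator (Phi (p_az \<alpha> z) G (Psi H \<phi> (H i))) (commutator G (Psi H \<phi> (H j))))"
proof (intro conjI)
  note H = assms(1) and \<alpha> = assms(3,4) and z = assms(5)
  note phat = has_bochner_integral_p_az_cis[OF \<alpha> z]
  show density: "is_prob_density (p_az \<alpha> z)" by (rule is_prob_density_p_az[OF \<alpha> z])
  show "is_channel (Psi H \<phi>)" by (rule is_channel_Psi[OF H])
  show "is_channel (Phi (p_az \<alpha> z) G)"
    using density unfolding is_prob_density_def
    by (intro is_channel_Phi[OF assms(2) _ phat]) (simp_all add: p_az_hat_def)

  obtain V g where V: "unitary V" and G: "G = V ** real_diag g ** dagger V"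
    using hermitian_spectral[OF assms(2)] .
  define Z where "Z = (\<Sum>q\<in>UNIV. exp (- g q))"
  have Z: "0 < Z" unfolding Z_def by (rule sum_pos) auto
  define r where "r p = exp (- g p) / Z" for p
  have rho: "gibbs G = V ** real_diag r ** dagger V"
    unfolding G gibbs_diag[OF V] r_def Z_def ..
  have r0: "0 < r p" for p unfolding r_def using Z by simp
  have sum_r: "(\<Sum>p\<in>UNIV. r p) = 1"
    unfolding r_def sum_divide_distrib[symmetric] Z_def[symmetric] using Z by simp
  have r1: "r p \<le> 1" for p
    unfolding sum_r[symmetric] using r0 by (intro member_le_sum) (auto intro: less_imp_le)
  define a b c m where "a p = r p powr (\<alpha> / z)" and "b p = r p powr ((1 - \<alpha>) / z)"
    and "c p = r p powr ((1 - \<alpha>) / (2 * z))" and "m p = r p powr (1 / z)" for p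

  define E where "E y = mat_exp (cscale \<i> (hamiltonian H (\<phi> + y)))" for y
  define E' where "E' k y = matser_deriv (\<lambda>n. 1 / fact n) (cscale \<i> (hamiltonian H (\<phi> + y))) (cscale \<i> (H k))" for k y
  have E_minus: "mat_exp (cscale (- \<i>) (hamiltonian H (\<phi> + y))) = dagger (E y)"
    and uE: "unitary (E y)" for y
  proof -
    have "unitary (mat_exp (cscale (- \<i>) (hamiltonian H (\<phi> + y))))"
      and e: "dagger (mat_exp (cscale (- \<i>) (hamiltonian H (\<phi> + y)))) = E y"
      using mat_exp_i_hermitian[where t = 1, OF hermitian_hamiltonian[of H "\<phi> + y", OF H]] by (simp_all add: E_def)
    then show "unitary (E y)" using unitary_dagger by metis
    show "mat_exp (cscale (- \<i>) (hamiltonian H (\<phi> + y))) = dagger (E y)" unfolding e[symmetric] by simp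
  qed
  have dE: "((\<lambda>s. E (y + s *\<^sub>R axis k 1)) has_vector_derivative E' k y) (at 0)" for k y
    unfolding E_def E'_def add.assoc[symmetric]
    by (rule has_vector_derivative_chain[OF _ has_vector_derivative_hamiltonian]) (simp add: has_derivative_mat_exp)
  define E'' where "E'' = (\<Sum>k. (1 / fact k) *\<^sub>R matpow_deriv2 k (cscale \<i> (hamiltonian H \<phi>)) (cscale \<i> (H j)) (cscale \<i> (H i)))"
  have dE': "((\<lambda>s. E' j (s *\<^sub>R axis i 1)) has_vector_derivative E'') (at 0)"
    unfolding E'_def E''_def
    by (rule has_vector_derivative_chain[OF _ has_vector_derivative_hamiltonian]) (simp add: has_derivative_mat_exp_deriv)

  \<comment> \<open>The rotation relating the states at \<phi> and \<phi> + y, written in the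
    eigenbasis of \<open>G\<close>. By unitary invariance the divergence depends on nothing
    else.\<close>
  define W where "W y = dagger V ** E y ** (dagger (E 0) ** V)" for y
  define W' where "W' k y = dagger V ** E' k y ** (dagger (E 0) ** V)" for k y
  define W'' where "W'' = dagger V ** E'' ** (dagger (E 0) ** V)"
  define K L where "K = dagger V ** Psi H \<phi> (H i) ** V" and "L = dagger V ** Psi H \<phi> (H j) ** V"
  have W'0: "W' k 0 = cscale \<i> (dagger V ** Psi H \<phi> (H k) ** V)" for k
  proof -
    have "E' k 0 ** dagger (E 0) = cscale \<i> (Psi H \<phi> (H k))"
      using mat_exp_deriv_eq_Psi[of H \<phi> "H k", OF H] unfolding E_minus[of 0, symmetric] by (simp add: E'_def)
    then have "W' k 0 = dagger V ** cscale \<i> (Psi H \<phi> (H k)) ** V"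
      unfolding W'_def by (metis matrix_mul_assoc)
    then show ?thesis by (simp only: cscale_mult_left cscale_mult_right)
  qed
  interpret unitary_family W "W' j" "W' i 0" W'' K L a b c r m z i j
  proof
    show "unitary (W y)" for y
      unfolding W_def by (intro unitary_mult unitary_dagger V uE)
    show "W 0 = mat 1"
      unfolding W_def using V by (simp add: matrix_mul_assoc[symmetric] unitary_cancel[OF uE] unitary_def)
    show "continuous_on UNIV W"
      unfolding W_def E_def by (intro bounded_linear.continuous_on[OF bounded_linear_sandwich] continuous_on_mat_exp_hamiltonian)
    show "((\<lambda>s. W (y + s *\<^sub>R axis j 1)) has_vector_derivative W' j y) (at 0)" for y
      unfolding W_def W'_def by (rule has_vector_derivative_sandwich[OF dE])
    show "((\<lambda>s. W (s *\<^sub>R axis i 1)) has_vector_derivative W' i 0) (at 0)"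
      unfolding W_def W'_def using has_vector_derivative_sandwich[OF dE[where y = 0]] by simp
    show "((\<lambda>s. W' j (s *\<^sub>R axis i 1)) has_vector_derivative W'') (at 0)"
      unfolding W'_def W''_def by (rule has_vector_derivative_sandwich[OF dE'])
    show "W' i 0 = cscale \<i> K" "W' j 0 = cscale \<i> L" unfolding W'0 K_def L_def by (rule refl)+
    show "c p * c p = b p" for p
    proof -
      have "(1 - \<alpha>) / (2 * z) + (1 - \<alpha>) / (2 * z) = (1 - \<alpha>) / z" using z by (simp add: field_simps)
      then show ?thesis unfolding c_def b_def powr_add[symmetric] by simp
    qed
    show "m p = a p * b p" for p
      unfolding a_def b_def m_def powr_add[symmetric] using z by (simp add: add_divide_distrib[symmetric])
    show "0 < m p \<and> m p \<le> 1" for p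
      unfolding m_def using r0[of p] r1[of p] z by (auto intro: powr_le1)
    show "r p = m p powr z" for p
      unfolding m_def powr_powr using r0[of p] z by simp
    show "(\<Sum>p\<in>UNIV. r p) = 1" by (rule sum_r)
    show "a p = a q \<and> b p = b q" if "m p = m q" for p q
    proof -
      have "r p = r q"
        using arg_cong[OF that, of "\<lambda>x. x powr z"] r0[of p] r0[of q] z unfolding m_def powr_powr by simp
      then show ?thesis unfolding a_def b_def by simp
    qed
  qed

  have evolved: "evolved H (gibbs G) (\<phi> + y) = (dagger (E y) ** V) ** real_diag r ** dagger (dagger (E y) ** V)" for y
    unfolding evolved_def E_minus E_def[symmetric] rho by (simp add: dagger_mult matrix_mul_assoc)
  have uEV: "unitary (dagger (E y) ** V)" for y by (intro unitary_mult unitary_dagger uE V)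
  have renyi: "renyi_az \<alpha> z (evolved H (gibbs G) \<phi>) (evolved H (gibbs G) (\<phi> + y)) = 1 / (\<alpha> - 1) * ln (Re (Tr y))" for y
  proof -
    \<comment> \<open>\<open>P\<close> and \<open>Q\<close> diagonalise the two states with the same
      eigenvalues \<open>r\<close>. Pulling \<open>P\<close> out of the product leaves
      \<open>dagger P ** Q = W y\<close>.\<close>
    define P Q where "P = dagger (E y) ** V" and "Q = dagger (E 0) ** V"
    have P: "unitary P" and Q: "unitary Q" unfolding P_def Q_def by (rule uEV)+
    have WPQ: "W y = dagger P ** Q"
      unfolding W_def P_def Q_def dagger_mult by (simp add: matrix_mul_assoc)
    have ev: "evolved H (gibbs G) (\<phi> + y) = P ** real_diag r ** dagger P" "evolved H (gibbs G) \<phi> = Q ** real_diag r ** dagger Q"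
      using evolved[of y] evolved[of 0] by (simp_all add: P_def Q_def)
    have "mat_powr (evolved H (gibbs G) (\<phi> + y)) ((1 - \<alpha>) / (2 * z)) ** mat_powr (evolved H (gibbs G) \<phi>) (\<alpha> / z)
          ** mat_powr (evolved H (gibbs G) (\<phi> + y)) ((1 - \<alpha>) / (2 * z))
        = (P ** real_diag c ** dagger P) ** (Q ** real_diag a ** dagger Q) ** (P ** real_diag c ** dagger P)"
      unfolding ev mat_powr_eq[OF P] mat_powr_eq[OF Q] a_def c_def ..
    also have "\<dots> = P ** sandwiched c a (W y) ** dagger P"
      unfolding sandwiched_def WPQ dagger_mult by (simp add: matrix_mul_assoc)
    finally show ?thesis
      unfolding renyi_az_def Tr_def
      by (simp only: mat_powr_unitary_conj[OF P hermitian_sandwiched] trace_unitary_conj[OF P])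
  qed
  show "has_second_partial_at i j
      (\<lambda>\<epsilon>. renyi_az \<alpha> z (evolved H (gibbs G) \<phi>) (evolved H (gibbs G) (\<phi> + \<epsilon>))) 0"
    unfolding renyi by (rule second_partial_deriv_ln_Tr)

  have "info_matrix \<alpha> z (evolved H (gibbs G)) \<phi> $ i $ j = 1 / \<alpha> * (1 / (\<alpha> - 1) * Re Trij)"
    unfolding info_matrix_def renyi vec_lambda_beta second_partial_deriv_ln_Tr ..
  then have "complex_of_real (info_matrix \<alpha> z (evolved H (gibbs G)) \<phi> $ i $ j)
      = complex_of_real (1 / \<alpha> * (1 / (\<alpha> - 1))) * Trij"
    using Trij_real by (simp only: of_real_mult mult.assoc)
  also have "\<dots> = complex_of_real (1 / \<alpha> * (1 / (\<alpha> - 1)) * - z)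
      * (\<Sum>p\<in>UNIV. \<Sum>q\<in>UNIV. complex_of_real (weight p q) * (K $ p $ q * L $ q $ p))"
    unfolding Trij_def by (simp only: of_real_mult of_real_minus mult.assoc)
  \<comment> \<open>The sign of \<open>Trij\<close> cancels the negative factor \<alpha> - 1,
    leaving the prefactor found in \<open>p_az_hat_weight\<close>.\<close>
  also have "1 / \<alpha> * (1 / (\<alpha> - 1)) * - z = z / (\<alpha> * (1 - \<alpha>))"
    using \<alpha> by (simp add: field_simps)
  \<comment> \<open>The inserted matrix is the eigenbasis form of \<open>Phi\<close> applied to
    \<open>Psi H \<phi> (H i)\<close>, written so that \<open>trace_commutator_diag\<close> applies
    in reverse.\<close>
  also have "complex_of_real (z / (\<alpha> * (1 - \<alpha>))) * (\<Sum>p\<in>UNIV. \<Sum>q\<in>UNIV. complex_of_real (weight p q) * (K $ p $ q * L $ q $ p))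
      = (\<Sum>p\<in>UNIV. \<Sum>q\<in>UNIV. complex_of_real ((g q - g p) * (r p - r q)) * ((\<chi> p q. complex_of_real (p_az_hat \<alpha> z (g p - g q)) * K $ p $ q) $ p $ q * L $ q $ p))"
    unfolding sum_distrib_left
  proof (intro sum.cong refl)
    fix p q
    have "z / (\<alpha> * (1 - \<alpha>)) * weight p q = p_az_hat \<alpha> z (g p - g q) * ((g q - g p) * (r p - r q))"
      using p_az_hat_weight[OF \<alpha> z Z, of "g p" "g q"] unfolding weight_def a_def b_def m_def r_def by simp
    then have "complex_of_real (z / (\<alpha> * (1 - \<alpha>))) * complex_of_real (weight p q)
        = complex_of_real (p_az_hat \<alpha> z (g p - g q)) * complex_of_real ((g q - g p) * (r p - r q))"
      by (simp only: of_real_mult[symmetric])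
    then show "complex_of_real (z / (\<alpha> * (1 - \<alpha>))) * (complex_of_real (weight p q) * (K $ p $ q * L $ q $ p))
      = complex_of_real ((g q - g p) * (r p - r q)) * ((\<chi> p q. complex_of_real (p_az_hat \<alpha> z (g p - g q)) * K $ p $ q) $ p $ q * L $ q $ p)"
      by (simp only: mult.assoc[symmetric] vec_lambda_beta) (simp only: mult_ac)
  qed
  also have "\<dots> = expect (gibbs G) (commutator (Phi (p_az \<alpha> z) G (Psi H \<phi> (H i))) (commutator G (Psi H \<phi> (H j))))"
  proof -
    have "Psi H \<phi> (H j) = V ** L ** dagger V"
      unfolding L_def by (simp add: matrix_mul_assoc[symmetric] unitary_cancel[OF V]) (simp add: matrix_mul_assoc unitary_cancel[OF V])
    then have "commutator G (Psi H \<phi> (H j)) = V ** commutator (real_diag g) L ** dagger V"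
      unfolding G by (simp only: unitary_conj_commutator[OF V])
    then show ?thesis
      unfolding Phi_eigenbasis[OF V G phat] K_def[symmetric] rho
      by (simp only: unitary_conj_commutator[OF V] expect_unitary_conj[OF V] trace_commutator_diag)
  qed
  finally show "complex_of_real (info_matrix \<alpha> z (evolved H (gibbs G)) \<phi> $ i $ j)
        = expect (gibbs G)
            (commutator (Phi (p_az \<alpha> z) G (Psi H \<phi> (H i))) (commutator G (Psi H \<phi> (H j))))" .
qed

end
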